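(* Let $\alpha>0$ and $m>-1$ with $\alpha>m$, and let $\lambda$ satisfy $0<\lambda<\frac{2(\alpha-m)}{1+m}$. Then there is $n_0=n_0(\lambda,\alpha,m)>0$ such that for every $n\in(0,n_0)$ the following hold: $(\alpha,m,n)$ satisfies $-\alpha+m+n<0$; $\lambda$ satisfies $0<\lambda<\frac{2(\alpha-m-n)(1+m)}{(1+m+n)^2}$; and system (S) (with these parameters) admits a heteroclinic orbit $\chi(\eta)=(p,q,r,s)(\eta)$, $\eta\in\mathbb{R}$, with $\chi(\eta)\to M_0$ as $\eta\to-\infty$, $\chi(\eta)\to M_1$ as $\eta\to+\infty$, and $$e^{-2\eta}\big(\chi(\eta)-M_0\big)\to\kappa X_{01}\quad\text{as }\eta\to-\infty$$ for some constant $\kappa\neq 0$.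
   Context: Parameters: $\alpha>0$, $m>-1$, $n>0$, $\lambda>0$. Set $D=1+2\alpha-m-n$, $a=\frac{2+2\alpha-n}{D}+\frac{2(1+\alpha)}{D}\lambda$, $b=\frac{1+m}{D}+\frac{1+m+n}{D}\lambda$. System (S) for $(p,q,r,s)(\eta)$, with $\dot{}=d/d\eta$: $\dot p=p\big(\tfrac1\lambda(r-a)+2-\lambda pr-q\big)$, $\dot q=q(1-\lambda pr-q)+bpr$, $n\dot r=r\Big(\tfrac{\alpha-m-n}{\lambda(1+\alpha)}(r-a)+\lambda pr+q+\tfrac{\alpha}{\lambda}r\big(s-\tfrac{1+m+n}{1+\alpha}\big)+\tfrac{n\alpha}{\lambda(1+\alpha)}\Big)$, $\dot s=s\Big(\tfrac{\alpha-m-n}{\lambda(1+\alpha)}(r-a)+\lambda pr+q-\tfrac1\lambda r\big(s-\tfrac{1+m+n}{1+\alpha}\big)-\tfrac{n}{\lambda(1+\alpha)}\Big)$. Equilibria: $M_0=(0,0,r_0,s_0)$ with $r_0=a$, $s_0=\frac{1+m+n}{1+\alpha}-\frac{n}{(1+\alpha)r_0}$; $M_1=(0,1,r_1,s_1)$ with $r_1=a-\frac{1+\alpha}{\alpha-m-n}\lambda$, $s_1=\frac{1+m+n}{1+\alpha}-\frac{n}{(1+\alpha)r_1}$. $X_{01}=(1,\,br_0,\,y_1,\,z_1)^T$, where $y_1=-(\lambda+b)r_0\frac{\frac{1+\alpha}{\lambda}r_0+\frac{2}{s_0}}{\Delta_1}$, $z_1=-(\lambda+b)r_0\frac{\frac{n}{r_0}(\frac1\lambda+2)}{\Delta_1}$,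 $\Delta_1=\frac{1-s_0}{\lambda}\big(\frac{1+\alpha}{\lambda}r_0+\frac2{s_0}\big)-\frac{n}{r_0}\big(\frac1\lambda+2\big)\big(\frac{r_0}{\lambda}+\frac2{s_0}\big)$; it is an eigenvector of the Jacobian of (S) at $M_0$ for the eigenvalue $2$. *)

theory Defs
  imports "HOL-Analysis.Analysis"
begin

definition DD :: "real \<Rightarrow> real \<Rightarrow> real \<Rightarrow> real" where
  "DD al m n = 1 + 2*al - m - n"

definition aa :: "real \<Rightarrow> real \<Rightarrow> real \<Rightarrow> real \<Rightarrow> real" where
  "aa al m n lam = (2 + 2*al - n) / DD al m n + (2*(1+al)) / DD al m n * lam"

definition bb :: "real \<Rightarrow> real \<Rightarrow> real \<Rightarrow> real \<Rightarrow> real" where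
  "bb al m n lam = (1 + m) / DD al m n + (1 + m + n) / DD al m n * lam"

text \<open>Right-hand sides of system (S); the r-equation is n r' = ..., hence divided by n.\<close>

definition Fp :: "real \<Rightarrow> real \<Rightarrow> real \<Rightarrow> real \<Rightarrow> real \<Rightarrow> real \<Rightarrow> real \<Rightarrow> real \<Rightarrow> real" where
  "Fp al m n lam p q r s = p * ((1/lam)*(r - aa al m n lam) + 2 - lam*p*r - q)"

definition Fq :: "real \<Rightarrow> real \<Rightarrow> real \<Rightarrow> real \<Rightarrow> real \<Rightarrow> real \<Rightarrow> real \<Rightarrow> real \<Rightarrow> real" where
  "Fq al m n lam p q r s = q * (1 - lam*p*r - q) + bb al m n lam * p * r"

definition Fr :: "real \<Rightarrow> real \<Rightarrow> real \<Rightarrow> real \<Rightarrow> real \<Rightarrow> real \<Rightarrow> real \<Rightarrow> real \<Rightarrow> real" where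
  "Fr al m n lam p q r s = (1/n) * (r * ((al - m - n) / (lam*(1+al)) * (r - aa al m n lam)
      + lam*p*r + q + (al/lam) * r * (s - (1+m+n)/(1+al)) + (n*al) / (lam*(1+al))))"

definition Fs :: "real \<Rightarrow> real \<Rightarrow> real \<Rightarrow> real \<Rightarrow> real \<Rightarrow> real \<Rightarrow> real \<Rightarrow> real \<Rightarrow> real" where
  "Fs al m n lam p q r s = s * ((al - m - n) / (lam*(1+al)) * (r - aa al m n lam)
      + lam*p*r + q - (1/lam) * r * (s - (1+m+n)/(1+al)) - n / (lam*(1+al)))"

text \<open>Equilibria M0 = (0,0,r0,s0), M1 = (0,1,r1,s1).\<close>

definition r0 :: "real \<Rightarrow> real \<Rightarrow> real \<Rightarrow> real \<Rightarrow> real" where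
  "r0 al m n lam = aa al m n lam"

definition s0 :: "real \<Rightarrow> real \<Rightarrow> real \<Rightarrow> real \<Rightarrow> real" where
  "s0 al m n lam = (1+m+n)/(1+al) - n / ((1+al) * r0 al m n lam)"

definition r1 :: "real \<Rightarrow> real \<Rightarrow> real \<Rightarrow> real \<Rightarrow> real" where
  "r1 al m n lam = aa al m n lam - (1+al)/(al - m - n) * lam"

definition s1 :: "real \<Rightarrow> real \<Rightarrow> real \<Rightarrow> real \<Rightarrow> real" where
  "s1 al m n lam = (1+m+n)/(1+al) - n / ((1+al) * r1 al m n lam)"

text \<open>Eigenvector X01 = (1, b r0, y1, z1).\<close>

definition Delta1 :: "real \<Rightarrow> real \<Rightarrow> real \<Rightarrow> real \<Rightarrow> real" where
  "Delta1 al m n lam =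
     (let r = r0 al m n lam; s = s0 al m n lam in
       (1 - s)/lam * ((1+al)/lam * r + 2/s) - n/r * (1/lam + 2) * (r/lam + 2/s))"

definition y1 :: "real \<Rightarrow> real \<Rightarrow> real \<Rightarrow> real \<Rightarrow> real" where
  "y1 al m n lam =
     (let r = r0 al m n lam; s = s0 al m n lam in
       - (lam + bb al m n lam) * r * (((1+al)/lam * r + 2/s) / Delta1 al m n lam))"

definition z1 :: "real \<Rightarrow> real \<Rightarrow> real \<Rightarrow> real \<Rightarrow> real" where
  "z1 al m n lam =
     (let r = r0 al m n lam in
       - (lam + bb al m n lam) * r * ((n/r * (1/lam + 2)) / Delta1 al m n lam))"

end

theory Submission
  imports Defs "HOL-Real_Asymp.Real_Asymp"
begin

text \<open>
  For small \<open>n\<close> the variable \<open>r\<close> is fast and repelled, at rate of order \<open>1 / n\<close>, from a slow manifold.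
  In logarithmic coordinates the orbit leaving \<open>M\<^sub>0\<close> like \<open>exp (2 \<eta>)\<close> is obtained as a global
  Lyapunov--Perron fixed point: the slow equations are integrated from \<open>- \<infinity>\<close> and the fast one from
  \<open>+ \<infinity>\<close>, in spaces weighted by \<open>exp (2 \<eta>) (1 + exp (2 \<eta>)) ^ J\<close>, after clipping the unknowns to a box so
  that the right-hand sides are globally Lipschitz. The fixed point stays close to the slow manifold, on which
  the planar system for \<open>(p, q)\<close> has a trapping region, hence the clipping is never active. Since
  \<open>p q powr (- 1 - \<gamma>) (r powr n * s powr \<alpha>) powr (- 1 / (\<alpha> - m - n))\<close>, with
  \<open>\<gamma> = (1 + \<alpha>) / (\<alpha> - m - n) > 1\<close>, decays exponentially along orbits, \<open>p\<close> tends to \<open>0\<close> and \<open>q\<close> to \<open>1\<close>.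
  The pair \<open>(r, s)\<close>, unstable in one direction and stable in the other with small cross-coupling, then converges by
  a small-gain estimate; the same estimate in reversed time gives the asymptotics at \<open>M\<^sub>0\<close>.
\<close>

section \<open>Scalar differential inequalities\<close>

text \<open>Three directions are unstable at \<open>M0\<close>: rate 1 along \<open>q\<close>, rate
  2 along \<open>X01\<close>, and a fast one of order \<open>1 / n\<close>. The wanted orbit is thus
  not generic in the unstable manifold, and it cannot be followed forward from \<open>M0\<close>
  because \<open>r\<close> is repelled at every time. Prescribing growth makes the selection: the
  factor \<open>exp (2 \<eta>)\<close> excludes rate 1 at \<open>-\<infinity>\<close>, and any
  growth below the fast rate excludes the fast direction at \<open>+\<infinity>\<close>. Writing
  \<open>p\<close> as \<open>exp (2 t)\<close> times a factor tending to 1 at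
  \<open>-\<infinity>\<close> fixes the time translation as well, so \<kappa> is 1.

  All constants except \<open>n\<close> are fixed by strict inequalities in the limit
  \<open>n = 0\<close>, and \<open>n\<close> is shrunk last. In particular \<open>J\<close> may be
  large, although the fast rate has to exceed \<open>2 + 2 J\<close>. At \<open>n = 0\<close> the
  bound on \<lambda> is equivalent to \<open>c a > 1\<close>, that is to \<open>r1 > 0\<close>, and
  it also implies the inequality needed for the planar trapping region.\<close>

text \<open>After the last time with \<open>h \<le> lo\<close> the graph would have to rise through
  the strip between \<open>lo\<close> and \<open>hi\<close>, where the mean value theorem gives a
  nonpositive slope. Only the strip matters; this admits differential inequalities that hold merely
  while a quantity keeps its sign.\<close>

lemma barrier_right:
  fixes h h' :: "real \<Rightarrow> real"
  assumes der: "\<And>x. x \<ge> T \<Longrightarrow> (h has_real_derivative h' x) (at x)"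
    and T: "h T \<le> lo" and lt: "lo < hi"
    and neg: "\<And>x. x \<ge> T \<Longrightarrow> lo < h x \<Longrightarrow> h x < hi \<Longrightarrow> h' x \<le> 0"
    and t: "T \<le> t"
  shows "h t \<le> lo"
proof (rule ccontr)
  assume n: "\<not> h t \<le> lo"
  have cont: "continuous_on {T..t} h"
    by (meson DERIV_isCont atLeastAtMost_iff continuous_at_imp_continuous_on der)
  define A where "A = {x\<in>{T..t}. h x \<in> {..lo}}"
  have clA: "closed A"
    unfolding A_def using continuous_closed_preimage[OF cont, of "{..lo}"] by (simp add: vimage_def Int_def)
  have neA: "T \<in> A" using T t by (auto simp: A_def)
  have bd: "bdd_above A" by (auto simp: A_def bdd_above_def)
  define \<tau> where "\<tau> = Sup A"
  have \<tau>A: "\<tau> \<in> A" unfolding \<tau>_def using clA neA bd closed_contains_Sup by blast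
  then have \<tau>: "T \<le> \<tau>" "\<tau> \<le> t" "h \<tau> \<le> lo" by (auto simp: A_def)
  have above: "h x > lo" if "\<tau> < x" "x \<le> t" for x
  proof (rule ccontr)
    assume "\<not> h x > lo"
    then have "x \<in> A" using that \<tau> by (auto simp: A_def)
    then have "x \<le> \<tau>" unfolding \<tau>_def using bd by (simp add: cSup_upper)
    then show False using that by simp
  qed
  have "\<tau> \<noteq> t" using \<tau> n by auto
  then have "\<tau> < t" using \<tau> by simp
  have "isCont h \<tau>" using der[of \<tau>] \<tau> DERIV_isCont by blast
  then have "\<forall>\<^sub>F x in at \<tau>. h x < hi"
    using \<tau> lt by (simp add: isCont_def order_tendstoD(2))
  then obtain d where d: "d > 0" "\<And>x. x \<noteq> \<tau> \<Longrightarrow> dist x \<tau> < d \<Longrightarrow> h x < hi"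
    by (auto simp: eventually_at)
  define x1 where "x1 = min t (\<tau> + d/2)"
  have x1: "\<tau> < x1" "x1 \<le> t" "x1 < \<tau> + d" using \<open>\<tau> < t\<close> d by (auto simp: x1_def)
  obtain z where z: "\<tau> < z" "z < x1" "h x1 - h \<tau> = (x1 - \<tau>) * h' z"
    using MVT2[of \<tau> x1 h h'] x1 der \<tau> by auto
  have "h' z \<le> 0"
    by (rule neg) (use z x1 \<tau> above[of z] d(2)[of z] in \<open>auto simp: dist_real_def\<close>)
  then have "(x1 - \<tau>) * h' z \<le> 0" using x1 by (simp add: mult_nonneg_nonpos)
  then have "h x1 \<le> lo" using z \<tau> by linarith
  then show False using above[of x1] x1 by simp
qed

text \<open>The first time at level \<open>B\<close> would be reached from below, which a negative
  derivative forbids. The limit at \<open>-\<infinity>\<close> takes the place of an initial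
  condition.\<close>

lemma barrier_left:
  fixes y :: "real \<Rightarrow> real"
  assumes cont: "continuous_on UNIV y" and lim: "(y \<longlongrightarrow> l) at_bot" and l: "l < B"
    and neg: "\<And>t. y t = B \<Longrightarrow> \<exists>D<0. (y has_real_derivative D) (at t)"
  shows "y t < B"
proof (rule ccontr)
  assume n: "\<not> y t < B"
  have "\<forall>\<^sub>F x in at_bot. y x < B" using lim l by (rule order_tendstoD)
  then obtain T where T: "\<And>x. x \<le> T \<Longrightarrow> y x < B" by (auto simp: eventually_at_bot_linorder)
  define A where "A = {x\<in>{T..t}. y x \<in> {B..}}"
  have cont': "continuous_on {T..t} y" using cont continuous_on_subset by blast
  have clA: "closed A"
    unfolding A_def using continuous_closed_preimage[OF cont', of "{B..}"] by (simp add: vimage_def Int_def)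
  have "T \<le> t" using T n by (meson linorder_le_cases)
  then have neA: "t \<in> A" using n by (auto simp: A_def)
  have bd: "bdd_below A" by (auto simp: A_def bdd_below_def)
  define \<tau> where "\<tau> = Inf A"
  have \<tau>A: "\<tau> \<in> A" unfolding \<tau>_def using clA neA bd closed_contains_Inf by blast
  then have \<tau>: "T \<le> \<tau>" "\<tau> \<le> t" "y \<tau> \<ge> B" by (auto simp: A_def)
  have below: "y x < B" if "x < \<tau>" for x
  proof (rule ccontr)
    assume a: "\<not> y x < B"
    then have "x > T" using T by (meson not_le)
    then have "x \<in> A" using that \<tau> a by (auto simp: A_def)
    then have "\<tau> \<le> x" unfolding \<tau>_def using bd by (simp add: cInf_lower)
    then show False using that by simp
  qed
  have "y \<tau> = B"
  proof (rule antisym)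
    have "isCont y \<tau>" using cont by (simp add: continuous_on_eq_continuous_at)
    then have "(y \<longlongrightarrow> y \<tau>) (at_left \<tau>)" 
      by (simp add: isCont_def filterlim_at_split)
    moreover have "\<forall>\<^sub>F x in at_left \<tau>. y x \<le> B"
      using below by (auto simp: eventually_at_filter less_imp_le)
    ultimately show "y \<tau> \<le> B" by (rule tendsto_upperbound) simp
  qed (use \<tau> in simp)
  then obtain D where D: "D < 0" "(y has_real_derivative D) (at \<tau>)" using neg by blast
  from DERIV_neg_dec_left[OF D(2,1)] obtain d where d: "d > 0" "\<And>h. h > 0 \<Longrightarrow> h < d \<Longrightarrow> y \<tau> < y (\<tau> - h)"
    by auto
  show False using d(2)[of "d/2"] d(1) below[of "\<tau> - d/2"] \<open>y \<tau> = B\<close> by auto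
qed

text \<open>The integrating factor turns growth into monotonicity. Taking \<open>hi = 0\<close> in
  \<open>barrier_right\<close> confines the argument to the times where \<open>y\<close> is
  positive, the only ones at which growth is assumed.\<close>

lemma exponential_growth:
  fixes y y' :: "real \<Rightarrow> real"
  assumes der: "\<And>x. x \<ge> T \<Longrightarrow> (y has_real_derivative y' x) (at x)"
    and pos: "y T > 0" and growth: "\<And>x. x \<ge> T \<Longrightarrow> y x > 0 \<Longrightarrow> y' x \<ge> \<mu> * y x"
    and t: "T \<le> t"
  shows "y t \<ge> y T * exp (\<mu> * (t - T))"
proof -
  define h where "h = (\<lambda>x. - y x * exp (- \<mu> * (x - T)))"
  have "h t \<le> - y T"
  proof (rule barrier_right[where h = h and t = t and hi = 0 and T = T and h' = "\<lambda>x. (- y' x + \<mu> * y x) * exp (- \<mu> * (x - T))"])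
    fix x assume x: "x \<ge> T"
    show "(h has_real_derivative (- y' x + \<mu> * y x) * exp (- \<mu> * (x - T))) (at x)"
      unfolding h_def by (auto intro!: derivative_eq_intros der[OF x] simp: algebra_simps)
    assume "h x < 0"
    then have "y x > 0" by (simp add: h_def zero_less_mult_iff)
    then show "(- y' x + \<mu> * y x) * exp (- \<mu> * (x - T)) \<le> 0"
      using growth[OF x] by (simp add: mult_nonpos_nonneg)
  qed (use pos t in \<open>auto simp: h_def\<close>)
  then have "y T \<le> y t * exp (- \<mu> * (t - T))" by (simp add: h_def)
  then have "y T * exp (\<mu> * (t - T)) \<le> y t * exp (- \<mu> * (t - T)) * exp (\<mu> * (t - T))" by simp
  then show ?thesis by (simp add: mult.assoc exp_add[symmetric])
qed

text \<open>Once \<open>s * y\<close> exceeds \<open>c / \<mu>\<close>, the excess grows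
  exponentially and contradicts \<open>B\<close>. Boundedness for all future times thus yields an
  estimate at every time that no longer involves \<open>B\<close>. Multiplying the inequality by
  \<open>y\<close> treats both signs at once.\<close>

lemma unstable_bound:
  fixes y y' :: "real \<Rightarrow> real"
  assumes der: "\<And>x. x \<ge> T \<Longrightarrow> (y has_real_derivative y' x) (at x)"
    and bd: "\<And>x. x \<ge> T \<Longrightarrow> \<bar>y x\<bar> \<le> B" and \<mu>: "\<mu> > 0"
    and growth: "\<And>x. x \<ge> T \<Longrightarrow> y x * y' x \<ge> \<mu> * (y x)\<^sup>2 - \<bar>y x\<bar> * c"
    and c: "c \<ge> 0" and t: "T \<le> t"
  shows "\<bar>y t\<bar> \<le> c / \<mu>"
proof -
  have key: "s * y t \<le> c / \<mu>" if s: "s = 1 \<or> s = -1" for s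
  proof (rule ccontr)
    assume n: "\<not> s * y t \<le> c / \<mu>"
    define w where "w = (\<lambda>x. s * y x - c/\<mu>)"
    have wt: "w t > 0" using n by (simp add: w_def)
    have grow: "w x \<ge> w t * exp (\<mu> * (x - t))" if "x \<ge> t" for x
    proof (rule exponential_growth[where y = w and t = x and y' = "\<lambda>x. s * y' x" and T = t])
      fix x assume x: "t \<le> x"
      show "(w has_real_derivative s * y' x) (at x)"
        unfolding w_def using der[of x] x t by (auto intro!: derivative_eq_intros)
      assume "w x > 0"
      then have p: "s * y x > 0" using c \<mu> by (smt (verit) divide_nonneg_pos w_def)
      then have ab: "\<bar>y x\<bar> = s * y x" using s by auto
      have "(s * y x) * (s * y' x) \<ge> (s * y x) * (\<mu> * (s * y x) - c)"
        using growth[of x] x t ab s by (auto simp: power2_eq_square algebra_simps)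
      then have "s * y' x \<ge> \<mu> * (s * y x) - c" using p by (simp add: mult_le_cancel_left)
      then show "\<mu> * w x \<le> s * y' x" using \<mu> by (simp add: w_def right_diff_distrib)
    qed (use wt that in auto)
    have "filterlim (\<lambda>x. w t * exp (\<mu> * (x - t))) at_top at_top"
      using wt \<mu> by real_asymp
    then have "\<forall>\<^sub>F x in at_top. w t * exp (\<mu> * (x - t)) > B"
      by (simp add: filterlim_at_top_dense)
    moreover have "\<forall>\<^sub>F x in at_top. x \<ge> t" by (rule eventually_ge_at_top)
    ultimately have "\<forall>\<^sub>F x::real in at_top. False"
    proof eventually_elim
      case (elim x)
      have "s * y x \<le> B" using bd[of x] elim t s by (auto simp: abs_le_iff)
      moreover have "c/\<mu> \<ge> 0" using c \<mu> by simp
      ultimately have "w x \<le> B" unfolding w_def by linarith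
      then show ?case using grow[of x] elim by linarith
    qed
    then show False by simp
  qed
  show ?thesis using key[of 1] key[of "-1"] by auto
qed

text \<open>The excess of \<open>s * y\<close> over \<open>c / \<mu>\<close>, multiplied by
  \<open>exp (\<mu> * (x - T))\<close>, never exceeds the positive part of its initial value. Hence
  the excess eventually drops below \<open>\<epsilon>\<close>.\<close>

lemma stable_bound:
  fixes y y' :: "real \<Rightarrow> real"
  assumes der: "\<And>x. x \<ge> T \<Longrightarrow> (y has_real_derivative y' x) (at x)"
    and \<mu>: "\<mu> > 0"
    and decay: "\<And>x. x \<ge> T \<Longrightarrow> y x * y' x \<le> - \<mu> * (y x)\<^sup>2 + \<bar>y x\<bar> * c"
    and c: "c \<ge> 0" and eps: "\<epsilon> > 0"
  shows "\<forall>\<^sub>F t in at_top. \<bar>y t\<bar> \<le> c / \<mu> + \<epsilon>"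
proof -
  have key: "\<forall>\<^sub>F t in at_top. s * y t \<le> c / \<mu> + \<epsilon>" if s: "s = 1 \<or> s = -1" for s
  proof -
    define h where "h = (\<lambda>x. (s * y x - c/\<mu>) * exp (\<mu> * (x - T)))"
    define h0 where "h0 = max 0 (h T)"
    have le: "h t \<le> h0" if "T \<le> t" for t
    proof (rule barrier_right[where h = h and t = t and hi = "h0 + 1" and T = T and h' = "\<lambda>x. (s * y' x + \<mu> * (s * y x) - c) * exp (\<mu> * (x - T))"])
      fix x assume x: "x \<ge> T"
      show "(h has_real_derivative (s * y' x + \<mu> * (s * y x) - c) * exp (\<mu> * (x - T))) (at x)"
        unfolding h_def using \<mu> by (auto intro!: derivative_eq_intros der[OF x] simp: algebra_simps)
      assume "h0 < h x"
      then have "0 < h x" by (simp add: h0_def)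
      then have "s * y x - c/\<mu> > 0" by (simp add: h_def zero_less_mult_iff)
      then have p: "s * y x > 0" using c \<mu> by (smt (verit) divide_nonneg_pos)
      then have ab: "\<bar>y x\<bar> = s * y x" using s by auto
      have "(s * y x) * (s * y' x) \<le> (s * y x) * (- \<mu> * (s * y x) + c)"
        using decay[of x] x ab s by (auto simp: power2_eq_square algebra_simps)
      then have "s * y' x \<le> - \<mu> * (s * y x) + c" using p by (simp add: mult_le_cancel_left)
      then show "(s * y' x + \<mu> * (s * y x) - c) * exp (\<mu> * (x - T)) \<le> 0"
        by (simp add: mult_nonpos_nonneg)
    qed (use that in \<open>auto simp: h0_def\<close>)
    have "((\<lambda>t. h0 * exp (- \<mu> * (t - T))) \<longlongrightarrow> 0) at_top"
      using \<mu> by real_asymp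
    then have "\<forall>\<^sub>F t in at_top. h0 * exp (- \<mu> * (t - T)) < \<epsilon>"
      using eps by (rule order_tendstoD)
    moreover have "\<forall>\<^sub>F t in at_top. t \<ge> T" by (rule eventually_ge_at_top)
    ultimately show ?thesis
    proof eventually_elim
      case (elim t)
      have "(s * y t - c/\<mu>) * exp (\<mu> * (t - T)) * exp (- \<mu> * (t - T)) \<le> h0 * exp (- \<mu> * (t - T))"
        using le[of t] elim by (simp add: h_def)
      then have "s * y t - c/\<mu> \<le> h0 * exp (- \<mu> * (t - T))" by (simp add: mult.assoc exp_add[symmetric])
      then show ?case using elim by linarith
    qed
  qed
  show ?thesis using key[of 1, simplified] key[of "-1", simplified] by eventually_elim (auto simp: abs_le_iff)
qed

text \<open>If \<open>N\<close> eventually bounds \<open>u\<close>, the unstable equation bounds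
  \<open>w\<close> by about \<open>d2 * N / \<mu>2\<close>, and the stable one then bounds
  \<open>u\<close> by about \<open>d1 * d2 / (\<mu>1 * \<mu>2) * N\<close>. The gain condition makes
  the last factor less than 1, so the limsup of \<open>u\<close> in modulus vanishes.\<close>

lemma small_gain:
  fixes u w D1 D2 f :: "real \<Rightarrow> real"
  assumes der1: "\<forall>\<^sub>F t in at_top. (u has_real_derivative D1 t) (at t)"
    and der2: "\<forall>\<^sub>F t in at_top. (w has_real_derivative D2 t) (at t)"
    and bd: "\<forall>\<^sub>F t in at_top. \<bar>u t\<bar> \<le> B \<and> \<bar>w t\<bar> \<le> B"
    and stable: "\<forall>\<^sub>F t in at_top. u t * D1 t \<le> - \<mu>1 * (u t)\<^sup>2 + \<bar>u t\<bar> * (d1 * \<bar>w t\<bar> + f t)"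
    and unstable: "\<forall>\<^sub>F t in at_top. w t * D2 t \<ge> \<mu>2 * (w t)\<^sup>2 - \<bar>w t\<bar> * (d2 * \<bar>u t\<bar> + f t)"
    and f: "(f \<longlongrightarrow> 0) at_top"
    and pos: "\<mu>1 > 0" "\<mu>2 > 0" "d1 \<ge> 0" "d2 \<ge> 0" "d1 * d2 < \<mu>1 * \<mu>2"
  shows "(u \<longlongrightarrow> 0) at_top \<and> (w \<longlongrightarrow> 0) at_top"
proof -
  have step2: "\<forall>\<^sub>F t in at_top. \<bar>w t\<bar> \<le> (d2 * N + \<epsilon>) / \<mu>2"
    if N: "\<forall>\<^sub>F t in at_top. \<bar>u t\<bar> \<le> N" "N \<ge> 0" and e: "\<epsilon> > 0" for N \<epsilon>
  proof -
    have "\<forall>\<^sub>F t in at_top. f t < \<epsilon>" using f e by (rule order_tendstoD)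
    with der2 bd unstable N(1)
    have "\<forall>\<^sub>F t in at_top. (w has_real_derivative D2 t) (at t) \<and> \<bar>w t\<bar> \<le> B \<and>
       w t * D2 t \<ge> \<mu>2 * (w t)\<^sup>2 - \<bar>w t\<bar> * (d2 * N + \<epsilon>)"
    proof eventually_elim
      case (elim t)
      have "d2 * \<bar>u t\<bar> \<le> d2 * N" using elim pos by (simp add: mult_left_mono)
      then have "\<bar>w t\<bar> * (d2 * \<bar>u t\<bar> + f t) \<le> \<bar>w t\<bar> * (d2 * N + \<epsilon>)"
        using elim by (intro mult_left_mono) auto
      then show ?case using elim by linarith
    qed
    then obtain T where T: "\<And>t. t \<ge> T \<Longrightarrow> (w has_real_derivative D2 t) (at t) \<and> \<bar>w t\<bar> \<le> B \<and>
       w t * D2 t \<ge> \<mu>2 * (w t)\<^sup>2 - \<bar>w t\<bar> * (d2 * N + \<epsilon>)"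
      by (auto simp: eventually_at_top_linorder)
    have "\<bar>w t\<bar> \<le> (d2 * N + \<epsilon>) / \<mu>2" if "t \<ge> T" for t
      by (rule unstable_bound[of T w D2 B]) (use T that pos N e in auto)
    then show ?thesis by (auto simp: eventually_at_top_linorder)
  qed
  have step1: "\<forall>\<^sub>F t in at_top. \<bar>u t\<bar> \<le> (d1 * N + \<epsilon>) / \<mu>1 + \<epsilon>"
    if N: "\<forall>\<^sub>F t in at_top. \<bar>w t\<bar> \<le> N" "N \<ge> 0" and e: "\<epsilon> > 0" for N \<epsilon>
  proof -
    have "\<forall>\<^sub>F t in at_top. f t < \<epsilon>" using f e by (rule order_tendstoD)
    with der1 stable N(1)
    have "\<forall>\<^sub>F t in at_top. (u has_real_derivative D1 t) (at t) \<and>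
       u t * D1 t \<le> - \<mu>1 * (u t)\<^sup>2 + \<bar>u t\<bar> * (d1 * N + \<epsilon>)"
    proof eventually_elim
      case (elim t)
      have "d1 * \<bar>w t\<bar> \<le> d1 * N" using elim pos by (simp add: mult_left_mono)
      then have "\<bar>u t\<bar> * (d1 * \<bar>w t\<bar> + f t) \<le> \<bar>u t\<bar> * (d1 * N + \<epsilon>)"
        using elim by (intro mult_left_mono) auto
      then show ?case using elim by linarith
    qed
    then obtain T where T: "\<And>t. t \<ge> T \<Longrightarrow> (u has_real_derivative D1 t) (at t) \<and>
       u t * D1 t \<le> - \<mu>1 * (u t)\<^sup>2 + \<bar>u t\<bar> * (d1 * N + \<epsilon>)"
      by (auto simp: eventually_at_top_linorder)
    show ?thesis
      by (rule stable_bound[of T u D1]) (use T pos N e in auto)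
  qed
  \<comment> \<open>The limsup of \<open>u\<close> in modulus is encoded as the infimum
    \<open>L\<close> of the real eventual bounds.\<close>
  define A where "A = {N. N \<ge> 0 \<and> (\<forall>\<^sub>F t in at_top. \<bar>u t\<bar> \<le> N)}"
  define L where "L = Inf A"
  have bb: "bdd_below A" by (auto simp: A_def bdd_below_def)
  have "\<bar>B\<bar> \<in> A" using bd by (auto simp: A_def elim: eventually_mono)
  then have ne: "A \<noteq> {}" by auto
  have L0: "L \<ge> 0" unfolding L_def using ne by (intro cInf_greatest) (auto simp: A_def)
  define k where "k = d1 * d2 / (\<mu>1 * \<mu>2)"
  define C where "C = k + d1/(\<mu>1*\<mu>2) + 1/\<mu>1 + 1"
  have k1: "k < 1" "k \<ge> 0" using pos by (auto simp: k_def)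
  have C0: "C > 0" using pos k1 by (auto simp: C_def intro!: add_nonneg_pos add_nonneg_nonneg)
  have ineq: "L \<le> k * L + C * \<epsilon>" if e: "\<epsilon> > 0" for \<epsilon>
  proof -
    obtain N where N: "N \<in> A" "N < L + \<epsilon>" using e cInf_lessD[of A "L + \<epsilon>"] ne by (auto simp: L_def)
    have N0: "N \<ge> 0" and Ne: "\<forall>\<^sub>F t in at_top. \<bar>u t\<bar> \<le> N" using N by (auto simp: A_def)
    have n2: "(d2 * N + \<epsilon>) / \<mu>2 \<ge> 0" using pos N0 e by auto
    define N' where "N' = (d1 * ((d2 * N + \<epsilon>) / \<mu>2) + \<epsilon>) / \<mu>1 + \<epsilon>"
    have "N' \<ge> 0" unfolding N'_def using n2 pos e N0
      by (intro add_nonneg_nonneg divide_nonneg_pos mult_nonneg_nonneg) auto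
    then have "N' \<in> A" using step1[OF step2[OF Ne N0 e] n2 e] by (auto simp: A_def N'_def)
    then have "L \<le> N'" unfolding L_def using bb by (simp add: cInf_lower)
    also have "N' = k * N + (d1/(\<mu>1*\<mu>2) + 1/\<mu>1 + 1) * \<epsilon>"
      using pos unfolding N'_def k_def by (simp add: field_simps)
    also have "\<dots> \<le> k * (L + \<epsilon>) + (d1/(\<mu>1*\<mu>2) + 1/\<mu>1 + 1) * \<epsilon>"
      using N k1 by (intro add_right_mono mult_left_mono) auto
    also have "\<dots> = k * L + C * \<epsilon>" by (simp add: C_def algebra_simps)
    finally show ?thesis .
  qed
  have "L \<le> k * L"
  proof (rule field_le_epsilon)
    fix e :: real assume "e > 0"
    then show "L \<le> k * L + e" using ineq[of "e / C"] C0 by simp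
  qed
  then have "(1 - k) * L \<le> 0" by (simp add: algebra_simps)
  then have "L = 0" using k1 L0 by (smt (verit) mult_pos_pos)
  have small: "\<forall>\<^sub>F t in at_top. \<bar>u t\<bar> \<le> \<epsilon>" if "\<epsilon> > 0" for \<epsilon>
  proof -
    have "Inf A < \<epsilon>" using \<open>L = 0\<close> that by (simp add: L_def[symmetric])
    then obtain N where "N \<in> A" "N < \<epsilon>" using cInf_lessD[OF ne] by blast
    then show ?thesis by (auto simp: A_def elim: eventually_mono)
  qed
  have u0: "(u \<longlongrightarrow> 0) at_top"
  proof (rule tendstoI)
    fix e :: real assume "e > 0"
    then show "\<forall>\<^sub>F t in at_top. dist (u t) 0 < e"
      using small[of "e/2"] by (auto elim!: eventually_mono)
  qed
  have "(w \<longlongrightarrow> 0) at_top"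
  proof (rule tendstoI)
    fix e :: real assume e: "e > 0"
    define \<epsilon> where "\<epsilon> = e * \<mu>2 / 2 / (d2 + 1)"
    have ep: "\<epsilon> > 0" using e pos by (auto simp: \<epsilon>_def)
    have "d2 * \<epsilon> + \<epsilon> = (d2 + 1) * \<epsilon>" by (simp add: algebra_simps)
    also have "\<dots> = e * \<mu>2 / 2" using pos by (simp add: \<epsilon>_def nonzero_mult_div_cancel_left del: divide_divide_eq_left divide_divide_eq_left')
    finally have half: "(d2 * \<epsilon> + \<epsilon>) / \<mu>2 = e/2" using pos by simp
    have "\<forall>\<^sub>F t in at_top. \<bar>w t\<bar> \<le> (d2 * \<epsilon> + \<epsilon>) / \<mu>2"
      by (rule step2[OF small[OF ep] _ ep]) (use ep in simp)
    then have "\<forall>\<^sub>F t in at_top. \<bar>w t\<bar> \<le> e / 2" unfolding half .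
    then show "\<forall>\<^sub>F t in at_top. dist (w t) 0 < e"
      by eventually_elim (use e in simp)
  qed
  with u0 show ?thesis by simp
qed

section \<open>Fixed points in weighted spaces\<close>

lemma antiderivative_exists:
  fixes f :: "real \<Rightarrow> real"
  assumes "continuous_on UNIV f"
  obtains F where "\<And>t. (F has_real_derivative f t) (at t)"
proof -
  have "\<exists>F. \<forall>x. - \<infinity> < ereal x \<longrightarrow> ereal x < \<infinity> \<longrightarrow> (F has_vector_derivative f x) (at x)"
    by (rule einterval_antiderivative) (use assms in \<open>auto simp: continuous_on_eq_continuous_at\<close>)
  then show ?thesis using that by (auto simp: has_real_derivative_iff_has_vector_derivative)
qed

text \<open>Both \<open>F + H\<close> and \<open>H - F\<close> increase, so the intervals from
  \<open>F - H\<close> to \<open>F + H\<close> are nested and shrink towards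
  \<open>-\<infinity>\<close>; \<open>l\<close> is their common point. Domination by the derivative
  of \<open>H\<close> replaces an improper integral.\<close>

lemma limit_at_bot_of_dominated_derivative:
  fixes F f H h :: "real \<Rightarrow> real"
  assumes F: "\<And>t. (F has_real_derivative f t) (at t)" and H: "\<And>t. (H has_real_derivative h t) (at t)"
    and dom: "\<And>t. \<bar>f t\<bar> \<le> h t" and lim: "(H \<longlongrightarrow> 0) at_bot"
  obtains l where "\<And>t. \<bar>F t - l\<bar> \<le> H t"
proof -
  have up: "F s + H s \<le> F t + H t" if "s \<le> t" for s t
    by (rule deriv_nonneg_imp_mono[of s t "\<lambda>t. F t + H t" "\<lambda>t. f t + h t"])
      (use that dom in \<open>auto intro!: derivative_eq_intros F H simp: abs_le_iff add.commute\<close>, smt (verit) dom)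
  have down: "F t - H t \<le> F s - H s" if "s \<le> t" for s t
    by (rule deriv_nonpos_imp_antimono[of s t "\<lambda>t. F t - H t" "\<lambda>t. f t - h t"])
      (use that dom in \<open>auto intro!: derivative_eq_intros F H simp: abs_le_iff\<close>)
  have hm: "H s \<le> H t" if "s \<le> t" for s t
    using up[OF that] down[OF that] by linarith
  have H0: "H t \<ge> 0" for t
  proof (rule tendsto_upperbound[OF lim])
    show "\<forall>\<^sub>F s in at_bot. H s \<le> H t" using eventually_le_at_bot[of t] by eventually_elim (rule hm)
  qed simp
  define l where "l = (INF t. F t + H t)"
  have lower: "F s - H s \<le> F t + H t" for s t
    using up[of s t] down[of t s] H0[of s] H0[of t] by (cases "s \<le> t") auto
  have bb: "bdd_below (range (\<lambda>t. F t + H t))" using lower[of 0] by (auto simp: bdd_below_def)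
  have "F s - H s \<le> l" for s unfolding l_def using lower by (intro cINF_greatest) auto
  moreover have "l \<le> F s + H s" for s unfolding l_def using bb by (intro cINF_lower) auto
  ultimately have "\<bar>F t - l\<bar> \<le> H t" for t by (smt (verit))
  then show ?thesis by (rule that)
qed

text \<open>
  A weight that outgrows \<open>exp (\<nu> t)\<close> forces \<open>y' = \<nu> y + f\<close> to be solved from \<open>- \<infinity>\<close>, a weight
  that grows more slowly forces it to be solved from \<open>+ \<infinity>\<close>; in both cases the weighted solution is unique.
\<close>

definition dichotomy_weight :: "real \<Rightarrow> (real \<Rightarrow> real) \<Rightarrow> (real \<Rightarrow> real) \<Rightarrow> bool" where
  "dichotomy_weight \<nu> W W' \<longleftrightarrow>
     (\<forall>t. (W has_real_derivative W' t) (at t)) \<and> (\<forall>t. W t > 0) \<and>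
     ((\<forall>t. \<nu> * W t < W' t) \<and> ((\<lambda>t. exp (- \<nu> * t) * W t) \<longlongrightarrow> 0) at_bot \<or>
      (\<forall>t. W' t < \<nu> * W t) \<and> ((\<lambda>t. exp (- \<nu> * t) * W t) \<longlongrightarrow> 0) at_top)"

text \<open>Variation of constants: subtracting the limit \<open>l\<close> of the antiderivative at
  \<open>-\<infinity>\<close> selects the solution integrated from there. The bound on
  \<open>f\<close> says that \<open>\<Theta> * W\<close> is a supersolution, so no integral has to
  be estimated.\<close>

lemma linear_solution_left:
  fixes f :: "real \<Rightarrow> real"
  assumes f: "continuous_on UNIV f" and W: "\<And>t. (W has_real_derivative W' t) (at t)"
    and bound: "\<And>t. \<bar>f t\<bar> \<le> \<Theta> * (W' t - \<nu> * W t)"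
    and lim: "((\<lambda>t. exp (- \<nu> * t) * W t) \<longlongrightarrow> 0) at_bot"
  obtains y where "\<And>t. (y has_real_derivative \<nu> * y t + f t) (at t)" "\<And>t. \<bar>y t\<bar> \<le> \<Theta> * W t"
proof -
  have "continuous_on UNIV (\<lambda>t. exp (- \<nu> * t) * f t)" using f by (intro continuous_intros)
  from antiderivative_exists[OF this]
  obtain F where F: "\<And>t. (F has_real_derivative exp (- \<nu> * t) * f t) (at t)" by blast
  have H: "((\<lambda>t. \<Theta> * (exp (- \<nu> * t) * W t)) has_real_derivative \<Theta> * (exp (- \<nu> * t) * (W' t - \<nu> * W t))) (at t)" for t
    by (auto intro!: derivative_eq_intros W simp: algebra_simps)
  have dom: "\<bar>exp (- \<nu> * t) * f t\<bar> \<le> \<Theta> * (exp (- \<nu> * t) * (W' t - \<nu> * W t))" for t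
    using mult_left_mono[OF bound[of t], of "exp (- \<nu> * t)"] by (simp add: abs_mult algebra_simps)
  have "((\<lambda>t. \<Theta> * (exp (- \<nu> * t) * W t)) \<longlongrightarrow> 0) at_bot"
    using tendsto_mult_right_zero[OF lim, of \<Theta>] by simp
  from limit_at_bot_of_dominated_derivative[OF F H dom this]
  obtain l where l: "\<And>t. \<bar>F t - l\<bar> \<le> \<Theta> * (exp (- \<nu> * t) * W t)" by blast
  define y where "y = (\<lambda>t. exp (\<nu> * t) * (F t - l))"
  have "(y has_real_derivative \<nu> * y t + f t) (at t)" for t
    unfolding y_def by (auto intro!: derivative_eq_intros F simp: algebra_simps exp_minus field_simps)
  moreover have "\<bar>y t\<bar> \<le> \<Theta> * W t" for t
  proof -
    have "\<bar>y t\<bar> = exp (\<nu> * t) * \<bar>F t - l\<bar>" by (simp add: y_def abs_mult)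
    also have "\<dots> \<le> exp (\<nu> * t) * (\<Theta> * (exp (- \<nu> * t) * W t))" using l by (intro mult_left_mono) auto
    also have "\<dots> = \<Theta> * W t" by (simp add: exp_minus field_simps)
    finally show ?thesis .
  qed
  ultimately show ?thesis by (rule that)
qed

text \<open>Uniqueness in the weighted space: a bound by any multiple \<open>C\<close> of
  \<open>W\<close> forces the constant of integration \<open>l\<close> to vanish, and the estimate
  with \<open>\<Theta>\<close> follows. Applied to the difference of two iterates it yields the
  contraction.\<close>

lemma linear_bound_left:
  fixes f :: "real \<Rightarrow> real"
  assumes W: "\<And>t. (W has_real_derivative W' t) (at t)"
    and y: "\<And>t. (y has_real_derivative \<nu> * y t + f t) (at t)" and C: "\<And>t. \<bar>y t\<bar> \<le> C * W t"
    and bound: "\<And>t. \<bar>f t\<bar> \<le> \<Theta> * (W' t - \<nu> * W t)"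
    and lim: "((\<lambda>t. exp (- \<nu> * t) * W t) \<longlongrightarrow> 0) at_bot"
  shows "\<bar>y t\<bar> \<le> \<Theta> * W t"
proof -
  define F where "F = (\<lambda>t. exp (- \<nu> * t) * y t)"
  have F: "(F has_real_derivative exp (- \<nu> * t) * f t) (at t)" for t
    unfolding F_def by (auto intro!: derivative_eq_intros y simp: algebra_simps)
  have H: "((\<lambda>t. \<Theta> * (exp (- \<nu> * t) * W t)) has_real_derivative \<Theta> * (exp (- \<nu> * t) * (W' t - \<nu> * W t))) (at t)" for t
    by (auto intro!: derivative_eq_intros W simp: algebra_simps)
  have dom: "\<bar>exp (- \<nu> * t) * f t\<bar> \<le> \<Theta> * (exp (- \<nu> * t) * (W' t - \<nu> * W t))" for t
    using mult_left_mono[OF bound[of t], of "exp (- \<nu> * t)"] by (simp add: abs_mult algebra_simps)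
  have H0: "((\<lambda>t. \<Theta> * (exp (- \<nu> * t) * W t)) \<longlongrightarrow> 0) at_bot"
    using tendsto_mult_right_zero[OF lim, of \<Theta>] by simp
  from limit_at_bot_of_dominated_derivative[OF F H dom this]
  obtain l where l: "\<And>t. \<bar>F t - l\<bar> \<le> \<Theta> * (exp (- \<nu> * t) * W t)" by blast
  have "(F \<longlongrightarrow> 0) at_bot"
  proof (rule Lim_null_comparison)
    show "\<forall>\<^sub>F t in at_bot. norm (F t) \<le> C * (exp (- \<nu> * t) * W t)"
      using mult_left_mono[OF C, of "exp (- \<nu> * _)"] by (simp add: F_def abs_mult mult.left_commute)
    show "((\<lambda>t. C * (exp (- \<nu> * t) * W t)) \<longlongrightarrow> 0) at_bot"
      using tendsto_mult_right_zero[OF lim, of C] by simp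
  qed
  moreover have "(F \<longlongrightarrow> l) at_bot"
  proof (rule LIM_zero_cancel, rule Lim_null_comparison[OF _ H0])
    show "\<forall>\<^sub>F t in at_bot. norm (F t - l) \<le> \<Theta> * (exp (- \<nu> * t) * W t)" using l by simp
  qed
  ultimately have "l = 0" using tendsto_unique[OF trivial_limit_at_bot_linorder] by blast
  then have "\<bar>F t\<bar> \<le> \<Theta> * (exp (- \<nu> * t) * W t)" using l[of t] by simp
  then have "exp (\<nu> * t) * \<bar>F t\<bar> \<le> exp (\<nu> * t) * (\<Theta> * (exp (- \<nu> * t) * W t))" by (intro mult_left_mono) auto
  then show ?thesis by (simp add: F_def abs_mult exp_minus field_simps)
qed

lemma has_real_derivative_reflect:
  fixes y :: "real \<Rightarrow> real"
  assumes "\<And>t. (y has_real_derivative D t) (at t)"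
  shows "((\<lambda>t. y (- t)) has_real_derivative - D (- t)) (at t)"
  by (rule DERIV_cong[OF DERIV_chain2[OF assms, of uminus]]) (auto intro!: derivative_eq_intros)

text \<open>Reversing time changes the signs of \<open>\<nu>\<close> and \<open>f\<close> and
  reduces a weight that grows more slowly than \<open>exp (\<nu> t)\<close> to
  \<open>linear_solution_left\<close>.\<close>

lemma linear_solution:
  fixes f :: "real \<Rightarrow> real"
  assumes adm: "dichotomy_weight \<nu> W W'" and f: "continuous_on UNIV f"
    and bound: "\<And>t. \<bar>f t\<bar> \<le> \<Theta> * \<bar>W' t - \<nu> * W t\<bar>"
  obtains y where "\<And>t. (y has_real_derivative \<nu> * y t + f t) (at t)" "\<And>t. \<bar>y t\<bar> \<le> \<Theta> * W t"
proof -
  have W: "\<And>t. (W has_real_derivative W' t) (at t)" using adm by (auto simp: dichotomy_weight_def)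
  consider (left) "\<And>t. \<nu> * W t < W' t" "((\<lambda>t. exp (- \<nu> * t) * W t) \<longlongrightarrow> 0) at_bot"
    | (right) "\<And>t. W' t < \<nu> * W t" "((\<lambda>t. exp (- \<nu> * t) * W t) \<longlongrightarrow> 0) at_top"
    using adm by (auto simp: dichotomy_weight_def)
  then show ?thesis
  proof cases
    case left
    have "\<bar>f t\<bar> \<le> \<Theta> * (W' t - \<nu> * W t)" for t using bound[of t] left(1)[of t] by simp
    from linear_solution_left[OF f W this left(2)] that show ?thesis by blast
  next
    case right
    have W2: "((\<lambda>t. W (- t)) has_real_derivative - W' (- t)) (at t)" for t
      by (rule has_real_derivative_reflect[OF W])
    have b2: "\<bar>- f (- t)\<bar> \<le> \<Theta> * (- W' (- t) - (- \<nu>) * W (- t))" for t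
      using bound[of "- t"] abs_of_neg[of "W' (- t) - \<nu> * W (- t)"] right(1)[of "- t"] by simp
    have f2: "continuous_on UNIV (\<lambda>t. - f (- t))"
      by (intro continuous_intros continuous_on_compose2[OF f]) auto
    have l2: "((\<lambda>t. exp (- (- \<nu>) * t) * W (- t)) \<longlongrightarrow> 0) at_bot"
      using right(2) by (simp add: filterlim_at_bot_mirror)
    obtain y where y: "\<And>t. (y has_real_derivative (- \<nu>) * y t + - f (- t)) (at t)" "\<And>t. \<bar>y t\<bar> \<le> \<Theta> * W (- t)"
      using linear_solution_left[OF f2 W2 b2 l2] by blast
    show ?thesis
    proof (rule that)
      show "((\<lambda>t. y (- t)) has_real_derivative \<nu> * y (- t) + f t) (at t)" for t
        using has_real_derivative_reflect[OF y(1), of t] by (simp add: add.commute)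
      show "\<bar>y (- t)\<bar> \<le> \<Theta> * W t" for t using y(2)[of "- t"] by simp
    qed
  qed
qed

lemma linear_bound:
  fixes f :: "real \<Rightarrow> real"
  assumes adm: "dichotomy_weight \<nu> W W'"
    and y: "\<And>t. (y has_real_derivative \<nu> * y t + f t) (at t)" and C: "\<And>t. \<bar>y t\<bar> \<le> C * W t"
    and bound: "\<And>t. \<bar>f t\<bar> \<le> \<Theta> * \<bar>W' t - \<nu> * W t\<bar>"
  shows "\<bar>y t\<bar> \<le> \<Theta> * W t"
proof -
  have W: "\<And>t. (W has_real_derivative W' t) (at t)" using adm by (auto simp: dichotomy_weight_def)
  consider (left) "\<And>t. \<nu> * W t < W' t" "((\<lambda>t. exp (- \<nu> * t) * W t) \<longlongrightarrow> 0) at_bot"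
    | (right) "\<And>t. W' t < \<nu> * W t" "((\<lambda>t. exp (- \<nu> * t) * W t) \<longlongrightarrow> 0) at_top"
    using adm by (auto simp: dichotomy_weight_def)
  then show ?thesis
  proof cases
    case left
    have "\<bar>f t\<bar> \<le> \<Theta> * (W' t - \<nu> * W t)" for t using bound[of t] left(1)[of t] by simp
    from linear_bound_left[OF W y C this left(2)] show ?thesis .
  next
    case right
    have W2: "((\<lambda>t. W (- t)) has_real_derivative - W' (- t)) (at t)" for t
      by (rule has_real_derivative_reflect[OF W])
    have b2: "\<bar>- f (- t)\<bar> \<le> \<Theta> * (- W' (- t) - (- \<nu>) * W (- t))" for t
      using bound[of "- t"] abs_of_neg[of "W' (- t) - \<nu> * W (- t)"] right(1)[of "- t"] by simp
    have l2: "((\<lambda>t. exp (- (- \<nu>) * t) * W (- t)) \<longlongrightarrow> 0) at_bot"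
      using right(2) by (simp add: filterlim_at_bot_mirror)
    have y2: "((\<lambda>t. y (- t)) has_real_derivative (- \<nu>) * y (- t) + - f (- t)) (at t)" for t
      using has_real_derivative_reflect[OF y, of t] by simp
    have "\<bar>y (- (- t))\<bar> \<le> \<Theta> * W (- (- t))"
      by (rule linear_bound_left[where y = "\<lambda>t. y (- t)" and W = "\<lambda>t. W (- t)", OF W2 y2 _ b2 l2]) (rule C)
    then show ?thesis by simp
  qed
qed

text \<open>A preimage is a union of slices over single indices, and singletons are open.\<close>

lemma continuous_on_discrete_prod:
  fixes g :: "'i::discrete_topology \<times> 'a::topological_space \<Rightarrow> 'b::topological_space"
  assumes "\<And>i. continuous_on UNIV (\<lambda>t. g (i, t))"
  shows "continuous_on UNIV g"
proof (rule continuous_on_open_vimage[THEN iffD2, rule_format, OF open_UNIV])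
  fix B :: "'b set" assume B: "open B"
  have "g -` B \<inter> UNIV = (\<Union>i. {i} \<times> ((\<lambda>t. g (i, t)) -` B))" by auto
  moreover have "open ((\<lambda>t. g (i, t)) -` B)" for i
    using assms[of i] B continuous_on_open_vimage[OF open_UNIV] by fastforce
  ultimately show "open (g -` B \<inter> UNIV)" by (simp add: open_UN open_Times open_discrete)
qed

text \<open>Banach's theorem for bounded continuous \<open>g\<close> on pairs \<open>(i, t)\<close>,
  where \<open>g\<close> encodes the unknown \<open>W i t * g (i, t)\<close>. An iterate solves the
  decoupled linear equations with frozen \<open>H\<close>. A Lipschitz bound for \<open>H\<close> by
  the fraction \<open>\<theta>\<close> of the gap between \<open>W'\<close> and
  \<open>\<nu> W\<close> is exactly what \<open>linear_bound\<close> converts into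
  contraction.\<close>

theorem weighted_contraction:
  fixes H :: "'i::{metric_space, discrete_topology} \<Rightarrow> real \<Rightarrow> ('i \<Rightarrow> real) \<Rightarrow> real"
  assumes adm: "\<And>i. dichotomy_weight (\<nu> i) (W i) (W' i)"
    and cont: "\<And>i y. (\<And>j. continuous_on UNIV (y j)) \<Longrightarrow> continuous_on UNIV (\<lambda>t. H i t (\<lambda>j. y j t))"
    and lip: "\<And>i t x y N. (\<And>j. \<bar>x j - y j\<bar> \<le> N * W j t) \<Longrightarrow>
        \<bar>H i t x - H i t y\<bar> \<le> \<theta> * N * \<bar>W' i t - \<nu> i * W i t\<bar>"
    and zero: "\<And>i t. \<bar>H i t (\<lambda>_. 0)\<bar> \<le> C * \<bar>W' i t - \<nu> i * W i t\<bar>"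
    and \<theta>: "0 \<le> \<theta>" "\<theta> < 1"
  obtains y C' where "\<And>i t. (y i has_real_derivative \<nu> i * y i t + H i t (\<lambda>j. y j t)) (at t)"
    "\<And>i t. \<bar>y i t\<bar> \<le> C' * W i t"
proof -
  have Wpos: "W i t > 0" for i t using adm[of i] by (auto simp: dichotomy_weight_def)
  have Wder: "(W i has_real_derivative W' i t) (at t)" for i t using adm[of i] by (auto simp: dichotomy_weight_def)
  have Wcont: "continuous_on UNIV (W i)" for i
    using Wder by (meson DERIV_isCont continuous_at_imp_continuous_on)
  define Y where "Y = (\<lambda>(g :: ('i \<times> real) \<Rightarrow>\<^sub>C real) i t. W i t * apply_bcontfun g (i, t))"
  have Yb: "\<bar>Y g i t - Y h i t\<bar> \<le> dist g h * W i t" for g h i t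
  proof -
    have "\<bar>Y g i t - Y h i t\<bar> = W i t * dist (apply_bcontfun g (i, t)) (apply_bcontfun h (i, t))"
      using Wpos[of i t] by (simp add: Y_def dist_real_def abs_mult flip: right_diff_distrib)
    also have "\<dots> \<le> W i t * dist g h" using Wpos[of i t] dist_bounded[of g "(i,t)" h] by (intro mult_left_mono) auto
    finally show ?thesis by (simp add: mult.commute)
  qed
  have Y0: "Y 0 = (\<lambda>i t. 0)" by (auto simp: Y_def)
  have Ycont: "continuous_on UNIV (Y g i)" for g i
    unfolding Y_def
    by (intro continuous_intros Wcont continuous_on_compose2[OF continuous_on_apply_bcontfun]) auto
  have Hb: "\<bar>H i t (\<lambda>j. Y g j t)\<bar> \<le> (C + \<theta> * norm g) * \<bar>W' i t - \<nu> i * W i t\<bar>" for g i t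
  proof -
    have "\<bar>H i t (\<lambda>j. Y g j t) - H i t (\<lambda>j. Y 0 j t)\<bar> \<le> \<theta> * dist g 0 * \<bar>W' i t - \<nu> i * W i t\<bar>"
      by (rule lip) (rule Yb)
    then show ?thesis using zero[of i t] by (simp add: Y0 algebra_simps)
  qed
  have ex: "\<exists>y. (\<forall>t. (y has_real_derivative \<nu> i * y t + H i t (\<lambda>j. Y g j t)) (at t)) \<and>
            (\<forall>t. \<bar>y t\<bar> \<le> (C + \<theta> * norm g) * W i t)" for g i
  proof -
    have c: "continuous_on UNIV (\<lambda>t. H i t (\<lambda>j. Y g j t))" by (rule cont) (rule Ycont)
    show ?thesis by (rule linear_solution[OF adm[of i] c Hb[of i _ g]]) blast
  qed
  define \<Phi> where "\<Phi> = (\<lambda>g i. SOME y. (\<forall>t. (y has_real_derivative \<nu> i * y t + H i t (\<lambda>j. Y g j t)) (at t)) \<and>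
            (\<forall>t. \<bar>y t\<bar> \<le> (C + \<theta> * norm g) * W i t))"
  have \<Phi>: "(\<Phi> g i has_real_derivative \<nu> i * \<Phi> g i t + H i t (\<lambda>j. Y g j t)) (at t)"
      "\<bar>\<Phi> g i t\<bar> \<le> (C + \<theta> * norm g) * W i t" for g i t
    using someI_ex[OF ex[of i g]] unfolding \<Phi>_def by blast+
  define P where "P = (\<lambda>g. Bcontfun (\<lambda>(i, t). \<Phi> g i t / W i t))"
  have inb: "(\<lambda>(i, t). \<Phi> g i t / W i t) \<in> bcontfun" for g
  proof -
    have c: "continuous_on UNIV (\<Phi> g i)" for i
      using \<Phi>(1) by (meson DERIV_isCont continuous_at_imp_continuous_on)
    have "continuous_on UNIV (\<lambda>(i, t). \<Phi> g i t / W i t)"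
      by (rule continuous_on_discrete_prod)
        (use Wpos in \<open>auto intro!: continuous_intros c Wcont simp: less_imp_neq[symmetric]\<close>)
    moreover have "norm (\<Phi> g i t / W i t) \<le> C + \<theta> * norm g" for i t
      using \<Phi>(2)[of g i t] Wpos[of i t] by (simp add: abs_divide divide_le_eq)
    then have "bounded (range (\<lambda>(i, t). \<Phi> g i t / W i t))"
      unfolding bounded_iff by auto
    ultimately show ?thesis by (simp add: bcontfun_def)
  qed
  have YP: "Y (P g) = \<Phi> g" for g
    using Wpos by (auto simp: Y_def P_def Bcontfun_inverse[OF inb] less_imp_neq[symmetric] fun_eq_iff)
  have contr: "dist (P g) (P h) \<le> \<theta> * dist g h" for g h
  proof (rule dist_bound, clarify)
    fix i t
    have "\<bar>\<Phi> g i t - \<Phi> h i t\<bar> \<le> (\<theta> * dist g h) * W i t"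
    proof (rule linear_bound[OF adm])
      show "((\<lambda>t. \<Phi> g i t - \<Phi> h i t) has_real_derivative
          \<nu> i * (\<Phi> g i t - \<Phi> h i t) + (H i t (\<lambda>j. Y g j t) - H i t (\<lambda>j. Y h j t))) (at t)" for t
        by (auto intro!: derivative_eq_intros \<Phi>(1) simp: algebra_simps)
      show "\<bar>\<Phi> g i t - \<Phi> h i t\<bar> \<le> ((C + \<theta> * norm g) + (C + \<theta> * norm h)) * W i t" for t
        using \<Phi>(2)[of g i t] \<Phi>(2)[of h i t] by (simp add: algebra_simps)
      show "\<bar>H i t (\<lambda>j. Y g j t) - H i t (\<lambda>j. Y h j t)\<bar> \<le> \<theta> * dist g h * \<bar>W' i t - \<nu> i * W i t\<bar>" for t
        by (rule lip) (rule Yb)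
    qed
    then have "\<bar>\<Phi> g i t / W i t - \<Phi> h i t / W i t\<bar> \<le> \<theta> * dist g h"
      using Wpos[of i t] by (simp add: divide_le_eq flip: diff_divide_distrib)
    then show "dist (apply_bcontfun (P g) (i, t)) (apply_bcontfun (P h) (i, t)) \<le> \<theta> * dist g h"
      by (simp add: P_def Bcontfun_inverse[OF inb] dist_real_def)
  qed
  from banach_fix_type[OF \<theta>, of P] contr obtain g where g: "P g = g" by blast
  show ?thesis
  proof (rule that)
    have e: "Y g = \<Phi> g" using YP[of g] g by simp
    show "(Y g i has_real_derivative \<nu> i * Y g i t + H i t (\<lambda>j. Y g j t)) (at t)" for i t
      using \<Phi>(1)[of g i t] by (simp add: e)
    show "\<bar>Y g i t\<bar> \<le> (C + \<theta> * norm g) * W i t" for i t using \<Phi>(2)[of g i t] by (simp add: e)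
  qed
qed

section \<open>Index type, clipping and weights\<close>

datatype comp = Psi | Que | Xi | Zeta

text \<open>The discrete metric on the index type makes bounded continuous functions on \<open>comp \<times> real\<close> a complete space.\<close>

instantiation comp :: "{metric_space, discrete_topology}"
begin

definition "dist_comp (x :: comp) y = (if x = y then 0 else 1 :: real)"
definition "(uniformity :: (comp \<times> comp) filter) = (INF e\<in>{0<..}. principal {(x, y). dist x y < e})"
definition "open_comp (U :: comp set) = True"

instance
proof
  fix x y z :: comp and U :: "comp set"
  show "(dist x y = 0) = (x = y)" "dist x y \<le> dist x z + dist y z" by (auto simp: dist_comp_def)
  have "\<forall>\<^sub>F (x', y) in uniformity. x' = x \<longrightarrow> y \<in> U" if "x \<in> U" for x
    unfolding uniformity_comp_def
    by (rule eventually_INF1[of 1]) (use that in \<open>auto simp: eventually_principal dist_comp_def split: if_splits\<close>)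
  then show "open U = (\<forall>x\<in>U. \<forall>\<^sub>F (x', y) in uniformity. x' = x \<longrightarrow> y \<in> U)"
    by (auto simp: open_comp_def)
  show "open U" by (simp add: open_comp_def)
qed (simp_all add: uniformity_comp_def open_comp_def)

end

definition clip :: "real \<Rightarrow> real \<Rightarrow> real \<Rightarrow> real" where
  "clip lo hi x = max lo (min hi x)"

lemma clip_bounds: "lo \<le> hi \<Longrightarrow> lo \<le> clip lo hi x \<and> clip lo hi x \<le> hi"
  by (auto simp: clip_def)

lemma clip_lipschitz: "\<bar>clip lo hi x - clip lo hi y\<bar> \<le> \<bar>x - y\<bar>"
  by (auto simp: clip_def min_def max_def)

lemma clip_eq: "lo \<le> x \<Longrightarrow> x \<le> hi \<Longrightarrow> clip lo hi x = x"
  by (simp add: clip_def)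

lemma continuous_on_clip [continuous_intros]:
  "continuous_on A f \<Longrightarrow> continuous_on A (\<lambda>x. clip lo hi (f x))"
  unfolding clip_def by (intro continuous_intros)

text \<open>Two uses of \<open>1 + x \<le> exp x\<close>, based at \<open>u\<close> for the lower
  and at \<open>v\<close> for the upper bound.\<close>

lemma exp_increment:
  fixes u v :: real
  assumes "lo \<le> u" "u \<le> v" "v \<le> hi"
  shows "exp lo * (v - u) \<le> exp v - exp u" "exp v - exp u \<le> exp hi * (v - u)"
proof -
  have "exp u * (1 + (v - u)) \<le> exp u * exp (v - u)" by (intro mult_left_mono exp_ge_add_one_self) auto
  then have "exp u * (v - u) \<le> exp v - exp u" by (simp add: algebra_simps flip: exp_add)
  moreover have "exp lo * (v - u) \<le> exp u * (v - u)" using assms by (intro mult_right_mono) auto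
  ultimately show "exp lo * (v - u) \<le> exp v - exp u" by linarith
  have "exp v * (1 + (u - v)) \<le> exp v * exp (u - v)" by (intro mult_left_mono exp_ge_add_one_self) auto
  then have "exp v - exp u \<le> exp v * (v - u)" by (simp add: algebra_simps flip: exp_add)
  moreover have "exp v * (v - u) \<le> exp hi * (v - u)" using assms by (intro mult_right_mono) auto
  ultimately show "exp v - exp u \<le> exp hi * (v - u)" by linarith
qed

lemma exp_lipschitz:
  fixes u v :: real
  assumes "u \<le> hi" "v \<le> hi"
  shows "\<bar>exp u - exp v\<bar> \<le> exp hi * \<bar>u - v\<bar>"
  using exp_increment(2)[of u u v hi] exp_increment(2)[of v v u hi] assms by (cases "u \<le> v") (auto simp: abs_if)

definition sat :: "real \<Rightarrow> real" where "sat t = exp (2*t) / (1 + exp (2*t))"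

lemma sat_bounds: "0 < sat t" "sat t < 1"
  by (auto simp: sat_def divide_simps add_pos_pos)

text \<open>Clipping bounds \<open>p\<close> by a multiple of \<open>exp (min 0 (2 * t))\<close>,
  whereas the weight absorbs multiples of \<open>sat t\<close>; the two are comparable.\<close>

lemma exp_min_le_sat: "exp (min 0 (2*t)) \<le> 2 * sat t"
  by (cases "t \<ge> 0") (auto simp: sat_def min_def divide_simps add_pos_pos distrib_left)

text \<open>The factor \<open>(1 + exp (2 t)) ^ J\<close> makes integration of terms of size \<open>sat\<close> gain \<open>1 / J\<close>.\<close>

definition wgt :: "nat \<Rightarrow> real \<Rightarrow> real" where "wgt J t = exp (2*t) * (1 + exp (2*t)) ^ J"

text \<open>Written through the logarithmic derivative of the weight, which rises from 2 at
  \<open>-\<infinity>\<close> to \<open>2 + 2 J\<close> at \<open>+\<infinity>\<close>. The gap to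
  \<open>nu i\<close> is measured with it.\<close>

definition wgt' :: "nat \<Rightarrow> real \<Rightarrow> real" where "wgt' J t = (2 + 2 * real J * sat t) * wgt J t"

lemma wgt_pos: "wgt J t > 0"
  by (auto simp: wgt_def add_pos_pos)

lemma wgt_deriv: "(wgt J has_real_derivative wgt' J t) (at t)"
proof -
  have nz: "1 + exp (2*t) \<noteq> 0" by (smt (verit) exp_gt_zero)
  have p: "(1 + exp (2*t)) ^ J * (real J / (1 + exp (2*t))) = real J * (1 + exp (2*t)) ^ (J - 1)"
    using nz by (cases J) (auto simp: field_simps)
  have "wgt' J t = 2 * wgt J t + 2 * exp (2*t) * exp (2*t) * ((1 + exp (2*t)) ^ J * (real J / (1 + exp (2*t))))"
    by (simp add: wgt'_def sat_def wgt_def algebra_simps)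
  then have e: "wgt' J t = 2 * wgt J t + exp (2*t) * (real J * (1 + exp (2*t)) ^ (J - 1) * (2 * exp (2*t)))"
    unfolding p by (simp add: algebra_simps)
  show ?thesis unfolding e unfolding wgt_def
    by (auto intro!: derivative_eq_intros)
qed

lemma wgt_at_bot: "\<nu> \<le> 0 \<Longrightarrow> ((\<lambda>t. exp (- \<nu> * t) * (k * wgt J t)) \<longlongrightarrow> 0) at_bot"
proof -
  assume \<nu>: "\<nu> \<le> 0"
  have e: "(\<lambda>t. exp (- \<nu> * t) * (k * wgt J t)) = (\<lambda>t. exp ((2 - \<nu>) * t) * (k * (1 + exp (2*t)) ^ J))"
    by (auto simp: wgt_def fun_eq_iff algebra_simps simp flip: exp_add)
  have "((\<lambda>t. exp ((2 - \<nu>) * t)) \<longlongrightarrow> 0) at_bot" using \<nu> by real_asymp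
  moreover have "((\<lambda>t::real. exp (2*t)) \<longlongrightarrow> 0) at_bot" by real_asymp
  then have "((\<lambda>t::real. k * (1 + exp (2*t)) ^ J) \<longlongrightarrow> k * (1 + 0) ^ J) at_bot" by (intro tendsto_intros)
  ultimately show ?thesis unfolding e using tendsto_mult by fastforce
qed

lemma wgt_le: "t \<ge> 0 \<Longrightarrow> wgt J t \<le> 2 ^ J * exp ((2 + 2 * real J) * t)"
proof -
  assume t: "t \<ge> 0"
  have "(1 + exp (2*t)) ^ J \<le> (2 * exp (2*t)) ^ J" using t by (intro power_mono) auto
  then have "wgt J t \<le> exp (2*t) * (2 * exp (2*t)) ^ J" unfolding wgt_def by (intro mult_left_mono) auto
  also have "\<dots> = 2 ^ J * exp ((2 + 2 * real J) * t)"
    by (simp add: power_mult_distrib exp_of_nat_mult[symmetric] algebra_simps flip: exp_add)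
  finally show ?thesis .
qed

lemma wgt_at_top: "\<nu> > 2 + 2 * real J \<Longrightarrow> ((\<lambda>t. exp (- \<nu> * t) * (k * wgt J t)) \<longlongrightarrow> 0) at_top"
proof -
  assume \<nu>: "\<nu> > 2 + 2 * real J"
  have "((\<lambda>t. exp (- \<nu> * t) * (wgt J t)) \<longlongrightarrow> 0) at_top"
  proof (rule Lim_null_comparison)
    show "\<forall>\<^sub>F t in at_top. norm (exp (- \<nu> * t) * wgt J t) \<le> 2 ^ J * exp ((2 + 2 * real J - \<nu>) * t)"
      using eventually_ge_at_top[of 0]
    proof eventually_elim
      case (elim t)
      have "exp (- \<nu> * t) * wgt J t \<le> exp (- \<nu> * t) * (2 ^ J * exp ((2 + 2 * real J) * t))"
        using wgt_le[OF elim] by (intro mult_left_mono) auto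
      also have "\<dots> = 2 ^ J * exp ((2 + 2 * real J - \<nu>) * t)" by (simp add: algebra_simps flip: exp_add)
      finally show ?case using wgt_pos[of J t] by (simp add: abs_mult)
    qed
    have "2 + 2 * real J - \<nu> < 0" using \<nu> by simp
    then show "((\<lambda>t. 2 ^ J * exp ((2 + 2 * real J - \<nu>) * t)) \<longlongrightarrow> 0) at_top" by real_asymp
  qed
  from tendsto_mult_right_zero[OF this, of k] show ?thesis by (simp add: mult_ac)
qed

section \<open>The clipped system\<close>

text \<open>
  With \<open>\<zeta> = ln (r / r\<^sub>0)\<close>, \<open>\<xi> = ln (s / s\<^sub>0) - n \<zeta>\<close>, \<open>c = (\<alpha> - m - n) / (\<lambda> (1 + \<alpha>))\<close>, \<open>S = s\<^sub>0\<close> and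
  \<open>p = exp (2 t + \<psi> + kap \<xi> + gam n \<zeta>)\<close> the system becomes, for \<open>v = p r\<close> and \<open>u = \<lambda> v + q\<close>,
  \<open>\<psi>' = - (1 + gam) u\<close>, \<open>q' = q (1 - u) + b v\<close>, \<open>\<xi>' = - (1 + \<alpha>) sig\<close>,
  \<open>n \<zeta>' = c a (exp \<zeta> - 1) + u + \<alpha> sig\<close>.
  Extracting \<open>kap \<xi> + gam n \<zeta>\<close> from \<open>ln p\<close> removes the linear dependence of \<open>\<psi>'\<close> on \<open>\<zeta>\<close>, which makes the
  coupling triangular up to small terms. The remaining parameters are the box \<open>Q\<close>, \<open>P\<close>, \<open>Z\<close>, \<open>e\<close> to which the
  unknowns are clipped, Lipschitz constants \<open>V0\<close>, \<open>gX\<close>, \<open>g0\<close>, \<open>g1\<close>, \<open>Cs\<close>, the contraction factor \<open>th\<close>, and the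
  scales \<open>M\<close>, \<open>J\<close> of the weights.
\<close>

locale slow_fast =
  fixes lam al n c a b S Q P Z e V0 gX g0 g1 k3 th M Cs :: real and J :: nat
  assumes pos: "lam > 0" "al > 0" "n > 0" "c > 0" "a > 0" "b > 0" "S > 0"
      "Q > 0" "Z > 0" "e > 0" "gX > 0" "g0 > 0" "M \<ge> 1"
    and P: "P \<ge> exp 1" and th: "0 \<le> th" "th < 1"
    and small: "e + n * Z \<le> 1" "1/(lam*c) * n \<le> 1"
      "1/(lam*c) * al/(1+al) * e + 1/(lam*c) * n * Z \<le> 1"
    and k3: "1/(lam*c) * al/(1+al) + 3 \<le> k3"
    and V0: "2 * a * exp Z * P \<le> V0"
    and gX: "(1+al) * (a * S * exp (Z + 1)) / lam \<le> gX"
    and g0: "2 * g0 \<le> c * a * exp (- Z)" "al * Cs \<le> g0"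
    and g1: "c * a * exp Z + 2 * lam * V0 + g0 \<le> g1"
    and Cs: "exp Z * (3 * a * S * (e + n * Z) + 3 * n * a * S + n) \<le> Cs * lam"
    and rowPsi: "(1 + 1/(lam*c)) * (lam * V0 * k3 * M) \<le> 2 * real J * th" "1 + 1/(lam*c) \<le> 2 * th * M"
    and rowQ: "2 * Q + 1 \<le> th * (2 * Q + 2)" "lam * V0 + (lam * Q + b) * V0 * k3 * M^2 \<le> 2 * real J * th"
    and rowXi: "gX + (1 + al) * Cs * M \<le> th * (gX + 2)"
    and rowZeta: "g1 - g0 + (1 + lam * V0 * (1 + 1/(lam*c) * al/(1+al)) + gX) / M \<le> th * (g1 - n * (2 + 2 * real J))"
      "n * (2 + 2 * real J) < g0"
begin

definition "gam = 1 / (lam * c)"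
definition "kap = gam * al / (1 + al)"
text \<open>In the original variables this is \<open>r * (s - (1 + m + n) / (1 + al)) / lam + n /
  (lam * (1 + al))\<close>, the combination common to the \<open>r\<close> and \<open>s\<close>
  equations; it vanishes at \<open>M0\<close>.\<close>

definition "sig x z = (a * S * exp z * (exp (x + n * z) - 1) - n / (1+al) * (exp z - 1)) / lam"
text \<open>The clipped \<open>ln p\<close>. The cap \<open>ln P\<close> acts for large
  \<open>t\<close>; \<open>min \<psi> 0\<close> keeps the exponent below \<open>2 * t\<close> plus a
  constant whatever \<open>\<psi>\<close> is, so that the coupling decays at
  \<open>-\<infinity>\<close>. The orbit turns out to satisfy \<open>\<psi> \<le> 0\<close>.\<close>

definition "lh t \<psi> x z = min (ln P) (2 * t + min \<psi> 0 + kap * x + gam * n * z)"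
definition "vh t \<psi> x z = a * exp (lh t \<psi> x z + z)"

lemma gam_pos: "gam > 0" and kap_pos: "kap > 0"
  using pos by (auto simp: gam_def kap_def)

lemma small': "gam * n \<le> 1" "kap * e + gam * n * Z \<le> 1" "kap + 3 \<le> k3"
  using small k3 by (auto simp: gam_def kap_def)

lemma V0_pos: "V0 > 0"
  using V0 pos P by (smt (verit) exp_gt_zero mult_pos_pos)

lemma Cs_pos: "Cs > 0"
proof -
  have "0 < exp Z * (3 * a * S * (e + n * Z) + 3 * n * a * S + n)"
    using pos by (intro mult_pos_pos add_pos_pos) auto
  then have "0 < Cs * lam" using Cs by linarith
  then show ?thesis using pos by (simp add: zero_less_mult_iff)
qed

lemma box_bound: "\<bar>x\<bar> \<le> e \<Longrightarrow> \<bar>z\<bar> \<le> Z \<Longrightarrow> \<bar>x + n * z\<bar> \<le> e + n * Z"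
proof -
  assume "\<bar>x\<bar> \<le> e" "\<bar>z\<bar> \<le> Z"
  moreover have "\<bar>n * z\<bar> \<le> n * Z" using \<open>\<bar>z\<bar> \<le> Z\<close> pos by (simp add: abs_mult)
  ultimately show ?thesis by linarith
qed

text \<open>The slope of \<open>sig\<close> in \<open>x\<close> is \<open>a * S / lam\<close> times
  the exponential of \<open>z + (x + n * z)\<close>. In the box the two summands are at most
  \<open>Z\<close> and 1 in modulus, whence the exponents \<open>- Z - 1\<close> and
  \<open>Z + 1\<close>.\<close>

lemma sig_xi:
  assumes "\<bar>x\<bar> \<le> e" "\<bar>x'\<bar> \<le> e" "\<bar>z\<bar> \<le> Z" "x \<le> x'"
  shows "a * S * exp (- Z - 1) / lam * (x' - x) \<le> sig x' z - sig x z"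
    "(1 + al) * (sig x' z - sig x z) \<le> gX * (x' - x)"
proof -
  have b1: "\<bar>x + n * z\<bar> \<le> 1" "\<bar>x' + n * z\<bar> \<le> 1"
    using box_bound[of x z] box_bound[of x' z] assms small by auto
  have eq: "sig x' z - sig x z = a * S / lam * (exp z * (exp (x' + n * z) - exp (x + n * z)))"
    by (simp add: sig_def algebra_simps diff_divide_distrib add_divide_distrib)
  have i: "exp (-1) * (x' - x) \<le> exp (x' + n * z) - exp (x + n * z)"
      "exp (x' + n * z) - exp (x + n * z) \<le> exp 1 * (x' - x)"
    using exp_increment[of "-1" "x + n * z" "x' + n * z" 1] b1 assms by auto
  have "exp (- Z) * (exp (-1) * (x' - x)) \<le> exp z * (exp (x' + n * z) - exp (x + n * z))"
    using assms i by (intro mult_mono) auto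
  then have "a * S / lam * (exp (- Z) * (exp (-1) * (x' - x))) \<le> sig x' z - sig x z"
    unfolding eq using pos by (intro mult_left_mono) auto
  then show "a * S * exp (- Z - 1) / lam * (x' - x) \<le> sig x' z - sig x z"
    by (simp add: exp_diff exp_minus field_simps)
  have "exp z * (exp (x' + n * z) - exp (x + n * z)) \<le> exp Z * (exp 1 * (x' - x))"
    using assms i by (intro mult_mono) auto
  then have "sig x' z - sig x z \<le> a * S / lam * (exp Z * (exp 1 * (x' - x)))"
    unfolding eq using pos by (intro mult_left_mono) auto
  also have "\<dots> = (a * S * exp (Z + 1)) / lam * (x' - x)" by (simp add: exp_add)
  finally have "(1 + al) * (sig x' z - sig x z) \<le> (1 + al) * ((a * S * exp (Z + 1)) / lam * (x' - x))"
    using pos by (intro mult_left_mono) auto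
  also have "\<dots> = (1+al) * (a * S * exp (Z + 1)) / lam * (x' - x)" by simp
  also have "\<dots> \<le> gX * (x' - x)" using gX assms by (intro mult_right_mono) auto
  finally show "(1 + al) * (sig x' z - sig x z) \<le> gX * (x' - x)" .
qed

text \<open>A slope between 0 and \<open>gX\<close> leaves, after splitting off
  \<open>gX * x\<close>, a remainder of Lipschitz constant \<open>gX\<close>. The gap available to
  this component is at least \<open>gX + 2\<close>, hence the strict contraction.\<close>

lemma sig_xi_lipschitz:
  assumes "\<bar>x\<bar> \<le> e" "\<bar>x'\<bar> \<le> e" "\<bar>z\<bar> \<le> Z"
  shows "\<bar>gX * (x' - x) - (1 + al) * (sig x' z - sig x z)\<bar> \<le> gX * \<bar>x' - x\<bar>"
    "al * \<bar>sig x' z - sig x z\<bar> \<le> gX * \<bar>x' - x\<bar>"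
proof -
  have *: "\<bar>gX * (x' - x) - (1 + al) * (sig x' z - sig x z)\<bar> \<le> gX * \<bar>x' - x\<bar> \<and>
      al * \<bar>sig x' z - sig x z\<bar> \<le> gX * \<bar>x' - x\<bar>"
    if a: "\<bar>x\<bar> \<le> e" "\<bar>x'\<bar> \<le> e" "x \<le> x'" for x x'
  proof -
    have "0 \<le> a * S * exp (- Z - 1) / lam * (x' - x)" using pos a by auto
    moreover define D where "D = sig x' z - sig x z"
    ultimately have D: "0 \<le> D" using sig_xi(1)[OF a(1,2) assms(3) a(3)] by linarith
    then have "0 \<le> al * D" using pos by simp
    moreover have "(1 + al) * D = al * D + D" by (simp add: algebra_simps)
    moreover have "(1 + al) * D \<le> gX * (x' - x)" using sig_xi(2)[OF a(1,2) assms(3) a(3)] by (simp add: D_def)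
    moreover have "\<bar>x' - x\<bar> = x' - x" "\<bar>D\<bar> = D" using a D by auto
    ultimately show ?thesis unfolding D_def[symmetric] using D by auto
  qed
  have "gX * (x' - x) - (1 + al) * (sig x' z - sig x z) = - (gX * (x - x') - (1 + al) * (sig x z - sig x' z))"
    by (simp add: algebra_simps)
  then have "\<bar>gX * (x' - x) - (1 + al) * (sig x' z - sig x z)\<bar> = \<bar>gX * (x - x') - (1 + al) * (sig x z - sig x' z)\<bar>"
    by (metis abs_minus_cancel)
  then show "\<bar>gX * (x' - x) - (1 + al) * (sig x' z - sig x z)\<bar> \<le> gX * \<bar>x' - x\<bar>"
    using *[of x x'] *[of x' x] assms by (cases "x \<le> x'") (auto simp: abs_minus_commute[of x x'])
  show "al * \<bar>sig x' z - sig x z\<bar> \<le> gX * \<bar>x' - x\<bar>"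
    using *[of x x'] *[of x' x] assms by (cases "x \<le> x'") (auto simp: abs_minus_commute)
qed

text \<open>Every contribution of \<open>z\<close> to \<open>sig\<close> carries a small factor:
  \<open>E z - 1\<close> is of size \<open>e + n * Z\<close>, the inner exponent varies with factor
  \<open>n\<close>, and the last term has the coefficient \<open>n\<close>. So \<open>Cs\<close> can
  be small, which is what makes the coupling nearly triangular.\<close>

lemma sig_zeta_lipschitz:
  assumes "\<bar>x\<bar> \<le> e" "\<bar>z\<bar> \<le> Z" "\<bar>z'\<bar> \<le> Z"
  shows "\<bar>sig x z' - sig x z\<bar> \<le> Cs * \<bar>z' - z\<bar>"
proof -
  define E where "E = (\<lambda>z. exp (x + n * z))"
  have b1: "\<bar>x + n * z\<bar> \<le> e + n * Z" "\<bar>x + n * z'\<bar> \<le> e + n * Z"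
    using box_bound assms by auto
  have e3: "exp (1::real) \<le> 3" by (rule exp_le)
  have E1: "\<bar>E z' - 1\<bar> \<le> 3 * (e + n * Z)"
  proof -
    have "\<bar>E z' - exp 0\<bar> \<le> exp 1 * \<bar>(x + n * z') - 0\<bar>"
      unfolding E_def by (rule exp_lipschitz) (use b1 small in auto)
    also have "\<dots> \<le> 3 * (e + n * Z)" using b1 e3 by (intro mult_mono) auto
    finally show ?thesis by simp
  qed
  have E2: "\<bar>E z' - E z\<bar> \<le> 3 * n * \<bar>z' - z\<bar>"
  proof -
    have "\<bar>E z' - E z\<bar> \<le> exp 1 * \<bar>(x + n * z') - (x + n * z)\<bar>"
      unfolding E_def by (rule exp_lipschitz) (use b1 small in auto)
    also have "\<dots> = exp 1 * (n * \<bar>z' - z\<bar>)" using pos by (simp add: abs_mult flip: right_diff_distrib)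
    also have "\<dots> \<le> 3 * (n * \<bar>z' - z\<bar>)" using e3 pos by (intro mult_right_mono) auto
    finally show ?thesis by simp
  qed
  have X: "\<bar>exp z' - exp z\<bar> \<le> exp Z * \<bar>z' - z\<bar>" by (rule exp_lipschitz) (use assms in auto)
  have eq: "lam * (sig x z' - sig x z) =
     a * S * ((exp z' - exp z) * (E z' - 1)) + a * S * (exp z * (E z' - E z)) - n / (1+al) * (exp z' - exp z)"
  proof -
    have l: "lam * sig x z = a * S * exp z * (E z - 1) - n / (1+al) * (exp z - 1)" for z
      using pos by (simp add: sig_def E_def)
    show ?thesis unfolding right_diff_distrib[of lam] l by (simp add: algebra_simps diff_divide_distrib)
  qed
  have t1: "\<bar>(exp z' - exp z) * (E z' - 1)\<bar> \<le> exp Z * \<bar>z' - z\<bar> * (3 * (e + n * Z))"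
    unfolding abs_mult using X E1 by (intro mult_mono) auto
  have t2: "\<bar>exp z * (E z' - E z)\<bar> \<le> exp Z * (3 * n * \<bar>z' - z\<bar>)"
    unfolding abs_mult using E2 assms by (intro mult_mono) auto
  have t3: "\<bar>n / (1+al) * (exp z' - exp z)\<bar> \<le> n * (exp Z * \<bar>z' - z\<bar>)"
    unfolding abs_mult using X pos by (intro mult_mono) (auto simp: divide_le_eq)
  have "\<bar>lam * (sig x z' - sig x z)\<bar> \<le> a * S * (exp Z * \<bar>z' - z\<bar> * (3 * (e + n * Z)))
      + a * S * (exp Z * (3 * n * \<bar>z' - z\<bar>)) + n * (exp Z * \<bar>z' - z\<bar>)"
  proof -
    have "\<bar>a * S * ((exp z' - exp z) * (E z' - 1))\<bar> \<le> a * S * (exp Z * \<bar>z' - z\<bar> * (3 * (e + n * Z)))"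
      unfolding abs_mult[of "a * S"] using t1 pos by (intro mult_mono) auto
    moreover have "\<bar>a * S * (exp z * (E z' - E z))\<bar> \<le> a * S * (exp Z * (3 * n * \<bar>z' - z\<bar>))"
      unfolding abs_mult[of "a * S"] using t2 pos by (intro mult_mono) auto
    ultimately show ?thesis unfolding eq using t3 by linarith
  qed
  also have "\<dots> = exp Z * (3 * a * S * (e + n * Z) + 3 * n * a * S + n) * \<bar>z' - z\<bar>"
    by (simp add: algebra_simps)
  also have "\<dots> \<le> Cs * lam * \<bar>z' - z\<bar>" using Cs by (intro mult_right_mono) auto
  finally have "lam * \<bar>sig x z' - sig x z\<bar> \<le> lam * (Cs * \<bar>z' - z\<bar>)" using pos by (simp add: abs_mult mult_ac)
  then show ?thesis using pos by simp
qed

lemma lh_bound: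
  assumes "\<bar>x\<bar> \<le> e" "\<bar>z\<bar> \<le> Z"
  shows "lh t \<psi> x z \<le> ln P + min 0 (2 * t)"
proof -
  have "kap * x \<le> kap * e" "gam * n * z \<le> gam * n * Z"
    using assms kap_pos gam_pos pos by (auto intro!: mult_left_mono)
  moreover have "1 \<le> ln P" using P by (metis exp_gt_zero ln_exp ln_mono order_less_le_trans)
  ultimately show ?thesis using small' by (auto simp: lh_def min_def)
qed

lemma exp_lh_bound:
  assumes "\<bar>x\<bar> \<le> e" "\<bar>z\<bar> \<le> Z"
  shows "exp (lh t \<psi> x z) \<le> 2 * P * sat t"
proof -
  have "exp (lh t \<psi> x z) \<le> exp (ln P + min 0 (2 * t))" using lh_bound[OF assms] by simp
  also have "\<dots> = P * exp (min 0 (2*t))" using P by (simp add: exp_add order_less_le_trans[OF exp_gt_zero])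
  also have "\<dots> \<le> P * (2 * sat t)" using P by (intro mult_left_mono exp_min_le_sat) (smt (verit) exp_gt_zero)
  finally show ?thesis by simp
qed

lemma vh_bound:
  assumes "\<bar>x\<bar> \<le> e" "\<bar>z\<bar> \<le> Z"
  shows "0 < vh t \<psi> x z" "vh t \<psi> x z \<le> V0 * sat t" "vh t \<psi> x z \<le> V0"
proof -
  show "0 < vh t \<psi> x z" using pos by (simp add: vh_def)
  have "exp (lh t \<psi> x z) * exp z \<le> (2 * P * sat t) * exp Z"
    using exp_lh_bound[OF assms, of t \<psi>] assms P sat_bounds[of t]
    by (intro mult_mono) (auto intro!: mult_nonneg_nonneg simp: less_imp_le order_trans[OF exp_ge_zero])
  then have "vh t \<psi> x z \<le> a * ((2 * P * sat t) * exp Z)"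
    unfolding vh_def exp_add using pos by (intro mult_left_mono) auto
  also have "\<dots> = (2 * a * exp Z * P) * sat t" by simp
  also have "\<dots> \<le> V0 * sat t" using V0 sat_bounds[of t] by (intro mult_right_mono) auto
  finally show v: "vh t \<psi> x z \<le> V0 * sat t" .
  also have "\<dots> \<le> V0 * 1" using V0_pos sat_bounds[of t] by (intro mult_left_mono) auto
  finally show "vh t \<psi> x z \<le> V0" by simp
qed

text \<open>The factor \<open>sat t\<close> survives because the exponent stays below
  \<open>ln P + min 0 (2 * t) + Z\<close>. It is the part of a Lipschitz constant that a large
  \<open>J\<close> can absorb.\<close>

lemma vh_lipschitz:
  assumes "\<bar>x\<bar> \<le> e" "\<bar>z\<bar> \<le> Z" "\<bar>x'\<bar> \<le> e" "\<bar>z'\<bar> \<le> Z"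
  shows "\<bar>vh t \<psi> x z - vh t \<psi>' x' z'\<bar> \<le>
    V0 * sat t * (\<bar>\<psi> - \<psi>'\<bar> + kap * \<bar>x - x'\<bar> + (1 + gam * n) * \<bar>z - z'\<bar>)"
proof -
  let ?B = "ln P + min 0 (2 * t) + Z"
  have "\<bar>exp (lh t \<psi> x z + z) - exp (lh t \<psi>' x' z' + z')\<bar>
      \<le> exp ?B * \<bar>(lh t \<psi> x z + z) - (lh t \<psi>' x' z' + z')\<bar>"
    by (rule exp_lipschitz) (use lh_bound[of x z t \<psi>] lh_bound[of x' z' t \<psi>'] assms in auto)
  also have "\<dots> \<le> exp ?B * (\<bar>\<psi> - \<psi>'\<bar> + kap * \<bar>x - x'\<bar> + (1 + gam * n) * \<bar>z - z'\<bar>)"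
  proof (intro mult_left_mono)
    have "\<bar>kap * x - kap * x'\<bar> = kap * \<bar>x - x'\<bar>" "\<bar>gam * n * z - gam * n * z'\<bar> = gam * n * \<bar>z - z'\<bar>"
      using kap_pos gam_pos pos by (auto simp: abs_mult simp flip: right_diff_distrib)
    then show "\<bar>(lh t \<psi> x z + z) - (lh t \<psi>' x' z' + z')\<bar> \<le> \<bar>\<psi> - \<psi>'\<bar> + kap * \<bar>x - x'\<bar> + (1 + gam * n) * \<bar>z - z'\<bar>"
    proof -
      assume lin: "\<bar>kap * x - kap * x'\<bar> = kap * \<bar>x - x'\<bar>" "\<bar>gam * n * z - gam * n * z'\<bar> = gam * n * \<bar>z - z'\<bar>"
      have min_lip: "\<bar>min u w - min v w\<bar> \<le> \<bar>u - v\<bar>" for u v w :: real by (auto simp: min_def)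
      have "\<bar>lh t \<psi> x z - lh t \<psi>' x' z'\<bar> \<le>
          \<bar>(min \<psi> 0 + kap * x + gam * n * z) - (min \<psi>' 0 + kap * x' + gam * n * z')\<bar>"
        using min_lip[of "2 * t + min \<psi> 0 + kap * x + gam * n * z" "ln P" "2 * t + min \<psi>' 0 + kap * x' + gam * n * z'"]
        unfolding lh_def min.commute[of "ln P"] by linarith
      moreover have "\<bar>min \<psi> 0 - min \<psi>' 0\<bar> \<le> \<bar>\<psi> - \<psi>'\<bar>" by (rule min_lip)
      moreover have "(1 + gam * n) * \<bar>z - z'\<bar> = \<bar>z - z'\<bar> + gam * n * \<bar>z - z'\<bar>" by (simp add: algebra_simps)
      moreover have "\<bar>(u + v + w) - (u' + v' + w')\<bar> \<le> \<bar>u - u'\<bar> + \<bar>v - v'\<bar> + \<bar>w - w'\<bar>" for u v w u' v' w' :: real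
        by linarith
      note this[of "min \<psi> 0" "kap * x" "gam * n * z" "min \<psi>' 0" "kap * x'" "gam * n * z'", unfolded lin]
      moreover have "\<bar>(lh t \<psi> x z + z) - (lh t \<psi>' x' z' + z')\<bar> \<le> \<bar>lh t \<psi> x z - lh t \<psi>' x' z'\<bar> + \<bar>z - z'\<bar>"
        by linarith
      ultimately show ?thesis by argo
    qed
  qed simp
  finally have "a * \<bar>exp (lh t \<psi> x z + z) - exp (lh t \<psi>' x' z' + z')\<bar>
     \<le> a * (exp ?B * (\<bar>\<psi> - \<psi>'\<bar> + kap * \<bar>x - x'\<bar> + (1 + gam * n) * \<bar>z - z'\<bar>))"
    using pos by (intro mult_left_mono) auto
  also have "\<dots> = a * exp ?B * (\<bar>\<psi> - \<psi>'\<bar> + kap * \<bar>x - x'\<bar> + (1 + gam * n) * \<bar>z - z'\<bar>)" by simp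
  also have "\<dots> \<le> V0 * sat t * (\<bar>\<psi> - \<psi>'\<bar> + kap * \<bar>x - x'\<bar> + (1 + gam * n) * \<bar>z - z'\<bar>)"
  proof (intro mult_right_mono)
    have "P > 0" using P by (smt (verit) exp_gt_zero)
    then have "a * exp ?B = a * P * exp Z * exp (min 0 (2*t))" by (simp add: exp_add)
    also have "\<dots> \<le> a * P * exp Z * (2 * sat t)"
      using \<open>P > 0\<close> pos by (intro mult_left_mono exp_min_le_sat) auto
    also have "\<dots> = 2 * a * exp Z * P * sat t" by simp
    also have "\<dots> \<le> V0 * sat t" using V0 sat_bounds[of t] by (intro mult_right_mono) auto
    finally show "a * exp ?B \<le> V0 * sat t" .
    show "0 \<le> \<bar>\<psi> - \<psi>'\<bar> + kap * \<bar>x - x'\<bar> + (1 + gam * n) * \<bar>z - z'\<bar>"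
      using kap_pos gam_pos pos by (intro add_nonneg_nonneg mult_nonneg_nonneg) auto
  qed
  finally show ?thesis unfolding vh_def using pos by (simp add: abs_mult flip: right_diff_distrib)
qed

text \<open>Monotonicity in \<open>z\<close> gives the coupling the same sign as the fast expansion,
  so it may be large without spoiling the lower slope in \<open>rhs_zeta_slope\<close>.\<close>

lemma vh_mono: "z \<le> z' \<Longrightarrow> vh t \<psi> x z \<le> vh t \<psi> x z'"
proof -
  assume z: "z \<le> z'"
  have "gam * n * z \<le> gam * n * z'" using z gam_pos pos by (intro mult_left_mono) auto
  then have "lh t \<psi> x z \<le> lh t \<psi> x z'" by (auto simp: lh_def)
  then show ?thesis using z pos by (simp add: vh_def)
qed

end

context slow_fast
begin

text \<open>
  Splitting off \<open>nu i\<close> times the unknown, its largest slope in modulus, leaves a remainder whose Lipschitz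
  constant is strictly smaller than the gap between \<open>nu i\<close> and the growth rate of the weight.
\<close>

definition nu :: "comp \<Rightarrow> real" where
  "nu i = (case i of Psi \<Rightarrow> 0 | Que \<Rightarrow> - (2 * Q) | Xi \<Rightarrow> - gX | Zeta \<Rightarrow> g1 / n)"

text \<open>A component that depends on one of smaller scale gains a power of \<open>1 / M\<close>.
  \<open>Zeta\<close> depends on all others and gets the largest scale; \<open>Que\<close> gets the
  smallest because \<open>q\<close> enters the \<open>Psi\<close> equation without a factor
  \<open>sat\<close>.\<close>

definition scale :: "comp \<Rightarrow> real" where
  "scale i = (case i of Psi \<Rightarrow> 1 / M | Que \<Rightarrow> 1 / M^2 | Xi \<Rightarrow> 1 / M | Zeta \<Rightarrow> 1)"

definition rhs :: "comp \<Rightarrow> real \<Rightarrow> real \<Rightarrow> real \<Rightarrow> real \<Rightarrow> real \<Rightarrow> real" where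
  "rhs i t \<psi> q x z = (case i of
      Psi \<Rightarrow> - ((1 + gam) * (lam * vh t \<psi> x z + q))
    | Que \<Rightarrow> 2 * Q * q + q * (1 - lam * vh t \<psi> x z - q) + b * vh t \<psi> x z
    | Xi \<Rightarrow> gX * x - (1 + al) * sig x z
    | Zeta \<Rightarrow> (c * a * (exp z - 1) + lam * vh t \<psi> x z + q + al * sig x z - g1 * z) / n)"

definition clipped_rhs :: "comp \<Rightarrow> real \<Rightarrow> (comp \<Rightarrow> real) \<Rightarrow> real" where
  "clipped_rhs i t y = rhs i t (y Psi) (clip 0 Q (y Que)) (clip (- e) e (y Xi)) (clip (- Z) Z (y Zeta))"

lemma g_order: "g0 \<le> g1" "n * (2 + 2 * real J) < g1"
proof -
  have "0 \<le> c * a * exp Z" "0 \<le> 2 * lam * V0" using pos V0_pos by auto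
  then show "g0 \<le> g1" using g1 by linarith
  then show "n * (2 + 2 * real J) < g1" using rowZeta by linarith
qed

text \<open>The exponential contributes a slope of at least \<open>2 * g0\<close>, \<open>vh\<close>
  is increasing, and \<open>sig\<close> perturbs by at most \<open>g0\<close> because
  \<open>al * Cs \<le> g0\<close>.\<close>

lemma rhs_zeta_slope:
  fixes t \<psi> :: real
  assumes "\<bar>x\<bar> \<le> e" "\<bar>z\<bar> \<le> Z" "\<bar>z'\<bar> \<le> Z" "z \<le> z'"
  defines "F \<equiv> \<lambda>z. c * a * (exp z - 1) + lam * vh t \<psi> x z + al * sig x z"
  shows "g0 * (z' - z) \<le> F z' - F z" "F z' - F z \<le> g1 * (z' - z)"
proof -
  have s: "al * \<bar>sig x z' - sig x z\<bar> \<le> g0 * (z' - z)"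
  proof -
    have "al * \<bar>sig x z' - sig x z\<bar> \<le> al * (Cs * \<bar>z' - z\<bar>)"
      using sig_zeta_lipschitz[OF assms(1-3)] pos by (intro mult_left_mono) auto
    also have "\<dots> = al * Cs * (z' - z)" using assms by simp
    also have "\<dots> \<le> g0 * (z' - z)" using g0 assms by (intro mult_right_mono) auto
    finally show ?thesis .
  qed
  have s2: "\<bar>al * sig x z' - al * sig x z\<bar> \<le> g0 * (z' - z)"
    using s pos by (simp add: abs_mult flip: right_diff_distrib)
  have x: "exp (- Z) * (z' - z) \<le> exp z' - exp z" "exp z' - exp z \<le> exp Z * (z' - z)"
    using exp_increment[of "- Z" z z' Z] assms by auto
  have v: "0 \<le> lam * (vh t \<psi> x z' - vh t \<psi> x z)" using vh_mono assms pos by auto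
  have "\<bar>vh t \<psi> x z' - vh t \<psi> x z\<bar> \<le> V0 * sat t * ((1 + gam * n) * (z' - z))"
    using vh_lipschitz[of x z' x z t \<psi> \<psi>] assms by simp
  also have "\<dots> \<le> V0 * 1 * (2 * (z' - z))"
    using V0_pos sat_bounds[of t] small' assms gam_pos pos by (intro mult_mono) auto
  finally have v2: "vh t \<psi> x z' - vh t \<psi> x z \<le> 2 * V0 * (z' - z)" by (simp add: algebra_simps abs_le_iff)
  have v3: "lam * (vh t \<psi> x z' - vh t \<psi> x z) \<le> lam * (2 * V0 * (z' - z))" using v2 pos by (intro mult_left_mono) auto
  have eq: "F z' - F z = c * a * (exp z' - exp z) + lam * (vh t \<psi> x z' - vh t \<psi> x z) + (al * sig x z' - al * sig x z)"
    by (simp add: F_def algebra_simps)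
  have "2 * g0 * (z' - z) \<le> c * a * exp (- Z) * (z' - z)" using g0 assms by (intro mult_right_mono) auto
  also have "\<dots> = c * a * (exp (- Z) * (z' - z))" by simp
  also have "\<dots> \<le> c * a * (exp z' - exp z)" using x pos by (intro mult_left_mono) auto
  finally show "g0 * (z' - z) \<le> F z' - F z" using eq s2 v by (simp add: abs_le_iff)
  have "c * a * (exp z' - exp z) \<le> c * a * (exp Z * (z' - z))" using x pos by (intro mult_left_mono) auto
  then have "F z' - F z \<le> c * a * (exp Z * (z' - z)) + lam * (2 * V0 * (z' - z)) + g0 * (z' - z)"
    using eq s2 v3 by linarith
  also have "\<dots> = (c * a * exp Z + 2 * lam * V0 + g0) * (z' - z)" by (simp add: algebra_simps)
  also have "\<dots> \<le> g1 * (z' - z)" using g1 assms by (intro mult_right_mono) auto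
  finally show "F z' - F z \<le> g1 * (z' - z)" .
qed

lemma rhs_zeta_contraction:
  fixes t \<psi> :: real
  assumes "\<bar>x\<bar> \<le> e" "\<bar>z\<bar> \<le> Z" "\<bar>z'\<bar> \<le> Z"
  defines "F \<equiv> \<lambda>z. c * a * (exp z - 1) + lam * vh t \<psi> x z + al * sig x z"
  shows "\<bar>F z - F z' - g1 * (z - z')\<bar> \<le> (g1 - g0) * \<bar>z - z'\<bar>"
proof (cases "z \<le> z'")
  case True
  then show ?thesis
    using rhs_zeta_slope[of x z z' t \<psi>] assms by (auto simp: F_def abs_if algebra_simps)
next
  case False
  then show ?thesis
    using rhs_zeta_slope[of x z' z t \<psi>] assms by (auto simp: F_def abs_if algebra_simps)
qed

text \<open>A weighted row-sum condition. Couplings with the factor \<open>sat t\<close> are paid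
  for by \<open>J\<close>, those without it by powers of \<open>1 / M\<close>. The dependence of
  \<open>Xi\<close> on \<open>Zeta\<close> goes against the scales and costs a factor
  \<open>M\<close>, which the smallness of \<open>Cs\<close> compensates. The diagonal terms lose
  strictly less than the gap.\<close>

lemma rhs_lipschitz:
  assumes box: "\<bar>x\<bar> \<le> e" "\<bar>x'\<bar> \<le> e" "\<bar>z\<bar> \<le> Z" "\<bar>z'\<bar> \<le> Z" "0 \<le> q" "q \<le> Q" "0 \<le> q'" "q' \<le> Q"
    and close: "\<bar>\<psi> - \<psi>'\<bar> \<le> D / M" "\<bar>q - q'\<bar> \<le> D / M^2" "\<bar>x - x'\<bar> \<le> D / M" "\<bar>z - z'\<bar> \<le> D"
  shows "\<bar>rhs Psi t \<psi> q x z - rhs Psi t \<psi>' q' x' z'\<bar> \<le> th * (D / M) * (2 + 2 * J * sat t)"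
    "\<bar>rhs Que t \<psi> q x z - rhs Que t \<psi>' q' x' z'\<bar> \<le> th * (D / M^2) * (2 + 2 * J * sat t + 2 * Q)"
    "\<bar>rhs Xi t \<psi> q x z - rhs Xi t \<psi>' q' x' z'\<bar> \<le> th * (D / M) * (2 + 2 * J * sat t + gX)"
    "\<bar>rhs Zeta t \<psi> q x z - rhs Zeta t \<psi>' q' x' z'\<bar> \<le> th * D * ((g1 - n * (2 + 2 * J)) / n)"
proof -
  have M: "M \<ge> 1" "M > 0" using pos by auto
  have D: "D \<ge> 0" using close by linarith
  have "D * 1 \<le> D * M" using M D by (intro mult_left_mono) auto
  then have DM: "D / M \<le> D" "D / M^2 \<le> D / M"
    using M by (auto simp: divide_le_eq power2_eq_square)
  let ?s = "sat t" let ?v = "vh t \<psi> x z" let ?v' = "vh t \<psi>' x' z'"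
  have s: "0 < ?s" "?s < 1" using sat_bounds by auto
  have vd: "\<bar>?v - ?v'\<bar> \<le> V0 * k3 * (?s * D)"
  proof -
    have "\<bar>?v - ?v'\<bar> \<le> V0 * ?s * (\<bar>\<psi> - \<psi>'\<bar> + kap * \<bar>x - x'\<bar> + (1 + gam * n) * \<bar>z - z'\<bar>)"
      by (rule vh_lipschitz) (use box in auto)
    also have "\<dots> \<le> V0 * ?s * (k3 * D)"
    proof (intro mult_left_mono)
      have "kap * \<bar>x - x'\<bar> \<le> kap * D" using close DM kap_pos by (intro mult_left_mono) auto
      moreover have "(1 + gam * n) * \<bar>z - z'\<bar> \<le> 2 * D" using close D small' by (intro mult_mono) auto
      moreover have "(kap + 3) * D \<le> k3 * D" using small' D by (intro mult_right_mono) auto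
      ultimately show "\<bar>\<psi> - \<psi>'\<bar> + kap * \<bar>x - x'\<bar> + (1 + gam * n) * \<bar>z - z'\<bar> \<le> k3 * D"
        using close DM by (simp add: algebra_simps)
    qed (use V0_pos s in auto)
    finally show ?thesis by (simp add: mult_ac)
  qed
  have v': "0 < ?v'" "?v' \<le> V0 * ?s" using vh_bound[of x' z' t \<psi>'] box by auto
  show "\<bar>rhs Psi t \<psi> q x z - rhs Psi t \<psi>' q' x' z'\<bar> \<le> th * (D / M) * (2 + 2 * J * sat t)"
  proof -
    have "rhs Psi t \<psi> q x z - rhs Psi t \<psi>' q' x' z' = - ((1 + gam) * (lam * (?v - ?v') + (q - q')))"
      by (simp add: rhs_def algebra_simps)
    also have "\<bar>\<dots>\<bar> = (1 + gam) * \<bar>lam * (?v - ?v') + (q - q')\<bar>"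
      using gam_pos by (simp add: abs_mult)
    also have "\<dots> \<le> (1 + gam) * (lam * (V0 * k3 * (?s * D)) + D / M^2)"
    proof (intro mult_left_mono)
      have "\<bar>lam * (?v - ?v')\<bar> \<le> lam * (V0 * k3 * (?s * D))"
        using vd pos by (simp add: abs_mult)
      then show "\<bar>lam * (?v - ?v') + (q - q')\<bar> \<le> lam * (V0 * k3 * (?s * D)) + D / M^2"
        using close by linarith
    qed (use gam_pos in auto)
    also have "\<dots> = (1 + gam) * (lam * V0 * k3 * M) * (?s * (D / M)) + (1 + gam) * (D / M^2)"
      using M by (simp add: field_simps)
    also have "\<dots> \<le> 2 * J * th * (?s * (D / M)) + 2 * th * M * (D / M^2)"
      using rowPsi D M s by (intro add_mono mult_right_mono) (auto simp: gam_def)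
    also have "\<dots> = th * (D / M) * (2 + 2 * J * sat t)"
      using M by (simp add: field_simps power2_eq_square)
    finally show ?thesis .
  qed
  show "\<bar>rhs Que t \<psi> q x z - rhs Que t \<psi>' q' x' z'\<bar> \<le> th * (D / M^2) * (2 + 2 * J * sat t + 2 * Q)"
  proof -
    have "rhs Que t \<psi> q x z - rhs Que t \<psi>' q' x' z' =
        (q - q') * (2 * Q + 1 - (q + q')) - lam * q * (?v - ?v') - lam * ?v' * (q - q') + b * (?v - ?v')"
      by (simp add: rhs_def algebra_simps)
    moreover have "\<bar>(q - q') * (2 * Q + 1 - (q + q'))\<bar> \<le> D / M^2 * (2 * Q + 1)"
      unfolding abs_mult using box close by (intro mult_mono) auto
    moreover have "\<bar>lam * q * (?v - ?v')\<bar> \<le> lam * Q * (V0 * k3 * (?s * D))"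
    proof -
      have "\<bar>lam * q * (?v - ?v')\<bar> = lam * q * \<bar>?v - ?v'\<bar>" using pos box(5) by (simp add: abs_mult)
      also have "\<dots> \<le> lam * Q * (V0 * k3 * (?s * D))"
        by (rule mult_mono[OF mult_left_mono[OF box(6)] vd]) (use pos box(5) in auto)
      finally show ?thesis .
    qed
    moreover have "\<bar>lam * ?v' * (q - q')\<bar> \<le> lam * (V0 * ?s) * (D / M^2)"
    proof -
      have "\<bar>lam * ?v' * (q - q')\<bar> = lam * ?v' * \<bar>q - q'\<bar>" using pos v' by (simp add: abs_mult)
      also have "\<dots> \<le> lam * (V0 * ?s) * (D / M^2)"
        by (rule mult_mono[OF mult_left_mono[OF v'(2)] close(2)]) (use pos V0_pos s in auto)
      finally show ?thesis .
    qed
    moreover have "\<bar>b * (?v - ?v')\<bar> \<le> b * (V0 * k3 * (?s * D))"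
      using mult_left_mono[OF vd, of b] pos by (simp add: abs_mult)
    ultimately have "\<bar>rhs Que t \<psi> q x z - rhs Que t \<psi>' q' x' z'\<bar> \<le>
        D / M^2 * (2 * Q + 1) + lam * Q * (V0 * k3 * (?s * D)) + lam * (V0 * ?s) * (D / M^2) + b * (V0 * k3 * (?s * D))"
      by linarith
    also have "\<dots> = (2 * Q + 1) * (D / M^2) + (lam * V0 + (lam * Q + b) * V0 * k3 * M^2) * (?s * (D / M^2))"
      using M by (simp add: field_simps)
    also have "\<dots> \<le> th * (2 * Q + 2) * (D / M^2) + 2 * J * th * (?s * (D / M^2))"
      using rowQ D M s by (intro add_mono mult_right_mono) auto
    also have "\<dots> = th * (D / M^2) * (2 + 2 * J * sat t + 2 * Q)" by (simp add: algebra_simps)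
    finally show ?thesis .
  qed
  show "\<bar>rhs Xi t \<psi> q x z - rhs Xi t \<psi>' q' x' z'\<bar> \<le> th * (D / M) * (2 + 2 * J * sat t + gX)"
  proof -
    have "rhs Xi t \<psi> q x z - rhs Xi t \<psi>' q' x' z' =
        (gX * (x - x') - (1 + al) * (sig x z - sig x' z)) - (1 + al) * (sig x' z - sig x' z')"
      by (simp add: rhs_def algebra_simps)
    moreover have "\<bar>gX * (x - x') - (1 + al) * (sig x z - sig x' z)\<bar> \<le> gX * (D / M)"
      using sig_xi_lipschitz(1)[of x' x z] box mult_left_mono[OF close(3), of gX] pos by auto
    moreover have "\<bar>(1 + al) * (sig x' z - sig x' z')\<bar> \<le> (1 + al) * (Cs * D)"
    proof -
      have "\<bar>sig x' z - sig x' z'\<bar> \<le> Cs * D"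
        using order_trans[OF sig_zeta_lipschitz[of x' z' z] mult_left_mono[OF close(4), of Cs]] box Cs_pos by auto
      then show ?thesis using pos by (simp add: abs_mult)
    qed
    ultimately have "\<bar>rhs Xi t \<psi> q x z - rhs Xi t \<psi>' q' x' z'\<bar> \<le> gX * (D / M) + (1 + al) * (Cs * D)"
      by linarith
    also have "\<dots> = (gX + (1 + al) * Cs * M) * (D / M)" using M by (simp add: field_simps)
    also have "\<dots> \<le> th * (gX + 2) * (D / M)" using rowXi D M by (intro mult_right_mono) auto
    also have "\<dots> \<le> th * (gX + 2) * (D / M) + th * (D / M) * (2 * J * sat t)" using th D M s by simp
    also have "\<dots> = th * (D / M) * (2 + 2 * J * sat t + gX)" by (simp add: algebra_simps)
    finally show ?thesis .
  qed
  show "\<bar>rhs Zeta t \<psi> q x z - rhs Zeta t \<psi>' q' x' z'\<bar> \<le> th * D * ((g1 - n * (2 + 2 * J)) / n)"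
  proof -
    define F where "F = (\<lambda>z. c * a * (exp z - 1) + lam * vh t \<psi> x z + al * sig x z)"
    \<comment> \<open>The difference is telescoped by changing \<open>z\<close> first, with
      \<open>\<psi>\<close> and \<open>x\<close> frozen, so that the two-sided slope bound for
      \<open>F\<close> applies; the remaining terms no longer contain the change of
      \<open>z\<close>.\<close>
    have "n * (rhs Zeta t \<psi> q x z - rhs Zeta t \<psi>' q' x' z') =
        (F z - F z' - g1 * (z - z')) + lam * (vh t \<psi> x z' - ?v') + (q - q') + al * (sig x z' - sig x' z')"
    proof -
      have l: "n * rhs Zeta t \<psi> q x z = c * a * (exp z - 1) + lam * vh t \<psi> x z + q + al * sig x z - g1 * z"
        for \<psi> q x z using pos by (simp add: rhs_def)
      show ?thesis unfolding right_diff_distrib[of n] l F_def by (simp add: algebra_simps)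
    qed
    moreover have "\<bar>F z - F z' - g1 * (z - z')\<bar> \<le> (g1 - g0) * D"
    proof -
      have "\<bar>F z - F z' - g1 * (z - z')\<bar> \<le> (g1 - g0) * \<bar>z - z'\<bar>"
        unfolding F_def by (rule rhs_zeta_contraction) (use box in auto)
      also have "\<dots> \<le> (g1 - g0) * D" using g_order close by (intro mult_left_mono) auto
      finally show ?thesis .
    qed
    moreover have "\<bar>lam * (vh t \<psi> x z' - ?v')\<bar> \<le> lam * V0 * (1 + kap) * (D / M)"
    proof -
      have "\<bar>vh t \<psi> x z' - ?v'\<bar> \<le> V0 * ?s * (\<bar>\<psi> - \<psi>'\<bar> + kap * \<bar>x - x'\<bar> + (1 + gam * n) * \<bar>z' - z'\<bar>)"
        by (rule vh_lipschitz) (use box in auto)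
      also have "\<dots> \<le> V0 * 1 * (D / M + kap * (D / M) + (1 + gam * n) * 0)"
        using V0_pos s close kap_pos gam_pos pos by (intro mult_mono add_mono mult_left_mono) (auto intro!: add_nonneg_nonneg mult_nonneg_nonneg)
      finally have "lam * \<bar>vh t \<psi> x z' - ?v'\<bar> \<le> lam * (V0 * 1 * (D / M + kap * (D / M) + (1 + gam * n) * 0))"
        using pos by (intro mult_left_mono) auto
      moreover have "\<bar>lam * (vh t \<psi> x z' - ?v')\<bar> = lam * \<bar>vh t \<psi> x z' - ?v'\<bar>" using pos by (simp add: abs_mult)
      moreover have "lam * (V0 * 1 * (D / M + kap * (D / M) + (1 + gam * n) * 0)) = lam * V0 * (1 + kap) * (D / M)"
        by (simp add: algebra_simps)
      ultimately show ?thesis by (simp only:)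
    qed
    moreover have "\<bar>al * (sig x z' - sig x' z')\<bar> \<le> gX * (D / M)"
      using sig_xi_lipschitz(2)[of x' x z'] box mult_left_mono[OF close(3), of gX] pos by (auto simp: abs_mult)
    ultimately have "\<bar>n * (rhs Zeta t \<psi> q x z - rhs Zeta t \<psi>' q' x' z')\<bar> \<le>
        (g1 - g0) * D + lam * V0 * (1 + kap) * (D / M) + D / M + gX * (D / M)"
      using close DM by linarith
    also have "\<dots> = (g1 - g0 + (1 + lam * V0 * (1 + kap) + gX) / M) * D"
      using M by (simp add: field_simps)
    also have "\<dots> \<le> th * (g1 - n * (2 + 2 * J)) * D"
      using rowZeta D by (intro mult_right_mono) (auto simp: kap_def gam_def)
    finally have "\<bar>rhs Zeta t \<psi> q x z - rhs Zeta t \<psi>' q' x' z'\<bar> * n \<le> th * (g1 - n * (2 + 2 * J)) * D"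
      using pos by (simp add: abs_mult mult.commute[of n])
    then have "\<bar>rhs Zeta t \<psi> q x z - rhs Zeta t \<psi>' q' x' z'\<bar> \<le> th * (g1 - n * (2 + 2 * J)) * D / n"
      using pos by (simp only: pos_le_divide_eq)
    then show ?thesis by (simp add: mult_ac)
  qed
qed

lemma clipped_box:
  "\<bar>clip (- e) e x\<bar> \<le> e" "\<bar>clip (- Z) Z x\<bar> \<le> Z" "0 \<le> clip 0 Q x" "clip 0 Q x \<le> Q"
  using clip_bounds[of "- e" e x] clip_bounds[of "- Z" Z x] clip_bounds[of 0 Q x] pos by auto

lemma clipped_zero: "clip (- e) e 0 = 0" "clip (- Z) Z 0 = 0" "clip 0 Q 0 = 0"
  using pos by (auto intro!: clip_eq)

text \<open>The first three components have \<open>nu \<le> 0\<close> and are solved from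
  \<open>-\<infinity>\<close>; \<open>Zeta\<close> has the rate \<open>g1 / n\<close>, above the
  growth \<open>2 + 2 J\<close> of the weight, and is solved from \<open>+\<infinity>\<close>. At
  zero unknowns \<open>vh\<close> is at most a multiple of \<open>exp (2 * t)\<close>, so the zero
  function has a finite weighted residual.\<close>

theorem clipped_solution_exists:
  obtains y C where "\<And>i t. (y i has_real_derivative nu i * y i t + clipped_rhs i t (\<lambda>j. y j t)) (at t)"
    "\<And>i t. \<bar>y i t\<bar> \<le> C * (scale i * wgt J t)"
proof -
  have M: "M > 0" using pos by auto
  have sc: "scale i > 0" for i using M by (cases i) (auto simp: scale_def)
  define W where "W = (\<lambda>i t. scale i * wgt J t)"
  define W' where "W' = (\<lambda>i t. scale i * wgt' J t)"
  have gap: "W' i t - nu i * W i t = scale i * wgt J t * (2 + 2 * J * sat t - nu i)" for i t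
    by (simp add: W_def W'_def wgt'_def algebra_simps)
  have s: "0 < sat t" "sat t < 1" for t by (rule sat_bounds)+
  have left: "2 + 2 * J * sat t - nu i > 0" if "i \<noteq> Zeta" for i t
    using that s[of t] pos by (cases i) (auto simp: nu_def add_pos_nonneg add_pos_pos)
  have gn: "2 + 2 * real J < g1 / n" using g_order pos by (simp add: field_simps)
  have Js: "2 * J * sat t \<le> 2 * J" for t using s[of t] by (simp add: mult_left_le)
  have right: "nu Zeta - (2 + 2 * J * sat t) \<ge> (g1 - n * (2 + 2 * J)) / n" for t
    using pos Js[of t] by (simp add: nu_def field_simps)
  have right': "(g1 - n * (2 + 2 * J)) / n > 0" using g_order pos by simp
  have abs_left: "\<bar>W' i t - nu i * W i t\<bar> = W i t * (2 + 2 * J * sat t - nu i)" if "i \<noteq> Zeta" for i t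
    unfolding gap using left[OF that, of t] sc[of i] wgt_pos[of J t] by (simp add: W_def abs_mult)
  have abs_right: "W Zeta t * ((g1 - n * (2 + 2 * J)) / n) \<le> \<bar>W' Zeta t - nu Zeta * W Zeta t\<bar>" for t
  proof -
    have "\<bar>W' Zeta t - nu Zeta * W Zeta t\<bar> = W Zeta t * (nu Zeta - (2 + 2 * J * sat t))"
      unfolding gap using right[of t] right' sc[of Zeta] wgt_pos[of J t] by (simp add: W_def abs_mult)
    moreover have "W Zeta t * ((g1 - n * (2 + 2 * J)) / n) \<le> W Zeta t * (nu Zeta - (2 + 2 * J * sat t))"
      using right[of t] sc[of Zeta] wgt_pos[of J t] by (intro mult_left_mono) (auto simp: W_def)
    ultimately show ?thesis by simp
  qed
  have Wpos: "W i t > 0" for i t using sc wgt_pos by (simp add: W_def)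
  have adm: "dichotomy_weight (nu i) (W i) (W' i)" for i
  proof -
    have "(W i has_real_derivative W' i t) (at t)" for t
      unfolding W_def W'_def by (rule DERIV_cmult[OF wgt_deriv])
    moreover have "(\<forall>t. nu i * W i t < W' i t) \<and> ((\<lambda>t. exp (- nu i * t) * W i t) \<longlongrightarrow> 0) at_bot" if "i \<noteq> Zeta"
    proof
      have "nu i \<le> 0" using that pos by (cases i) (auto simp: nu_def)
      then show "((\<lambda>t. exp (- nu i * t) * W i t) \<longlongrightarrow> 0) at_bot" unfolding W_def by (rule wgt_at_bot)
      show "\<forall>t. nu i * W i t < W' i t"
      proof
        fix t
        have "0 < W i t * (2 + 2 * J * sat t - nu i)" using Wpos left[OF that] by simp
        then show "nu i * W i t < W' i t" using gap[of i t] by (simp add: W_def)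
      qed
    qed
    moreover have "(\<forall>t. W' i t < nu i * W i t) \<and> ((\<lambda>t. exp (- nu i * t) * W i t) \<longlongrightarrow> 0) at_top" if "i = Zeta"
    proof
      show "((\<lambda>t. exp (- nu i * t) * W i t) \<longlongrightarrow> 0) at_top" unfolding W_def
        by (rule wgt_at_top) (use gn that in \<open>simp add: nu_def\<close>)
      show "\<forall>t. W' i t < nu i * W i t"
      proof
        fix t
        have "0 < W i t * (nu i - (2 + 2 * J * sat t))" using Wpos[of i t] right[of t] right' that by (intro mult_pos_pos) auto
        then show "W' i t < nu i * W i t" using gap[of i t] by (simp add: W_def algebra_simps)
      qed
    qed
    ultimately show ?thesis using Wpos unfolding dichotomy_weight_def by (cases "i = Zeta") auto
  qed
  have cont: "continuous_on UNIV (\<lambda>t. clipped_rhs i t (\<lambda>j. y j t))"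
    if "\<And>j. continuous_on UNIV (y j)" for i and y :: "comp \<Rightarrow> real \<Rightarrow> real"
    unfolding clipped_rhs_def rhs_def vh_def lh_def sig_def
    by (cases i) (simp_all, (intro continuous_intros that; (use pos in simp)?)+)
  have lip: "\<bar>clipped_rhs i t x - clipped_rhs i t y\<bar> \<le> th * N * \<bar>W' i t - nu i * W i t\<bar>"
    if cl: "\<And>j. \<bar>x j - y j\<bar> \<le> N * W j t" for i t x y N
  proof -
    have "0 \<le> N * W Zeta t" using cl[of Zeta] by linarith
    then have N: "N \<ge> 0" using Wpos[of Zeta t] by (simp add: zero_le_mult_iff)
    define D where "D = N * wgt J t"
    have close: "\<bar>x Psi - y Psi\<bar> \<le> D / M" "\<bar>clip 0 Q (x Que) - clip 0 Q (y Que)\<bar> \<le> D / M^2"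
       "\<bar>clip (- e) e (x Xi) - clip (- e) e (y Xi)\<bar> \<le> D / M" "\<bar>clip (- Z) Z (x Zeta) - clip (- Z) Z (y Zeta)\<bar> \<le> D"
      using cl[of Psi] order_trans[OF clip_lipschitz cl[of Que]]
        order_trans[OF clip_lipschitz cl[of Xi]] order_trans[OF clip_lipschitz cl[of Zeta]]
      by (auto simp: D_def W_def scale_def)
    note L = rhs_lipschitz[OF clipped_box(1)[of "x Xi"] clipped_box(1)[of "y Xi"] clipped_box(2)[of "x Zeta"] clipped_box(2)[of "y Zeta"]
        clipped_box(3)[of "x Que"] clipped_box(4)[of "x Que"] clipped_box(3)[of "y Que"] clipped_box(4)[of "y Que"] close, of t]
    show ?thesis
    proof (cases i)
      case Psi
      have "th * N * \<bar>W' i t - nu i * W i t\<bar> = th * (D / M) * (2 + 2 * J * sat t)"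
        using abs_left[of i t] Psi by (simp add: W_def D_def scale_def nu_def)
      then show ?thesis using L(1) Psi by (simp add: clipped_rhs_def)
    next
      case Que
      have "th * N * \<bar>W' i t - nu i * W i t\<bar> = th * (D / M^2) * (2 + 2 * J * sat t + 2 * Q)"
        using abs_left[of i t] Que by (simp add: W_def D_def scale_def nu_def)
      then show ?thesis using L(2) Que by (simp add: clipped_rhs_def)
    next
      case Xi
      have "th * N * \<bar>W' i t - nu i * W i t\<bar> = th * (D / M) * (2 + 2 * J * sat t + gX)"
        using abs_left[of i t] Xi by (simp add: W_def D_def scale_def nu_def)
      then show ?thesis using L(3) Xi by (simp add: clipped_rhs_def)
    next
      case Zeta
      have "th * N * (W Zeta t * ((g1 - n * (2 + 2 * J)) / n)) \<le> th * N * \<bar>W' Zeta t - nu Zeta * W Zeta t\<bar>"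
        using abs_right[of t] th N by (intro mult_left_mono) auto
      moreover have "th * N * (W Zeta t * ((g1 - n * (2 + 2 * J)) / n)) = th * D * ((g1 - n * (2 + 2 * J)) / n)"
        by (simp add: W_def D_def scale_def)
      ultimately have "th * D * ((g1 - n * (2 + 2 * J)) / n) \<le> th * N * \<bar>W' Zeta t - nu Zeta * W Zeta t\<bar>"
        by (simp only:)
      from order_trans[OF L(4) this] show ?thesis unfolding Zeta clipped_rhs_def .
    qed
  qed
  \<comment> \<open>The three summands are the weighted bounds of the right-hand side at zero for
    \<open>Psi\<close>, \<open>Que\<close> and \<open>Zeta\<close>; the one for \<open>Xi\<close>
    vanishes.\<close>
  define C where "C = (1 + gam) * lam * V0 * M + b * V0 * M^2 + lam * V0 / (g1 - n * (2 + 2 * J))"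
  have gp: "g1 - n * (2 + 2 * J) > 0" using g_order by simp
  have Cp: "(1 + gam) * lam * V0 * M \<ge> 0" "b * V0 * M^2 \<ge> 0" "lam * V0 / (g1 - n * (2 + 2 * J)) \<ge> 0"
    using gp pos gam_pos V0_pos by auto
  have zero: "\<bar>clipped_rhs i t (\<lambda>_. 0)\<bar> \<le> C * \<bar>W' i t - nu i * W i t\<bar>" for i t
  proof -
    let ?v = "vh t 0 0 0"
    have v0: "0 < ?v" "?v \<le> V0 * sat t" using vh_bound[of 0 0 t 0] pos by auto
    have "sat t \<le> exp (2 * t) / 1" unfolding sat_def by (intro divide_left_mono) (auto simp: add_pos_pos)
    also have "\<dots> \<le> wgt J t" by (simp add: wgt_def mult_le_cancel_left1 one_le_power)
    finally have v: "?v \<le> V0 * wgt J t" using v0 V0_pos by (smt (verit) mult_left_mono)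
    have s0: "sig 0 0 = 0" by (simp add: sig_def)
    show ?thesis
    proof (cases i)
      case Psi
      have "\<bar>clipped_rhs i t (\<lambda>_. 0)\<bar> = (1 + gam) * lam * ?v"
        using Psi v0 gam_pos pos by (simp add: clipped_rhs_def clipped_zero rhs_def abs_mult)
      also have "\<dots> \<le> (1 + gam) * lam * (V0 * wgt J t)" using v gam_pos pos by (intro mult_left_mono) auto
      also have "\<dots> = (1 + gam) * lam * V0 * M * (W i t * 1)" using Psi M by (simp add: W_def scale_def)
      also have "\<dots> \<le> C * (W i t * (2 + 2 * J * sat t - nu i))"
        using Cp M Psi Wpos[of i t] s[of t] by (intro mult_mono) (auto simp: C_def nu_def)
      finally show ?thesis using abs_left[of i t] Psi by simp
    next
      case Que
      have "\<bar>clipped_rhs i t (\<lambda>_. 0)\<bar> = b * ?v"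
        using Que v0 pos by (simp add: clipped_rhs_def clipped_zero rhs_def abs_mult)
      also have "\<dots> \<le> b * (V0 * wgt J t)" using v pos by (intro mult_left_mono) auto
      also have "\<dots> = b * V0 * M^2 * (W i t * 1)" using Que M by (simp add: W_def scale_def)
      also have "\<dots> \<le> C * (W i t * (2 + 2 * J * sat t - nu i))"
        using Cp M Que Wpos[of i t] s[of t] pos by (intro mult_mono) (auto simp: C_def nu_def)
      finally show ?thesis using abs_left[of i t] Que by simp
    next
      case Xi
      then show ?thesis using Cp by (auto simp: clipped_rhs_def clipped_zero rhs_def s0 C_def)
    next
      case Zeta
      have "\<bar>clipped_rhs i t (\<lambda>_. 0)\<bar> = lam * ?v / n"
        using Zeta v0 pos by (simp add: clipped_rhs_def clipped_zero rhs_def s0 abs_mult)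
      also have "\<dots> \<le> lam * (V0 * wgt J t) / n" using v pos by (intro divide_right_mono mult_left_mono) auto
      also have "\<dots> = lam * V0 / (g1 - n * (2 + 2 * J)) * (W Zeta t * ((g1 - n * (2 + 2 * J)) / n))"
        using gp by (simp add: W_def scale_def)
      also have "\<dots> \<le> C * \<bar>W' i t - nu i * W i t\<bar>"
        using abs_right[of t] Zeta Cp Wpos[of Zeta t] gp pos by (intro mult_mono) (auto simp: C_def intro!: divide_nonneg_pos mult_nonneg_nonneg)
      finally show ?thesis .
    qed
  qed
  from weighted_contraction[where \<nu> = nu and W = W and W' = W' and H = clipped_rhs and \<theta> = th and C = C, OF adm cont lip zero th]
  obtain y C' where y: "\<And>i t. (y i has_real_derivative nu i * y i t + clipped_rhs i t (\<lambda>j. y j t)) (at t)"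
    "\<And>i t. \<bar>y i t\<bar> \<le> C' * W i t" by blast
  show ?thesis by (rule that[OF y(1) y(2)[unfolded W_def]])
qed

end

section \<open>Lipschitz estimates for clipped functions and logarithms\<close>

lemma lipschitz_from_derivative:
  fixes f :: "real \<Rightarrow> real"
  assumes der: "\<And>t. (f has_real_derivative D t) (at t)" and bd: "\<And>t. \<bar>D t\<bar> \<le> K"
  shows "\<bar>f t - f s\<bar> \<le> K * \<bar>t - s\<bar>"
proof -
  have "norm (f t - f s) \<le> K * norm (t - s)"
    by (rule field_differentiable_bound[of UNIV f D]) (use der bd in \<open>auto intro: DERIV_subset\<close>)
  then show ?thesis by simp
qed

text \<open>The clipped function is constant where \<open>f\<close> leaves the strip, so the
  derivative needs a bound only inside it. The raw equations for \<open>q\<close> and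
  \<open>\<zeta>\<close> contain correction terms that are unbounded outside the box.\<close>

lemma clip_lipschitz_from_derivative:
  fixes f :: "real \<Rightarrow> real"
  assumes der: "\<And>t. (f has_real_derivative D t) (at t)" and lh: "lo \<le> hi"
    and bd: "\<And>t. lo < f t \<Longrightarrow> f t < hi \<Longrightarrow> \<bar>D t\<bar> \<le> K" and K: "K \<ge> 0"
  shows "\<bar>clip lo hi (f t) - clip lo hi (f s)\<bar> \<le> K * \<bar>t - s\<bar>"
proof -
  have up: "clip lo hi (g t) - clip lo hi (g s) \<le> K * (t - s)"
    if st: "s \<le> t" and der: "\<And>t. (g has_real_derivative E t) (at t)"
      and bd: "\<And>t. lo < g t \<Longrightarrow> g t < hi \<Longrightarrow> \<bar>E t\<bar> \<le> K" and "lo \<le> hi"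
    for g E s t lo hi
  proof (rule ccontr)
    assume n: "\<not> clip lo hi (g t) - clip lo hi (g s) \<le> K * (t - s)"
    have "0 \<le> K * (t - s)" using K st by simp
    then have lt: "clip lo hi (g s) < clip lo hi (g t)" using n by linarith
    define l where "l = clip lo hi (g s)"
    define h where "h = (\<lambda>x. g x - K * (x - s))"
    have l: "lo \<le> l" "g s \<le> l" using lt \<open>lo \<le> hi\<close> by (auto simp: l_def clip_def min_def max_def split: if_splits)
    define u where "u = clip lo hi (g t)"
    have u: "u \<le> hi" "u \<le> g t" using lt \<open>lo \<le> hi\<close> by (auto simp: u_def clip_def min_def max_def split: if_splits)
    have lu: "l < u" using lt by (simp add: l_def u_def)
    have cont: "continuous_on {x..y} g" for x y
      by (meson DERIV_isCont continuous_at_imp_continuous_on der)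
    define A where "A = {x\<in>{s..t}. g x \<in> {..l}}"
    have clA: "closed A"
      unfolding A_def using continuous_closed_preimage[OF cont[of s t], of "{..l}"] by (simp add: vimage_def Int_def)
    have sA: "s \<in> A" using l st by (auto simp: A_def)
    have bA: "bdd_above A" by (auto simp: A_def bdd_above_def)
    \<comment> \<open>Between the last time at or below \<open>l\<close> and the first later time at
      or above \<open>u\<close>, the function runs strictly inside the strip; the mean value theorem
      is applied there.\<close>
    define s' where "s' = Sup A"
    have "s' \<in> A" unfolding s'_def using clA sA bA closed_contains_Sup by blast
    then have s': "s \<le> s'" "s' \<le> t" "g s' \<le> l" by (auto simp: A_def)
    have above: "g x > l" if "s' < x" "x \<le> t" for x
    proof (rule ccontr)
      assume "\<not> g x > l"
      then have "x \<in> A" using that s' by (auto simp: A_def)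
      then show False using cSup_upper[OF _ bA] that by (auto simp: s'_def not_le[symmetric])
    qed
    define B where "B = {x\<in>{s'..t}. g x \<in> {u..}}"
    have clB: "closed B"
      unfolding B_def using continuous_closed_preimage[OF cont[of s' t], of "{u..}"] by (simp add: vimage_def Int_def)
    have tB: "t \<in> B" using u s' by (auto simp: B_def)
    have bB: "bdd_below B" by (auto simp: B_def bdd_below_def)
    define t' where "t' = Inf B"
    have "t' \<in> B" unfolding t'_def using clB tB bB closed_contains_Inf by blast
    then have t': "s' \<le> t'" "t' \<le> t" "g t' \<ge> u" by (auto simp: B_def)
    have below: "g x < u" if "s' \<le> x" "x < t'" for x
    proof (rule ccontr)
      assume "\<not> g x < u"
      then have "x \<in> B" using that t' by (auto simp: B_def)
      then show False using cInf_lower[OF _ bB] that by (auto simp: t'_def not_le[symmetric])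
    qed
    have "s' < t'" using s' t' lu by (metis le_less_trans not_le order_less_le order.strict_trans2)
    then obtain z where z: "s' < z" "z < t'" "g t' - g s' = (t' - s') * E z"
      using MVT2[of s' t' g E] der by auto
    have "lo < g z" "g z < hi" using above[of z] below[of z] z t' l u by auto
    then have "E z \<le> K" using bd[of z] by (simp add: abs_le_iff)
    then have "(t' - s') * E z \<le> (t' - s') * K" using \<open>s' < t'\<close> by (intro mult_left_mono) auto
    also have "\<dots> \<le> (t - s) * K" using s' t' K by (intro mult_right_mono) auto
    finally have "u - l \<le> K * (t - s)" using z s' t' by (simp add: mult.commute)
    then show False using n by (simp add: u_def l_def)
  qed
  have neg: "clip (- hi) (- lo) (- x) = - clip lo hi x" for x
    using lh by (auto simp: clip_def min_def max_def)
  have *: "\<bar>clip lo hi (f t) - clip lo hi (f s)\<bar> \<le> K * (t - s)" if "s \<le> t" for s t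
  proof -
    have "clip lo hi (f t) - clip lo hi (f s) \<le> K * (t - s)"
      by (rule up[OF that der bd lh])
    moreover have "clip (- hi) (- lo) (- f t) - clip (- hi) (- lo) (- f s) \<le> K * (t - s)"
    proof (rule up[OF that])
      show "((\<lambda>x. - f x) has_real_derivative - D t) (at t)" for t by (intro DERIV_minus der)
      show "\<bar>- D t\<bar> \<le> K" if "- hi < - f t" "- f t < - lo" for t using bd[of t] that by simp
    qed (use lh in simp)
    ultimately show ?thesis unfolding neg by simp
  qed
  show ?thesis using *[of s t] *[of t s] by (cases "s \<le> t") (auto simp: abs_minus_commute)
qed

lemma ln_lipschitz:
  fixes x y m :: real
  assumes "0 < m" "m \<le> x" "m \<le> y"
  shows "\<bar>ln x - ln y\<bar> \<le> \<bar>x - y\<bar> / m"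
proof -
  have *: "ln x - ln y \<le> \<bar>x - y\<bar> / m" if "m \<le> x" "m \<le> y" for x y
  proof -
    have p: "x > 0" "y > 0" using that assms by auto
    have "ln x - ln y = ln (x / y)" using p by (simp add: ln_div)
    also have "\<dots> \<le> x / y - 1" using p by (intro ln_le_minus_one) auto
    also have "\<dots> = (x - y) / y" using p by (simp add: field_simps)
    also have "\<dots> \<le> \<bar>x - y\<bar> / m"
      using p that assms by (intro frac_le) auto
    finally show ?thesis .
  qed
  show ?thesis using *[of x y] *[of y x] assms by (auto simp: abs_le_iff abs_minus_commute)
qed

text \<open>The derivative \<open>k * exp u / (c + k * exp u)\<close> lies between 0 and 1; the
  proof uses the equivalent comparison of \<open>c + k * exp u\<close> with
  \<open>exp (u - v) * (c + k * exp v)\<close>.\<close>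

lemma ln_affine_exp_lipschitz:
  fixes u v c k :: real
  assumes "c > 0" "k > 0"
  shows "\<bar>ln (c + k * exp u) - ln (c + k * exp v)\<bar> \<le> \<bar>u - v\<bar>"
proof -
  have *: "\<bar>ln (c + k * exp u) - ln (c + k * exp v)\<bar> \<le> u - v" if "v \<le> u" for u v
  proof -
    have p: "c + k * exp u > 0" "c + k * exp v > 0" using assms by (auto intro: add_pos_pos)
    have "c * 1 \<le> c * exp (u - v)" using assms that by (intro mult_left_mono) auto
    then have "c + k * exp u \<le> exp (u - v) * (c + k * exp v)"
      by (simp add: algebra_simps flip: exp_add)
    then have "ln (c + k * exp u) \<le> ln (exp (u - v) * (c + k * exp v))" using p by (subst ln_le_cancel_iff) auto
    then have "ln (c + k * exp u) \<le> (u - v) + ln (c + k * exp v)" using p by (simp add: ln_mult)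
    moreover have "k * exp v \<le> k * exp u" using that assms by (intro mult_left_mono) auto
    then have "ln (c + k * exp v) \<le> ln (c + k * exp u)" using p by simp
    ultimately show ?thesis by simp
  qed
  show ?thesis using *[of u v] *[of v u] by (cases "v \<le> u") (auto simp: abs_minus_commute)
qed

section \<open>The clipping is inactive\<close>

text \<open>\<open>U\<close> is the level that \<open>u\<close> must not reach on the slow manifold:
  with margin \<open>d\<close> it makes both parts of the planar flow point inwards, and
  \<open>U < c * a\<close> keeps \<open>r\<close> positive there. \<open>Sig\<close> bounds
  \<open>sig\<close>, \<open>eta\<close> bounds the logarithmic distance to the manifold, and
  \<open>LR\<close> its drift; no factor \<open>1 / n\<close> enters the condition on
  \<open>LR\<close>. \<open>Zrho\<close> places the manifold so that a distance of 1 to the lower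
  side of the box remains.\<close>

locale slow_fast_trap = slow_fast +
  fixes U d Sig eta LR :: real
  assumes Z1: "Z \<ge> 1" and margin: "d > 0"
    and U: "1 + d \<le> U" "2 + b / lam + d \<le> (1 + 1/(lam*c)) * U" "U < Q" "Q < c * a"
      "U < lam * P * (a - U / c)"
    and Zrho: "a * exp (1 - Z) * (c + lam * P) \<le> c * a - Q"
    and Sig: "Cs * Z + gX * e \<le> Sig"
    and barrier: "n * exp Z * (3 * a * S * Z + 1) < a * S * exp (- Z - 1) * e"
    and eta: "al * Sig + n * LR \<le> eta * g0" "eta \<le> 1"
      "P * (a + lam^2 * P * a + lam * Q + b) * (a * exp Z * eta) < d * U"
    and LR: "(Q * (1 + lam * V0 + Q) + b * V0) / (c * a - Q) + 2 + (1 + gam) * (lam * V0 + Q)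
        + kap * ((1 + al) * Sig) + gam * (c * a * exp Z + lam * V0 + Q + al * Sig) \<le> LR"

context slow_fast_trap
begin

text \<open>At \<open>x = 0\<close> both terms of \<open>sig\<close> carry a factor
  \<open>n\<close>, so the zero of \<open>sig\<close> in \<open>x\<close> lies within order
  \<open>n\<close> of 0.\<close>

lemma sig_zero_bound:
  assumes "\<bar>z\<bar> \<le> Z"
  shows "\<bar>sig 0 z\<bar> \<le> n * exp Z * (3 * a * S * Z + 1) / lam"
proof -
  have nz: "\<bar>n * z\<bar> \<le> n * Z" "n * Z \<le> 1" using assms pos small by (auto simp: abs_mult)
  have "\<bar>exp (n * z) - exp 0\<bar> \<le> exp 1 * \<bar>n * z - 0\<bar>" by (rule exp_lipschitz) (use nz in auto)
  also have "\<dots> \<le> 3 * (n * Z)" using nz exp_le by (intro mult_mono) auto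
  finally have E: "\<bar>exp (n * z) - 1\<bar> \<le> 3 * (n * Z)" by simp
  have "exp z \<le> exp Z" "1 \<le> exp Z" "0 < exp z" using assms pos by auto
  then have X: "\<bar>exp z - 1\<bar> \<le> exp Z" unfolding abs_le_iff by linarith
  have "\<bar>a * S * exp z * (exp (n * z) - 1)\<bar> = a * S * exp z * \<bar>exp (n * z) - 1\<bar>"
    using pos by (simp add: abs_mult)
  also have "\<dots> \<le> a * S * exp Z * (3 * (n * Z))"
    using E pos assms by (intro mult_mono mult_left_mono) auto
  finally have t1: "\<bar>a * S * exp z * (exp (n * z) - 1)\<bar> \<le> a * S * exp Z * (3 * (n * Z))" .
  have "\<bar>n / (1+al) * (exp z - 1)\<bar> = n / (1+al) * \<bar>exp z - 1\<bar>" using pos by (simp add: abs_mult)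
  also have "\<dots> \<le> n * exp Z" using X pos by (intro mult_mono) (auto simp: divide_le_eq)
  finally have "\<bar>a * S * exp z * (exp (n * z) - 1) - n / (1+al) * (exp z - 1)\<bar> \<le> a * S * exp Z * (3 * (n * Z)) + n * exp Z"
    using t1 by linarith
  also have "\<dots> = n * exp Z * (3 * a * S * Z + 1)" by (simp add: algebra_simps)
  finally show ?thesis using pos by (simp add: sig_def divide_right_mono)
qed

text \<open>The slope in \<open>x\<close> times \<open>e\<close> beats the value of order
  \<open>n\<close> at \<open>x = 0\<close>. This turns the two faces where \<open>\<xi>\<close> is
  \<open>e\<close> or \<open>- e\<close> into barriers.\<close>

lemma sig_sign:
  assumes "\<bar>z\<bar> \<le> Z"
  shows "sig e z > 0" "sig (- e) z < 0"
proof -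
  have l: "n * exp Z * (3 * a * S * Z + 1) / lam < a * S * exp (- Z - 1) / lam * e"
    using barrier pos by (simp add: divide_strict_right_mono)
  show "sig e z > 0" using sig_xi(1)[of 0 e z] assms l sig_zero_bound[OF assms] pos by auto
  show "sig (- e) z < 0" using sig_xi(1)[of "- e" 0 z] assms l sig_zero_bound[OF assms] pos by auto
qed

end

text \<open>The equations keep the split form: \<open>nu i\<close> times the raw unknown plus the
  remainder at the clipped one. Outside the box they therefore contain corrections proportional to
  the amount clipped.\<close>

locale clipped_orbit = slow_fast_trap +
  fixes \<psi> q \<xi> \<zeta> :: "real \<Rightarrow> real" and C :: real
  assumes der_psi: "(\<psi> has_real_derivative rhs Psi t (\<psi> t) (clip 0 Q (q t)) (clip (- e) e (\<xi> t)) (clip (- Z) Z (\<zeta> t))) (at t)"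
    and der_q: "(q has_real_derivative - (2 * Q) * q t + rhs Que t (\<psi> t) (clip 0 Q (q t)) (clip (- e) e (\<xi> t)) (clip (- Z) Z (\<zeta> t))) (at t)"
    and der_xi: "(\<xi> has_real_derivative - gX * \<xi> t + rhs Xi t (\<psi> t) (clip 0 Q (q t)) (clip (- e) e (\<xi> t)) (clip (- Z) Z (\<zeta> t))) (at t)"
    and der_zeta: "(\<zeta> has_real_derivative g1 / n * \<zeta> t + rhs Zeta t (\<psi> t) (clip 0 Q (q t)) (clip (- e) e (\<xi> t)) (clip (- Z) Z (\<zeta> t))) (at t)"
    and bound: "\<bar>\<psi> t\<bar> \<le> C * wgt J t" "\<bar>q t\<bar> \<le> C * wgt J t" "\<bar>\<xi> t\<bar> \<le> C * wgt J t" "\<bar>\<zeta> t\<bar> \<le> C * wgt J t"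
begin

definition "qh t = clip 0 Q (q t)"
definition "xh t = clip (- e) e (\<xi> t)"
definition "zh t = clip (- Z) Z (\<zeta> t)"
definition "lp t = lh t (\<psi> t) (xh t) (zh t)"
definition "vv t = vh t (\<psi> t) (xh t) (zh t)"
definition "sg t = sig (xh t) (zh t)"
text \<open>The zero set of the fast equation is \<open>r = rho\<close> up to the small term \<open>sg\<close>.\<close>

definition "rho t = (c * a - qh t) / (c + lam * exp (lp t))"
definition "R t = ln (rho t / a)"

lemma box: "\<bar>xh t\<bar> \<le> e" "\<bar>zh t\<bar> \<le> Z" "0 \<le> qh t" "qh t \<le> Q"
  unfolding qh_def xh_def zh_def by (rule clipped_box)+

lemma vv_eq: "vv t = a * exp (lp t) * exp (zh t)"
  by (simp add: vv_def vh_def lp_def exp_add)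

lemma vv_bounds: "0 < vv t" "vv t \<le> V0"
  unfolding vv_def using vh_bound(1,3)[OF box(1,2)] by auto

lemma exp_lp_le: "exp (lp t) \<le> P"
proof -
  have "lp t \<le> ln P" by (simp add: lp_def lh_def)
  moreover have "P > 0" using P by (smt (verit) exp_gt_zero)
  ultimately show ?thesis by (metis exp_le_cancel_iff exp_ln)
qed

lemma psi_deriv: "(\<psi> has_real_derivative - ((1 + gam) * (lam * vv t + qh t))) (at t)"
  using der_psi[of t] by (simp add: rhs_def qh_def vv_def xh_def zh_def)

lemma q_deriv: "(q has_real_derivative qh t * (1 - lam * vv t - qh t) + b * vv t - 2 * Q * (q t - qh t)) (at t)"
  using der_q[of t] by (simp add: rhs_def algebra_simps flip: qh_def vv_def xh_def zh_def)

lemma xi_deriv: "(\<xi> has_real_derivative - ((1 + al) * sg t) - gX * (\<xi> t - xh t)) (at t)"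
  using der_xi[of t] by (simp add: rhs_def sg_def algebra_simps flip: qh_def vv_def xh_def zh_def)

text \<open>For fixed \<open>p\<close> and \<open>q\<close> the fast equation without
  \<open>sig\<close> is affine in \<open>r\<close> with zero \<open>rho\<close>, so it factors
  through the distance to \<open>rho\<close>.\<close>

lemma zeta_deriv: "(\<zeta> has_real_derivative
    ((c + lam * exp (lp t)) * (a * exp (zh t) - rho t) + al * sg t + g1 * (\<zeta> t - zh t)) / n) (at t)"
proof -
  have p: "c + lam * exp (lp t) > 0" using pos by (simp add: add_pos_pos)
  have r: "(c + lam * exp (lp t)) * rho t = c * a - qh t" using p by (simp add: rho_def)
  have "(c + lam * exp (lp t)) * (a * exp (zh t) - rho t) = c * a * (exp (zh t) - 1) + lam * vv t + qh t"
    unfolding right_diff_distrib[of "c + lam * exp (lp t)"] r vv_eq by (simp add: algebra_simps)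
  then have "((c + lam * exp (lp t)) * (a * exp (zh t) - rho t) + al * sg t + g1 * (\<zeta> t - zh t)) / n =
     g1 / n * \<zeta> t + rhs Zeta t (\<psi> t) (qh t) (xh t) (zh t)"
    using pos by (simp add: rhs_def sg_def vv_def field_simps)
  then show ?thesis using der_zeta[of t] by (simp add: qh_def xh_def zh_def)
qed

lemma wgt_null: "((\<lambda>t. C * wgt J t) \<longlongrightarrow> 0) at_bot"
  using wgt_at_bot[of 0 C J] by simp

lemma limits_at_bot: "(\<psi> \<longlongrightarrow> 0) at_bot" "(q \<longlongrightarrow> 0) at_bot" "(\<xi> \<longlongrightarrow> 0) at_bot" "(\<zeta> \<longlongrightarrow> 0) at_bot"
  by (rule Lim_null_comparison[OF _ wgt_null]; use bound in simp)+

lemma continuity: "continuous_on UNIV \<psi>" "continuous_on UNIV q" "continuous_on UNIV \<xi>" "continuous_on UNIV \<zeta>"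
  using psi_deriv q_deriv xi_deriv zeta_deriv
  by (meson DERIV_isCont continuous_at_imp_continuous_on)+

lemma psi_nonpos: "\<psi> t \<le> 0"
proof (rule tendsto_lowerbound[OF limits_at_bot(1)])
  have "\<psi> t \<le> \<psi> s" if "s \<le> t" for s
  proof (rule deriv_nonpos_imp_antimono[OF psi_deriv _ that])
    fix x show "- ((1 + gam) * (lam * vv x + qh x)) \<le> 0"
      using gam_pos vv_bounds[of x] box(3)[of x] pos by simp
  qed
  then show "\<forall>\<^sub>F s in at_bot. \<psi> t \<le> \<psi> s" using eventually_le_at_bot[of t] by (rule eventually_mono[rotated])
qed simp

text \<open>At \<open>q = - B\<close> the clipped value is 0, so \<open>b * vv t\<close> and the
  correction \<open>2 * Q * B\<close> both push \<open>q\<close> upwards.\<close>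

lemma q_nonneg: "0 \<le> q t"
proof (rule field_le_epsilon)
  fix B :: real assume B: "B > 0"
  have "- q t < B"
  proof (rule barrier_left[where y = "\<lambda>t. - q t" and t = t and l = 0])
    show "continuous_on UNIV (\<lambda>t. - q t)" by (intro continuous_intros continuity)
    show "((\<lambda>t. - q t) \<longlongrightarrow> 0) at_bot" using tendsto_minus[OF limits_at_bot(2)] by simp
    fix t assume "- q t = B"
    then have qt: "q t = - B" by simp
    then have "qh t = 0" using B pos by (simp add: qh_def clip_def)
    then show "\<exists>D<0. ((\<lambda>t. - q t) has_real_derivative D) (at t)"
    proof (intro exI[of _ "- (b * vv t + 2 * Q * B)"] conjI)
      assume "qh t = 0"
      then show "((\<lambda>t. - q t) has_real_derivative - (b * vv t + 2 * Q * B)) (at t)"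
        using DERIV_minus[OF q_deriv[of t]] qt by simp
      have "0 < b * vv t" "0 < 2 * Q * B" using B pos vv_bounds[of t] by simp_all
      then show "- (b * vv t + 2 * Q * B) < 0" by linarith
    qed
  qed (use B in simp)
  then show "0 \<le> q t + B" by simp
qed

lemma xi_in_box: "\<bar>\<xi> t\<bar> < e"
proof -
  have "\<xi> t < e"
  proof (rule barrier_left[OF continuity(3) limits_at_bot(3)])
    fix t assume t: "\<xi> t = e"
    then have "xh t = e" using pos by (simp add: xh_def clip_def)
    then show "\<exists>D<0. (\<xi> has_real_derivative D) (at t)"
      using xi_deriv[of t] t sig_sign(1)[OF box(2), of t] pos
      by (intro exI[of _ "- ((1 + al) * sg t)"]) (auto simp: sg_def)
  qed (use pos in auto)
  moreover have "- \<xi> t < e"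
  proof (rule barrier_left[where y = "\<lambda>t. - \<xi> t" and t = t and l = 0])
    show "continuous_on UNIV (\<lambda>t. - \<xi> t)" by (intro continuous_intros continuity)
    show "((\<lambda>t. - \<xi> t) \<longlongrightarrow> 0) at_bot" using tendsto_minus[OF limits_at_bot(3)] by simp
    fix t assume "- \<xi> t = e"
    then have t: "\<xi> t = - e" by simp
    then have "xh t = - e" using pos by (simp add: xh_def clip_def)
    then show "\<exists>D<0. ((\<lambda>t. - \<xi> t) has_real_derivative D) (at t)"
      using DERIV_minus[OF xi_deriv[of t]] t sig_sign(2)[OF box(2), of t] pos
      by (intro exI[of _ "(1 + al) * sg t"]) (auto simp: sg_def mult_less_0_iff)
  qed (use pos in auto)
  ultimately show ?thesis by linarith
qed

lemma xh_eq: "xh t = \<xi> t"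
  using xi_in_box[of t] by (auto simp: xh_def intro!: clip_eq)

lemma sg_bound: "\<bar>sg t\<bar> \<le> Sig"
proof -
  have s0: "sig 0 0 = 0" by (simp add: sig_def)
  have "\<bar>sig (xh t) (zh t) - sig (xh t) 0\<bar> \<le> Cs * \<bar>zh t - 0\<bar>"
    by (rule sig_zeta_lipschitz) (use box pos in auto)
  also have "\<dots> \<le> Cs * Z" using box Cs_pos by (intro mult_left_mono) auto
  finally have 1: "\<bar>sig (xh t) (zh t) - sig (xh t) 0\<bar> \<le> Cs * Z" .
  have 2: "\<bar>sig x 0 - sig 0 0\<bar> \<le> gX * e" if x: "\<bar>x\<bar> \<le> e" for x
  proof -
    have aux: "\<bar>w\<bar> \<le> G" if "(1 + al) * w \<le> G" "0 \<le> w" for w G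
    proof -
      have "0 \<le> al * w" using pos that by auto
      moreover have "(1 + al) * w = w + al * w" by (simp add: algebra_simps)
      ultimately show ?thesis using that by auto
    qed
    show ?thesis
    proof (cases "0 \<le> x")
      case True
      have "(1 + al) * (sig x 0 - sig 0 0) \<le> gX * (x - 0)" by (rule sig_xi(2)) (use x True pos in auto)
      also have "\<dots> \<le> gX * e" using x pos by (intro mult_left_mono) auto
      finally have 1: "(1 + al) * (sig x 0 - sig 0 0) \<le> gX * e" .
      have "a * S * exp (- Z - 1) / lam * (x - 0) \<le> sig x 0 - sig 0 0" by (rule sig_xi(1)) (use x True pos in auto)
      moreover have "0 \<le> a * S * exp (- Z - 1) / lam * (x - 0)" using pos True by auto
      ultimately show ?thesis using aux[OF 1] by linarith
    next
      case False
      have "(1 + al) * (sig 0 0 - sig x 0) \<le> gX * (0 - x)" by (rule sig_xi(2)) (use x False pos in auto)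
      also have "\<dots> \<le> gX * e" using x pos by (intro mult_left_mono) auto
      finally have 1: "(1 + al) * (sig 0 0 - sig x 0) \<le> gX * e" .
      have "a * S * exp (- Z - 1) / lam * (0 - x) \<le> sig 0 0 - sig x 0" by (rule sig_xi(1)) (use x False pos in auto)
      moreover have "0 \<le> a * S * exp (- Z - 1) / lam * (0 - x)" using pos False by (intro mult_nonneg_nonneg) auto
      ultimately have "\<bar>sig 0 0 - sig x 0\<bar> \<le> gX * e" using aux[OF 1] by linarith
      then show ?thesis by (simp add: abs_minus_commute)
    qed
  qed
  show ?thesis using 1 2[OF box(1), of t] Sig unfolding sg_def s0 by linarith
qed

lemma Sig_nonneg: "0 \<le> Sig" using sg_bound[of 0] by linarith

text \<open>The lower bound \<open>1 - Z\<close> instead of \<open>- Z\<close> reserves a unit for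
  the error \<open>eta \<le> 1\<close>.\<close>

lemma rho_facts: "rho t = a * exp (R t)" "1 - Z \<le> R t" "R t \<le> 0" "c * (a - rho t) = lam * exp (lp t) * rho t + qh t"
proof -
  have p: "c + lam * exp (lp t) > 0" using pos by (simp add: add_pos_pos)
  have cQ: "c * a - qh t > 0" using box(4)[of t] U by linarith
  then have r0: "rho t > 0" using p by (simp add: rho_def)
  then show e: "rho t = a * exp (R t)" using pos by (simp add: R_def)
  have "c + lam * exp (lp t) \<le> c + lam * P" using exp_lp_le[of t] pos by simp
  then have "a * exp (1 - Z) * (c + lam * exp (lp t)) \<le> a * exp (1 - Z) * (c + lam * P)"
    using pos by (intro mult_left_mono) auto
  also have "\<dots> \<le> c * a - qh t" using Zrho box(4)[of t] by linarith
  finally have "a * exp (1 - Z) \<le> rho t" using p by (simp add: rho_def le_divide_eq)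
  then show "1 - Z \<le> R t" using e pos by simp
  have "rho t \<le> a"
  proof -
    have "a * c \<le> a * (c + lam * exp (lp t))" using pos by (intro mult_left_mono) auto
    then have "c * a - qh t \<le> a * (c + lam * exp (lp t))" using box(3)[of t] by (simp add: mult.commute)
    then show ?thesis using p by (simp add: rho_def divide_le_eq)
  qed
  then show "R t \<le> 0" using r0 pos by (simp add: R_def)
  have "(c + lam * exp (lp t)) * rho t = c * a - qh t" using p by (simp add: rho_def)
  then show "c * (a - rho t) = lam * exp (lp t) * rho t + qh t" by (simp add: algebra_simps)
qed

text \<open>\<open>\<zeta>\<close> moves at speed of order \<open>1 / n\<close>, but it enters
  \<open>lp\<close> only with the factor \<open>gam * n\<close>, so the bound does not degenerate as
  \<open>n\<close> tends to 0.\<close>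

lemma R_lipschitz: "\<bar>R t - R s\<bar> \<le> LR * \<bar>t - s\<bar>"
proof -
  let ?d = "\<bar>t - s\<bar>"
  have cQ: "0 < c * a - Q" using U by simp
  have V: "V0 > 0" by (rule V0_pos)
  have lq: "\<bar>qh t - qh s\<bar> \<le> (Q * (1 + lam * V0 + Q) + b * V0) * ?d"
    unfolding qh_def
  proof (rule clip_lipschitz_from_derivative[OF q_deriv])
    fix t assume "0 < q t" "q t < Q"
    then have qt: "qh t = q t" "0 \<le> qh t" "qh t \<le> Q" by (simp_all add: qh_def clip_eq)
    have lv: "lam * vv t \<le> lam * V0" "0 \<le> lam * vv t" using vv_bounds[of t] pos by auto
    have "\<bar>qh t * (1 - lam * vv t - qh t)\<bar> \<le> Q * (1 + lam * V0 + Q)"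
      unfolding abs_mult using qt lv by (intro mult_mono) auto
    moreover have "\<bar>b * vv t\<bar> \<le> b * V0" using vv_bounds[of t] pos by (simp add: abs_mult)
    ultimately show "\<bar>qh t * (1 - lam * vv t - qh t) + b * vv t - 2 * Q * (q t - qh t)\<bar> \<le> Q * (1 + lam * V0 + Q) + b * V0"
      using qt by simp
  qed (use pos V in auto)
  have ub: "0 \<le> lam * vv t + qh t" "lam * vv t + qh t \<le> lam * V0 + Q" for t
    using vv_bounds[of t] box[of t] pos by (auto intro!: add_mono)
  have lpsi: "\<bar>\<psi> t - \<psi> s\<bar> \<le> (1 + gam) * (lam * V0 + Q) * ?d"
  proof (rule lipschitz_from_derivative[OF psi_deriv])
    fix t
    have "\<bar>- ((1 + gam) * (lam * vv t + qh t))\<bar> = (1 + gam) * (lam * vv t + qh t)"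
      using ub[of t] gam_pos by (simp add: abs_mult)
    also have "\<dots> \<le> (1 + gam) * (lam * V0 + Q)" using ub[of t] gam_pos by (intro mult_left_mono) auto
    finally show "\<bar>- ((1 + gam) * (lam * vv t + qh t))\<bar> \<le> (1 + gam) * (lam * V0 + Q)" .
  qed
  have lxi: "\<bar>xh t - xh s\<bar> \<le> (1 + al) * Sig * ?d"
    unfolding xh_eq
  proof (rule lipschitz_from_derivative[OF xi_deriv])
    fix t show "\<bar>- ((1 + al) * sg t) - gX * (\<xi> t - xh t)\<bar> \<le> (1 + al) * Sig"
      using sg_bound[of t] pos by (simp add: xh_eq abs_mult)
  qed
  have lze: "\<bar>zh t - zh s\<bar> \<le> (c * a * exp Z + lam * V0 + Q + al * Sig) / n * ?d"
    unfolding zh_def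
  proof (rule clip_lipschitz_from_derivative[OF zeta_deriv])
    fix t assume "- Z < \<zeta> t" "\<zeta> t < Z"
    then have zt: "zh t = \<zeta> t" by (auto simp: zh_def intro!: clip_eq)
    have p: "c + lam * exp (lp t) > 0" using pos by (simp add: add_pos_pos)
    have r: "(c + lam * exp (lp t)) * rho t = c * a - qh t" using p by (simp add: rho_def)
    have e: "(c + lam * exp (lp t)) * (a * exp (zh t) - rho t) = c * a * (exp (zh t) - 1) + (lam * vv t + qh t)"
      unfolding right_diff_distrib[of "c + lam * exp (lp t)"] r vv_eq by (simp add: algebra_simps)
    have "exp (zh t) \<le> exp Z" "1 \<le> exp Z" using box(2)[of t] pos by auto
    moreover have "0 < exp (zh t)" by simp
    ultimately have "\<bar>exp (zh t) - 1\<bar> \<le> exp Z" unfolding abs_le_iff by linarith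
    then have "\<bar>c * a * (exp (zh t) - 1)\<bar> \<le> c * a * exp Z" using pos by (simp add: abs_mult)
    moreover have "\<bar>al * sg t\<bar> \<le> al * Sig" using sg_bound[of t] pos by (simp add: abs_mult)
    ultimately have "\<bar>(c + lam * exp (lp t)) * (a * exp (zh t) - rho t) + al * sg t + g1 * (\<zeta> t - zh t)\<bar>
        \<le> c * a * exp Z + lam * V0 + Q + al * Sig"
      unfolding e using ub[of t] zt by simp
    then show "\<bar>((c + lam * exp (lp t)) * (a * exp (zh t) - rho t) + al * sg t + g1 * (\<zeta> t - zh t)) / n\<bar>
        \<le> (c * a * exp Z + lam * V0 + Q + al * Sig) / n"
      using pos by (simp add: abs_divide divide_right_mono)
  qed (use pos V Sig_nonneg in auto)
  have llp: "\<bar>lp t - lp s\<bar> \<le> 2 * ?d + (1 + gam) * (lam * V0 + Q) * ?d + kap * ((1 + al) * Sig * ?d)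
      + gam * n * ((c * a * exp Z + lam * V0 + Q + al * Sig) / n * ?d)"
  proof -
    have min_lip: "\<bar>min w u - min w v\<bar> \<le> \<bar>u - v\<bar>" for u v w :: real by (auto simp: min_def)
    have "\<bar>lp t - lp s\<bar> \<le> \<bar>(2 * t + min (\<psi> t) 0 + kap * xh t + gam * n * zh t) - (2 * s + min (\<psi> s) 0 + kap * xh s + gam * n * zh s)\<bar>"
      unfolding lp_def lh_def by (rule min_lip)
    also have "\<dots> = \<bar>2 * (t - s) + (\<psi> t - \<psi> s) + kap * (xh t - xh s) + gam * n * (zh t - zh s)\<bar>"
      using psi_nonpos[of t] psi_nonpos[of s] by (simp add: algebra_simps)
    also have "\<dots> \<le> \<bar>2 * (t - s)\<bar> + \<bar>\<psi> t - \<psi> s\<bar> + \<bar>kap * (xh t - xh s)\<bar> + \<bar>gam * n * (zh t - zh s)\<bar>"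
      by linarith
    also have "\<dots> = 2 * ?d + \<bar>\<psi> t - \<psi> s\<bar> + kap * \<bar>xh t - xh s\<bar> + gam * n * \<bar>zh t - zh s\<bar>"
      using kap_pos gam_pos pos by (simp add: abs_mult del: right_diff_distrib_numeral)
    also have "\<dots> \<le> 2 * ?d + (1 + gam) * (lam * V0 + Q) * ?d + kap * ((1 + al) * Sig * ?d)
      + gam * n * ((c * a * exp Z + lam * V0 + Q + al * Sig) / n * ?d)"
      using lpsi lxi lze kap_pos gam_pos pos by (intro add_mono mult_left_mono) auto
    finally show ?thesis .
  qed
  have Req: "R t = ln (c * a - qh t) - ln (c + lam * exp (lp t)) - ln a" for t
  proof -
    have p: "c + lam * exp (lp t) > 0" using pos by (simp add: add_pos_pos)
    have "c * a - qh t > 0" using box(4)[of t] cQ by linarith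
    then show ?thesis using p pos by (simp add: R_def rho_def ln_div ln_mult)
  qed
  have "\<bar>ln (c * a - qh t) - ln (c * a - qh s)\<bar> \<le> \<bar>(c * a - qh t) - (c * a - qh s)\<bar> / (c * a - Q)"
    by (rule ln_lipschitz) (use cQ box in auto)
  also have "\<dots> \<le> ((Q * (1 + lam * V0 + Q) + b * V0) * ?d) / (c * a - Q)"
    using lq cQ by (intro divide_right_mono) (auto simp: abs_minus_commute)
  finally have l1: "\<bar>ln (c * a - qh t) - ln (c * a - qh s)\<bar> \<le> ((Q * (1 + lam * V0 + Q) + b * V0) * ?d) / (c * a - Q)" .
  have l2: "\<bar>ln (c + lam * exp (lp t)) - ln (c + lam * exp (lp s))\<bar> \<le> \<bar>lp t - lp s\<bar>"
    by (rule ln_affine_exp_lipschitz) (use pos in auto)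
  have "\<bar>R t - R s\<bar> \<le> ((Q * (1 + lam * V0 + Q) + b * V0) * ?d) / (c * a - Q) + (2 * ?d + (1 + gam) * (lam * V0 + Q) * ?d + kap * ((1 + al) * Sig * ?d)
      + gam * n * ((c * a * exp Z + lam * V0 + Q + al * Sig) / n * ?d))"
    unfolding Req using l1 l2 llp by linarith
  also have "gam * n * ((c * a * exp Z + lam * V0 + Q + al * Sig) / n * ?d) = gam * (c * a * exp Z + lam * V0 + Q + al * Sig) * ?d"
    using pos by simp
  also have "((Q * (1 + lam * V0 + Q) + b * V0) * ?d) / (c * a - Q) + (2 * ?d + (1 + gam) * (lam * V0 + Q) * ?d + kap * ((1 + al) * Sig * ?d)
      + gam * (c * a * exp Z + lam * V0 + Q + al * Sig) * ?d) = ((Q * (1 + lam * V0 + Q) + b * V0) / (c * a - Q) + 2 + (1 + gam) * (lam * V0 + Q)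
        + kap * ((1 + al) * Sig) + gam * (c * a * exp Z + lam * V0 + Q + al * Sig)) * ?d"
    by (simp add: algebra_simps)
  also have "\<dots> \<le> LR * ?d" using LR by (intro mult_right_mono) auto
  finally show ?thesis .
qed

text \<open>The distance is split at the clipped value \<open>zh t\<close>. Inside the box the
  increment of \<open>exp\<close> gives the rate \<open>2 * g0\<close>; beyond it the linear
  correction of slope \<open>g1 \<ge> g0\<close> takes over.\<close>

lemma zeta_repelled:
  assumes s: "s = 1 \<or> s = -1" and away: "s * (\<zeta> t - R t) \<ge> 0"
  shows "g0 * (s * (\<zeta> t - R t)) - al * Sig \<le>
    s * ((c + lam * exp (lp t)) * (a * exp (zh t) - rho t) + al * sg t + g1 * (\<zeta> t - zh t))"
proof -
  have gg: "g0 \<le> g1" by (rule g_order)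
  have Rb: "- Z \<le> R t" "R t \<le> Z" "\<bar>R t\<bar> \<le> Z" using rho_facts(2,3)[of t] pos Z1 by auto
  have cp: "c \<le> c + lam * exp (lp t)" using pos by simp
  have asg: "- (al * Sig) \<le> s * (al * sg t)"
    using sg_bound[of t] s pos mult_left_mono[of "sg t" Sig al] mult_left_mono[of "- Sig" "sg t" al] by (auto simp: abs_le_iff)
  have main: "2 * g0 * (s * (zh t - R t)) \<le> s * ((c + lam * exp (lp t)) * (a * exp (zh t) - rho t))"
    and order: "0 \<le> s * (zh t - R t)" "0 \<le> s * (\<zeta> t - zh t)"
  proof -
    have incr: "2 * g0 * (v - u) \<le> (c + lam * exp (lp t)) * (a * (exp v - exp u))" if "- Z \<le> u" "u \<le> v" "v \<le> Z" for u v
    proof -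
      have "2 * g0 * (v - u) \<le> c * a * exp (- Z) * (v - u)" using g0 that by (intro mult_right_mono) auto
      also have "\<dots> = c * (a * (exp (- Z) * (v - u)))" by simp
      also have "\<dots> \<le> (c + lam * exp (lp t)) * (a * (exp v - exp u))"
        using exp_increment(1)[of "- Z" u v Z] that pos cp by (intro mult_mono mult_left_mono) auto
      finally show ?thesis .
    qed
    have zb: "- Z \<le> zh t" "zh t \<le> Z" using box(2)[of t] by auto
    show o1: "0 \<le> s * (zh t - R t)" and "0 \<le> s * (\<zeta> t - zh t)"
      using s away Rb pos by (auto simp: zh_def clip_def min_def max_def)
    show "2 * g0 * (s * (zh t - R t)) \<le> s * ((c + lam * exp (lp t)) * (a * exp (zh t) - rho t))"
      using s
    proof
      assume "s = 1"
      then show ?thesis using incr[of "R t" "zh t"] o1 zb Rb by (simp add: rho_facts(1)[of t] right_diff_distrib)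
    next
      assume m: "s = -1"
      have "2 * g0 * (R t - zh t) \<le> (c + lam * exp (lp t)) * (a * (exp (R t) - exp (zh t)))"
        using incr[of "zh t" "R t"] o1 zb Rb m by simp
      also have "\<dots> = s * ((c + lam * exp (lp t)) * (a * exp (zh t) - rho t))"
        by (simp add: m rho_facts(1)[of t] algebra_simps)
      finally show ?thesis by (simp add: m)
    qed
  qed
  have "g0 * (s * (zh t - R t)) \<le> 2 * g0 * (s * (zh t - R t))"
    using order pos by (intro mult_right_mono) auto
  moreover have "g0 * (s * (\<zeta> t - zh t)) \<le> g1 * (s * (\<zeta> t - zh t))" using order gg by (intro mult_right_mono) auto
  moreover have "g0 * (s * (\<zeta> t - R t)) = g0 * (s * (zh t - R t)) + g0 * (s * (\<zeta> t - zh t))"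
    by (simp add: algebra_simps)
  moreover have "s * ((c + lam * exp (lp t)) * (a * exp (zh t) - rho t) + al * sg t + g1 * (\<zeta> t - zh t))
     = s * ((c + lam * exp (lp t)) * (a * exp (zh t) - rho t)) + s * (al * sg t) + g1 * (s * (\<zeta> t - zh t))"
    by (simp add: algebra_simps)
  ultimately show ?thesis using main asg by linarith
qed

text \<open>
  The graph \<open>r = rho\<close> repels at rate \<open>g0 / n\<close>, faster than the weight grows, so an orbit that leaves
  its neighbourhood contradicts the weighted bound.
\<close>

lemma zeta_close: "\<bar>\<zeta> t0 - R t0\<bar> \<le> eta"
proof -
  have key: "s * (\<zeta> t0 - R t0) \<le> eta" if s: "s = 1 \<or> s = -1" for s
  proof (rule ccontr)
    assume neg: "\<not> s * (\<zeta> t0 - R t0) \<le> eta"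
    have eta0: "0 \<le> eta"
    proof -
      have "0 \<le> LR" using R_lipschitz[of 1 0] by simp
      then have "0 \<le> eta * g0" using eta(1) pos Sig_nonneg by (smt (verit) mult_nonneg_nonneg)
      then show ?thesis using pos by (simp add: zero_le_mult_iff)
    qed
    \<comment> \<open>\<open>R\<close> is known to be Lipschitz only, so it is frozen at
      \<open>t0\<close> and its drift is charged to the line \<open>LR * (t - t0)\<close>.\<close>
    define y where "y = (\<lambda>t. s * (\<zeta> t - R t0) - LR * (t - t0) - eta)"
    define D where "D = (\<lambda>t. s * (((c + lam * exp (lp t)) * (a * exp (zh t) - rho t) + al * sg t + g1 * (\<zeta> t - zh t)) / n) - LR)"
    have y0: "y t0 > 0" using neg by (simp add: y_def)
    have grow: "y t \<ge> y t0 * exp (g0 / n * (t - t0))" if "t0 \<le> t" for t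
    proof (rule exponential_growth[where y = y and y' = D and T = t0 and t = t])
      fix t assume t: "t0 \<le> t"
      show "(y has_real_derivative D t) (at t)"
        unfolding y_def D_def by (auto intro!: derivative_eq_intros zeta_deriv)
      assume yp: "0 < y t"
      have "s * R t - s * R t0 \<le> LR * (t - t0)"
        using R_lipschitz[of t t0] t s by (auto simp: abs_le_iff)
      then have d: "y t + eta \<le> s * (\<zeta> t - R t)" by (simp add: y_def algebra_simps)
      then have "g0 * (y t + eta) \<le> g0 * (s * (\<zeta> t - R t))" using pos by (intro mult_left_mono) auto
      moreover have "0 \<le> s * (\<zeta> t - R t)" using d yp eta0 by linarith
      ultimately have "g0 * (y t + eta) - al * Sig \<le>
          s * ((c + lam * exp (lp t)) * (a * exp (zh t) - rho t) + al * sg t + g1 * (\<zeta> t - zh t))"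
        using zeta_repelled[OF s, of t] by linarith
      then have "g0 * y t + n * LR \<le> s * ((c + lam * exp (lp t)) * (a * exp (zh t) - rho t) + al * sg t + g1 * (\<zeta> t - zh t))"
        using eta(1) by (simp add: algebra_simps)
      then have "(g0 * y t + n * LR) / n \<le> s * ((c + lam * exp (lp t)) * (a * exp (zh t) - rho t) + al * sg t + g1 * (\<zeta> t - zh t)) / n"
        using pos by (intro divide_right_mono) auto
      moreover have "(g0 * y t + n * LR) / n = g0 / n * y t + LR" using pos by (simp add: add_divide_distrib)
      ultimately show "g0 / n * y t \<le> D t" unfolding D_def times_divide_eq_right by linarith
    qed (use y0 that in auto)
    have fast: "2 + 2 * real J < g0 / n" using rowZeta pos by (simp add: field_simps)
    have "((\<lambda>t. exp (- (g0 / n) * t) * (C * wgt J t)) \<longlongrightarrow> 0) at_top"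
      by (rule wgt_at_top[OF fast])
    moreover define k where "k = g0 / n"
    have "k > 0" using pos by (simp add: k_def)
    then have "((\<lambda>t. exp (- k * t)) \<longlongrightarrow> 0) at_top" "((\<lambda>t. exp (- k * t) * (t - t0)) \<longlongrightarrow> 0) at_top"
      by real_asymp+
    from tendsto_add[OF tendsto_mult_right_zero[OF this(1), of "\<bar>R t0\<bar>"] tendsto_mult_right_zero[OF this(2), of "\<bar>LR\<bar>"]]
    have "((\<lambda>t. exp (- (g0 / n) * t) * (\<bar>R t0\<bar> + \<bar>LR\<bar> * (t - t0))) \<longlongrightarrow> 0) at_top"
      unfolding k_def by (simp add: algebra_simps)
    ultimately have "((\<lambda>t. exp (- (g0 / n) * t) * (C * wgt J t) + exp (- (g0 / n) * t) * (\<bar>R t0\<bar> + \<bar>LR\<bar> * (t - t0))) \<longlongrightarrow> 0 + 0) at_top"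
      by (rule tendsto_add)
    then have lim: "((\<lambda>t. exp (- (g0 / n) * t) * (C * wgt J t + (\<bar>R t0\<bar> + \<bar>LR\<bar> * (t - t0)))) \<longlongrightarrow> 0) at_top"
      by (simp add: distrib_left)
    \<comment> \<open>After division by \<open>exp (g0 / n * t)\<close> the growth of
      \<open>y\<close> leaves a positive constant, while the weighted bound tends to 0.\<close>
    have "y t0 * exp (- (g0 / n) * t0) \<le> 0"
    proof (rule tendsto_lowerbound[OF lim])
      show "\<forall>\<^sub>F t in at_top. y t0 * exp (- (g0 / n) * t0) \<le> exp (- (g0 / n) * t) * (C * wgt J t + (\<bar>R t0\<bar> + \<bar>LR\<bar> * (t - t0)))"
        using eventually_ge_at_top[of t0]
      proof eventually_elim
        case (elim t)
        have "\<bar>s * (\<zeta> t - R t0)\<bar> \<le> C * wgt J t + \<bar>R t0\<bar>" using bound(4)[of t] s by auto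
        moreover have "- (LR * (t - t0)) \<le> \<bar>LR\<bar> * (t - t0)"
          using mult_right_mono[of "- LR" "\<bar>LR\<bar>" "t - t0"] elim by simp
        ultimately have "y t \<le> C * wgt J t + (\<bar>R t0\<bar> + \<bar>LR\<bar> * (t - t0))"
          using eta0 unfolding y_def by linarith
        then have "y t0 * exp (g0 / n * (t - t0)) \<le> C * wgt J t + (\<bar>R t0\<bar> + \<bar>LR\<bar> * (t - t0))"
          using grow[OF elim] by linarith
        then have "exp (- (g0 / n) * t) * (y t0 * exp (g0 / n * (t - t0))) \<le> exp (- (g0 / n) * t) * (C * wgt J t + (\<bar>R t0\<bar> + \<bar>LR\<bar> * (t - t0)))"
          by (intro mult_left_mono) auto
        moreover have "exp (- (g0 / n) * t) * (y t0 * exp (g0 / n * (t - t0))) = y t0 * exp (- (g0 / n) * t0)"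
          by (simp add: algebra_simps diff_divide_distrib flip: exp_add)
        ultimately show ?case by (simp only:)
      qed
    qed simp
    then show False using y0 by (simp add: mult_le_0_iff)
  qed
  show ?thesis using key[of 1] key[of "-1"] by (auto simp: abs_le_iff)
qed

lemma zh_eq: "zh t = \<zeta> t" and zeta_bound: "\<bar>\<zeta> t\<bar> \<le> Z"
proof -
  show "\<bar>\<zeta> t\<bar> \<le> Z" using zeta_close[of t] rho_facts(2,3)[of t] eta(2) Z1 by auto
  then show "zh t = \<zeta> t" by (auto simp: zh_def intro!: clip_eq)
qed

lemma err_bound: "\<bar>a * exp (zh t) - rho t\<bar> \<le> a * exp Z * eta"
proof -
  have "\<bar>exp (zh t) - exp (R t)\<bar> \<le> exp Z * \<bar>zh t - R t\<bar>"
    by (rule exp_lipschitz) (use box(2)[of t] rho_facts(3)[of t] pos in auto)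
  also have "\<dots> \<le> exp Z * eta" using zeta_close[of t] by (simp add: zh_eq)
  finally have "a * \<bar>exp (zh t) - exp (R t)\<bar> \<le> a * (exp Z * eta)" using pos by (intro mult_left_mono) auto
  moreover have "a * \<bar>exp (zh t) - exp (R t)\<bar> = \<bar>a * exp (zh t) - rho t\<bar>"
    using pos by (simp add: rho_facts(1)[of t] abs_mult flip: right_diff_distrib)
  ultimately show ?thesis by simp
qed

text \<open>
  On \<open>r = rho\<close> the quantity \<open>c (a - rho)\<close> equals \<open>u\<close>, and the planar flow of \<open>(p, q)\<close> points strictly
  into \<open>u \<le> U\<close>.
\<close>

lemma slow_trap: "c * (a - rho t) < U"
proof (rule barrier_left[where y = "\<lambda>t. c * (a - rho t)" and l = 0])
  have sat0: "(sat \<longlongrightarrow> 0) at_bot" unfolding sat_def by real_asymp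
  have lp0: "((\<lambda>t. exp (lp t)) \<longlongrightarrow> 0) at_bot"
  proof (rule Lim_null_comparison)
    show "\<forall>\<^sub>F t in at_bot. norm (exp (lp t)) \<le> 2 * P * sat t"
      unfolding lp_def using exp_lh_bound[OF box(1,2)] by simp
    show "((\<lambda>t. 2 * P * sat t) \<longlongrightarrow> 0) at_bot" using tendsto_mult_right_zero[OF sat0] by simp
  qed
  have qh0: "(qh \<longlongrightarrow> 0) at_bot"
  proof (rule Lim_null_comparison[OF _ limits_at_bot(2)])
    show "\<forall>\<^sub>F t in at_bot. norm (qh t) \<le> q t"
      using q_nonneg pos by (auto simp: qh_def clip_def min_def)
  qed
  have cont_qh: "continuous_on UNIV qh" unfolding qh_def by (intro continuous_intros continuity)
  have cont_lp: "continuous_on UNIV lp"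
    unfolding lp_def lh_def xh_def zh_def by (intro continuous_intros continuity)
  have nz: "c + lam * exp (lp t) \<noteq> 0" for t using pos by (smt (verit) exp_gt_zero mult_pos_pos)
  show "continuous_on UNIV (\<lambda>t. c * (a - rho t))"
    unfolding rho_def using nz by (intro continuous_intros cont_qh cont_lp) auto
  have "((\<lambda>t. c * (a - (c * a - qh t) / (c + lam * exp (lp t)))) \<longlongrightarrow> c * (a - (c * a - 0) / (c + lam * 0))) at_bot"
    by (intro tendsto_intros lp0 qh0) (use pos in auto)
  then show "((\<lambda>t. c * (a - rho t)) \<longlongrightarrow> 0) at_bot" using pos by (simp add: rho_def)
  show "0 < U" using U margin by linarith
  fix t assume tU: "c * (a - rho t) = U"
  define p where "p = (\<lambda>t. exp (2 * t + \<psi> t + kap * \<xi> t + gam * n * \<zeta> t))"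
  have Pp: "P > 0" using P by (smt (verit) exp_gt_zero)
  have rho_pos: "rho t > 0" and rho_le: "rho t \<le> a" using rho_facts(1,3)[of t] pos by auto
  have split: "U = lam * exp (lp t) * rho t + qh t" using rho_facts(4)[of t] tU by simp
  have "0 < lam * exp (lp t) * rho t" using rho_pos pos by simp
  then have "qh t < Q" using split U by linarith
  then have qt: "q t < Q" by (simp add: qh_def clip_def min_def max_def split: if_splits)
  have rho_U: "rho t = a - U / c" using tU pos by (simp add: field_simps)
  have "lam * exp (lp t) * rho t \<le> U" using split box(3)[of t] by linarith
  also have "\<dots> < lam * P * rho t" using U by (simp add: rho_U)
  finally have "exp (lp t) < P" using pos rho_pos by (simp add: mult_less_cancel_right)
  then have lpP: "lp t < ln P" using Pp by (metis exp_less_cancel_iff exp_ln)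
  have lp_full: "lp t = min (ln P) (2 * t + \<psi> t + kap * \<xi> t + gam * n * \<zeta> t)" for t
    using psi_nonpos[of t] by (simp add: lp_def lh_def xh_eq zh_eq)
  have lpt: "2 * t + \<psi> t + kap * \<xi> t + gam * n * \<zeta> t < ln P" using lpP by (simp add: lp_full min_def split: if_splits)
  \<comment> \<open>At a contact time neither \<open>q\<close> nor \<open>p\<close> touches its cap.
    By continuity this holds nearby, so \<open>rho\<close> can be differentiated there as a function
    of the unclipped \<open>p\<close> and \<open>q\<close>.\<close>
  have "open {x. q x < Q}" by (rule open_Collect_less) (intro continuous_intros continuity)+
  moreover have "open {x. 2 * x + \<psi> x + kap * \<xi> x + gam * n * \<zeta> x < ln P}"
    by (rule open_Collect_less) (intro continuous_intros continuity)+
  ultimately have op: "open ({x. q x < Q} \<inter> {x. 2 * x + \<psi> x + kap * \<xi> x + gam * n * \<zeta> x < ln P})" (is "open ?O") by blast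
  have tO: "t \<in> ?O" using qt lpt by simp
  have pO: "exp (lp x) = p x" "qh x = q x" if "x \<in> ?O" for x
    using that q_nonneg[of x] by (auto simp: lp_full p_def qh_def intro!: clip_eq)
  define u where "u = lam * vv t + qh t"
  define r where "r = a * exp (zh t)"
  define err where "err = r - rho t"
  have u_eq: "u = U + lam * p t * err"
    using pO(1)[OF tO] by (simp add: u_def split vv_eq err_def r_def algebra_simps)
  have p_der: "(p has_real_derivative p t * (2 - u + (r - a) / lam)) (at t)"
  proof -
    have ze: "((c + lam * exp (lp t)) * (a * exp (zh t) - rho t) + al * sg t + g1 * (\<zeta> t - zh t)) = c * (r - a) + u + al * sg t"
      using nz[of t] by (simp add: zh_eq u_def r_def rho_def vv_eq) (simp add: field_simps)
    have zd: "(\<zeta> has_real_derivative (c * (r - a) + u + al * sg t) / n) (at t)"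
      using zeta_deriv[of t] unfolding ze .
    have xd: "(\<xi> has_real_derivative - ((1 + al) * sg t)) (at t)"
      using xi_deriv[of t] by (simp add: xh_eq)
    have pd: "(\<psi> has_real_derivative - ((1 + gam) * u)) (at t)"
      using psi_deriv[of t] by (simp add: u_def)
    have "(p has_real_derivative p t * (2 + - ((1 + gam) * u) + kap * (- ((1 + al) * sg t)) + gam * n * ((c * (r - a) + u + al * sg t) / n))) (at t)"
      unfolding p_def by (rule derivative_eq_intros zd xd pd refl)+ simp
    moreover have "2 + - ((1 + gam) * u) + kap * (- ((1 + al) * sg t)) + gam * n * ((c * (r - a) + u + al * sg t) / n) = 2 - u + (r - a) / lam"
    proof -
      have k: "kap * (1 + al) = gam * al" using pos by (simp add: kap_def)
      have g: "gam * c = 1 / lam" using pos by (simp add: gam_def)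
      have "2 + - ((1 + gam) * u) + kap * (- ((1 + al) * sg t)) + gam * n * ((c * (r - a) + u + al * sg t) / n)
         = 2 + - ((1 + gam) * u) + kap * (- ((1 + al) * sg t)) + gam * (c * (r - a) + u + al * sg t)"
        using pos by simp
      also have "\<dots> = 2 - u - (kap * (1 + al)) * sg t + gam * al * sg t + (gam * c) * (r - a)"
        by (simp add: algebra_simps)
      also have "\<dots> = 2 - u + (r - a) / lam" unfolding k g by simp
      finally show ?thesis .
    qed
    ultimately show ?thesis by (simp only:)
  qed
  have q_der: "(q has_real_derivative q t * (1 - u) + b * vv t) (at t)"
    using q_deriv[of t] pO(2)[OF tO] by (simp add: u_def algebra_simps)
  \<comment> \<open>The quotient rule for \<open>c * (a - rho)\<close>, with
    \<open>c * a - q t = rho t * (c + lam * p t)\<close> cancelled once.\<close>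
  define D where "D = c * ((q t * (1 - u) + b * vv t) + lam * rho t * (p t * (2 - u + (r - a) / lam))) / (c + lam * p t)"
  have cp: "c + lam * p t > 0" using pos by (auto simp: p_def intro: add_pos_pos)
  have rho_p: "(c * a - q t) = rho t * (c + lam * p t)" using cp pO[OF tO] by (simp add: rho_def)
  have quot: "((\<lambda>x. c * (a - (c * a - q x) / (c + lam * p x))) has_real_derivative
      c * (Dq * (c + lam * p t) + (c * a - q t) * (lam * Dp)) / ((c + lam * p t) * (c + lam * p t))) (at t)"
    if "(p has_real_derivative Dp) (at t)" "(q has_real_derivative Dq) (at t)" for Dp Dq
    using cp by (auto intro!: derivative_eq_intros that simp: algebra_simps add_divide_distrib diff_divide_distrib)
  have "c * (Dq * w + rho t * w * (lam * Dp)) / (w * w) = c * (Dq + lam * rho t * Dp) / w" if "w > 0" for Dp Dq w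
  proof -
    have *: "c * (Dq * w + rho t * w * (lam * Dp)) = c * (Dq + lam * rho t * Dp) * w" by (simp add: algebra_simps)
    show ?thesis unfolding * using that by simp
  qed
  from quot[OF p_der q_der, unfolded rho_p this[OF cp], folded D_def]
  have "((\<lambda>x. c * (a - (c * a - q x) / (c + lam * p x))) has_real_derivative D) (at t)" .
  then have der: "((\<lambda>t. c * (a - rho t)) has_real_derivative D) (at t)"
    by (rule has_field_derivative_transform_within_open[OF _ op tO]) (use pO in \<open>simp add: rho_def\<close>)
  have "D < 0"
  proof -
    have pt: "0 < p t" "p t \<le> P" using exp_lp_le[of t] pO(1)[OF tO] by (auto simp: p_def)
    have qt: "0 \<le> q t" "q t \<le> Q" using q_nonneg qt by auto
    have UU: "U = lam * p t * rho t + q t" using split pO[OF tO] by simp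
    have ra: "(r - a) / lam = - gam * U + err / lam"
    proof -
      have *: "r - a = err - U / c" by (simp add: err_def rho_U)
      show ?thesis unfolding * using pos by (simp add: gam_def field_simps)
    qed
    have vr: "vv t = p t * (rho t + err)" using pO(1)[OF tO] by (simp add: vv_eq err_def r_def)
    have e1: "lam * rho t * (p t * (err / lam)) = rho t * p t * err" using pos by simp
    \<comment> \<open>The planar part has the brackets \<open>1 - U\<close> and
      \<open>b / lam + 2 - (1 + gam) * U\<close>, both at most \<open>- d\<close>; their
      coefficients \<open>q t\<close> and \<open>lam * p t * rho t\<close> add up to
      \<open>U\<close>. All other terms are proportional to \<open>err\<close>.\<close>
    have "(q t * (1 - u) + b * vv t) + lam * rho t * (p t * (2 - u + (r - a) / lam))
      = (q t * (1 - U) + lam * p t * rho t * (b / lam + 2 - (1 + gam) * U))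
        + err * p t * (b - lam * q t - lam^2 * p t * rho t) + lam * rho t * (p t * (err / lam))"
      unfolding ra u_eq vr using pos by (simp add: algebra_simps power2_eq_square)
    also have "\<dots> = (q t * (1 - U) + lam * p t * rho t * (b / lam + 2 - (1 + gam) * U))
        + err * (p t * (b - lam * q t - lam^2 * p t * rho t + rho t))"
      unfolding e1 by (simp add: algebra_simps)
    also have "\<dots> \<le> - (d * U) + \<bar>err\<bar> * (P * (a + lam^2 * P * a + lam * Q + b))"
    proof (rule add_mono)
      have "q t * (1 - U) \<le> q t * (- d)" using U qt by (intro mult_left_mono) auto
      moreover have "lam * p t * rho t * (b / lam + 2 - (1 + gam) * U) \<le> lam * p t * rho t * (- d)"
        using U pt rho_pos pos by (intro mult_left_mono) (auto simp: gam_def)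
      moreover have "- (d * U) = q t * (- d) + lam * p t * rho t * (- d)"
        by (subst UU) (simp add: algebra_simps)
      ultimately show "q t * (1 - U) + lam * p t * rho t * (b / lam + 2 - (1 + gam) * U) \<le> - (d * U)" by linarith
      have l1: "0 \<le> lam * q t" "lam * q t \<le> lam * Q" using pos qt by (auto intro: mult_left_mono)
      have l2: "0 \<le> lam^2 * p t * rho t" "lam^2 * p t * rho t \<le> lam^2 * P * a"
        using pos pt rho_pos rho_le by (auto intro!: mult_mono mult_nonneg_nonneg)
      have b0: "0 < b" using pos by simp
      have "\<bar>b - lam * q t - lam^2 * p t * rho t + rho t\<bar> \<le> a + lam^2 * P * a + lam * Q + b"
        unfolding abs_le_iff using l1 l2 rho_pos rho_le b0 by linarith
      then have "\<bar>p t * (b - lam * q t - lam^2 * p t * rho t + rho t)\<bar> \<le> P * (a + lam^2 * P * a + lam * Q + b)"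
        unfolding abs_mult using pt by (intro mult_mono) auto
      then have "\<bar>err * (p t * (b - lam * q t - lam^2 * p t * rho t + rho t))\<bar> \<le> \<bar>err\<bar> * (P * (a + lam^2 * P * a + lam * Q + b))"
        unfolding abs_mult[of err] by (intro mult_left_mono) auto
      then show "err * (p t * (b - lam * q t - lam^2 * p t * rho t + rho t)) \<le> \<bar>err\<bar> * (P * (a + lam^2 * P * a + lam * Q + b))"
        by linarith
    qed
    also have "\<dots> < 0"
    proof -
      have "\<bar>err\<bar> * (P * (a + lam^2 * P * a + lam * Q + b)) \<le> (a * exp Z * eta) * (P * (a + lam^2 * P * a + lam * Q + b))"
        using err_bound[of t] Pp pos by (intro mult_right_mono) (auto simp: err_def r_def)
      also have "\<dots> < d * U" using eta(3) by (simp add: mult.commute)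
      finally show ?thesis by simp
    qed
    finally show ?thesis using cp pos by (simp add: D_def divide_neg_pos mult_pos_neg)
  qed
  then show "\<exists>D<0. ((\<lambda>t. c * (a - rho t)) has_real_derivative D) (at t)" using der by blast
qed

text \<open>Below the level \<open>U\<close> both \<open>lam * p * rho\<close> and \<open>q\<close>
  are smaller than \<open>U\<close>. Since then \<open>rho > a - U / c\<close>, the choice of
  \<open>P\<close> keeps \<open>p\<close> strictly below its cap.\<close>

lemma unclipped: "q t < Q" "lp t = 2 * t + \<psi> t + kap * \<xi> t + gam * n * \<zeta> t"
proof -
  have Pp: "P > 0" using P by (smt (verit) exp_gt_zero)
  have rho_pos: "rho t > 0" using rho_facts(1)[of t] pos by auto
  have split: "c * (a - rho t) = lam * exp (lp t) * rho t + qh t" by (rule rho_facts(4))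
  have lpos: "0 < lam * exp (lp t) * rho t" using rho_pos pos by simp
  then have "qh t < Q" using split slow_trap[of t] U by linarith
  then show "q t < Q" by (simp add: qh_def clip_def min_def max_def split: if_splits)
  have rl: "a - U / c < rho t"
  proof -
    have "c * (a - rho t) / c < U / c" using slow_trap[of t] pos by (intro divide_strict_right_mono) auto
    then show ?thesis using pos by simp
  qed
  have "lam * exp (lp t) * rho t < U" using split slow_trap[of t] box(3)[of t] by linarith
  also have "\<dots> < lam * P * (a - U / c)" by (rule U)
  also have "\<dots> \<le> lam * P * rho t" using rl pos Pp by (intro mult_left_mono) auto
  finally have "exp (lp t) < P" using pos rho_pos by (simp add: mult_less_cancel_right)
  then have "lp t < ln P" using Pp by (metis exp_less_cancel_iff exp_ln)
  then show "lp t = 2 * t + \<psi> t + kap * \<xi> t + gam * n * \<zeta> t"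
    using psi_nonpos[of t] by (simp add: lp_def lh_def xh_eq zh_eq min_def split: if_splits)
qed

end

context slow_fast
begin

text \<open>The product \<open>p * r\<close> without clipping.\<close>

definition "vel t \<psi> x z = a * exp (2 * t + \<psi> + kap * x + (1 + gam * n) * z)"

end

context slow_fast_trap
begin

theorem slow_fast_orbit_exists:
  obtains \<psi> q \<xi> \<zeta> :: "real \<Rightarrow> real" and C where
    "\<And>t. (\<psi> has_real_derivative - ((1 + gam) * (lam * vel t (\<psi> t) (\<xi> t) (\<zeta> t) + q t))) (at t)"
    "\<And>t. (q has_real_derivative q t * (1 - (lam * vel t (\<psi> t) (\<xi> t) (\<zeta> t) + q t)) + b * vel t (\<psi> t) (\<xi> t) (\<zeta> t)) (at t)"
    "\<And>t. (\<xi> has_real_derivative - ((1 + al) * sig (\<xi> t) (\<zeta> t))) (at t)"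
    "\<And>t. (\<zeta> has_real_derivative (c * a * (exp (\<zeta> t) - 1) + (lam * vel t (\<psi> t) (\<xi> t) (\<zeta> t) + q t) + al * sig (\<xi> t) (\<zeta> t)) / n) (at t)"
    "\<And>t. \<bar>\<psi> t\<bar> \<le> C * wgt J t" "\<And>t. \<bar>q t\<bar> \<le> C * wgt J t" "\<And>t. \<bar>\<xi> t\<bar> \<le> C * wgt J t" "\<And>t. \<bar>\<zeta> t\<bar> \<le> C * wgt J t"
    "\<And>t. 0 \<le> q t" "\<And>t. q t \<le> Q" "\<And>t. \<bar>\<xi> t\<bar> \<le> e" "\<And>t. \<bar>\<zeta> t\<bar> \<le> Z"
proof -
  obtain y C where y: "\<And>i t. (y i has_real_derivative nu i * y i t + clipped_rhs i t (\<lambda>j. y j t)) (at t)"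
    "\<And>i t. \<bar>y i t\<bar> \<le> C * (scale i * wgt J t)"
    using clipped_solution_exists by blast
  have "0 \<le> C * (scale Zeta * wgt J 0)" using y(2)[of Zeta 0] by linarith
  then have C0: "0 \<le> C" using wgt_pos[of J 0] by (simp add: scale_def zero_le_mult_iff)
  have scale_le: "scale i \<le> 1" for i
    using pos one_le_power[of M 2] by (cases i) (auto simp: scale_def divide_le_eq_1)
  have b: "\<bar>y i t\<bar> \<le> C * wgt J t" for i t
  proof -
    have "scale i * wgt J t \<le> 1 * wgt J t" using scale_le wgt_pos[of J t] by (intro mult_right_mono) auto
    then have "C * (scale i * wgt J t) \<le> C * wgt J t" using C0 by (intro mult_left_mono) auto
    then show ?thesis using y(2)[of i t] by linarith
  qed
  interpret orb: clipped_orbit lam al n c a b S Q P Z e V0 gX g0 g1 k3 th M Cs J U d Sig eta LR "y Psi" "y Que" "y Xi" "y Zeta" C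
    by unfold_locales (use y(1)[of Psi] y(1)[of Que] y(1)[of Xi] y(1)[of Zeta] b in \<open>auto simp: nu_def clipped_rhs_def\<close>)
  have vv: "orb.vv t = vel t (y Psi t) (y Xi t) (y Zeta t)" for t
    by (simp add: orb.vv_eq orb.unclipped(2) vel_def orb.zh_eq algebra_simps flip: exp_add)
  have qh: "orb.qh t = y Que t" for t
    using orb.q_nonneg[of t] orb.unclipped(1)[of t] by (simp add: orb.qh_def clip_eq)
  have sg: "orb.sg t = sig (y Xi t) (y Zeta t)" for t by (simp add: orb.sg_def orb.xh_eq orb.zh_eq)
  show ?thesis
  proof (rule that)
    fix t
    show "(y Psi has_real_derivative - ((1 + gam) * (lam * vel t (y Psi t) (y Xi t) (y Zeta t) + y Que t))) (at t)"
      using orb.psi_deriv[of t] by (simp add: vv qh)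
    show "(y Que has_real_derivative y Que t * (1 - (lam * vel t (y Psi t) (y Xi t) (y Zeta t) + y Que t)) + b * vel t (y Psi t) (y Xi t) (y Zeta t)) (at t)"
      using orb.q_deriv[of t] by (simp add: vv qh algebra_simps)
    show "(y Xi has_real_derivative - ((1 + al) * sig (y Xi t) (y Zeta t))) (at t)"
      using orb.xi_deriv[of t] by (simp add: sg orb.xh_eq)
    have p: "c + lam * exp (orb.lp t) \<noteq> 0" using pos by (smt (verit) exp_gt_zero mult_pos_pos)
    have r: "(c + lam * exp (orb.lp t)) * orb.rho t = c * a - orb.qh t" using p by (simp add: orb.rho_def)
    have "(c + lam * exp (orb.lp t)) * (a * exp (orb.zh t) - orb.rho t) = c * a * (exp (orb.zh t) - 1) + (lam * orb.vv t + orb.qh t)"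
      unfolding right_diff_distrib[of "c + lam * exp (orb.lp t)"] r orb.vv_eq by (simp add: algebra_simps)
    then show "(y Zeta has_real_derivative (c * a * (exp (y Zeta t) - 1) + (lam * vel t (y Psi t) (y Xi t) (y Zeta t) + y Que t) + al * sig (y Xi t) (y Zeta t)) / n) (at t)"
      using orb.zeta_deriv[of t] by (simp add: sg qh vv orb.zh_eq)
    show "\<bar>y Psi t\<bar> \<le> C * wgt J t" "\<bar>y Que t\<bar> \<le> C * wgt J t" "\<bar>y Xi t\<bar> \<le> C * wgt J t" "\<bar>y Zeta t\<bar> \<le> C * wgt J t"
      by (rule b)+
    show "0 \<le> y Que t" by (rule orb.q_nonneg)
    show "y Que t \<le> Q" using orb.unclipped(1)[of t] by simp
    show "\<bar>y Xi t\<bar> \<le> e" using orb.xi_in_box[of t] by simp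
    show "\<bar>y Zeta t\<bar> \<le> Z" by (rule orb.zeta_bound)
  qed
qed

end

section \<open>Asymptotics at both ends\<close>

text \<open>The remainder \<open>exp h - 1 - h\<close> is at most \<open>h * (exp h - 1)\<close>, so
  boundedness of the product \<open>k * h\<close> suffices although \<open>k\<close> itself may be
  unbounded.\<close>

lemma scaled_exp_expansion:
  fixes h k :: "real \<Rightarrow> real"
  assumes h: "(h \<longlongrightarrow> 0) F" and bd: "\<forall>\<^sub>F t in F. \<bar>k t * h t\<bar> \<le> B"
  shows "((\<lambda>t. k t * (exp (h t) - 1) - k t * h t) \<longlongrightarrow> 0) F"
proof (rule Lim_null_comparison)
  show "\<forall>\<^sub>F t in F. norm (k t * (exp (h t) - 1) - k t * h t) \<le> B * \<bar>exp (h t) - 1\<bar>"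
    using bd
  proof eventually_elim
    case (elim t)
    have "1 + h t \<le> exp (h t)" by (rule exp_ge_add_one_self)
    moreover have "exp (h t) * (1 + - h t) \<le> exp (h t) * exp (- h t)"
      by (intro mult_left_mono exp_ge_add_one_self) auto
    then have "exp (h t) - 1 \<le> h t * exp (h t)" by (simp add: algebra_simps flip: exp_add)
    ultimately have "\<bar>exp (h t) - 1 - h t\<bar> \<le> h t * (exp (h t) - 1)" by (simp add: algebra_simps)
    also have "\<dots> \<le> \<bar>h t\<bar> * \<bar>exp (h t) - 1\<bar>" by (simp flip: abs_mult)
    finally have "\<bar>k t\<bar> * \<bar>exp (h t) - 1 - h t\<bar> \<le> \<bar>k t\<bar> * (\<bar>h t\<bar> * \<bar>exp (h t) - 1\<bar>)"
      by (intro mult_left_mono) auto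
    also have "\<dots> = \<bar>k t * h t\<bar> * \<bar>exp (h t) - 1\<bar>" by (simp add: abs_mult)
    also have "\<dots> \<le> B * \<bar>exp (h t) - 1\<bar>" using elim by (intro mult_right_mono) auto
    also have "\<bar>k t\<bar> * \<bar>exp (h t) - 1 - h t\<bar> = norm (k t * (exp (h t) - 1) - k t * h t)"
      unfolding real_norm_def abs_mult[symmetric] by (simp add: algebra_simps)
    finally show ?case .
  qed
  have "((\<lambda>t. B * \<bar>exp (h t) - 1\<bar>) \<longlongrightarrow> B * \<bar>exp 0 - 1\<bar>) F" by (intro tendsto_intros h)
  then show "((\<lambda>t. B * \<bar>exp (h t) - 1\<bar>) \<longlongrightarrow> 0) F" by simp
qed

lemma bounded_times_null:
  fixes f g :: "real \<Rightarrow> real"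
  assumes "\<forall>\<^sub>F t in F. \<bar>f t\<bar> \<le> B" "(g \<longlongrightarrow> 0) F"
  shows "((\<lambda>t. f t * g t) \<longlongrightarrow> 0) F"
proof (rule Lim_null_comparison)
  show "\<forall>\<^sub>F t in F. norm (f t * g t) \<le> B * \<bar>g t\<bar>"
    using assms(1) by eventually_elim (simp add: abs_mult mult_right_mono)
  show "((\<lambda>t. B * \<bar>g t\<bar>) \<longlongrightarrow> 0) F"
    using tendsto_mult_right_zero[OF tendsto_rabs_zero[OF assms(2)]] .
qed

text \<open>\<open>gam1\<close> gives the decay of \<open>p\<close> at \<open>+\<infinity>\<close>.
  \<open>gain1\<close> and \<open>gain0\<close> are the gain conditions of \<open>small_gain\<close>
  at \<open>M1\<close> and, after scaling and time reversal, at \<open>M0\<close>; the factors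
  \<open>1 / n\<close> on both sides have been cancelled.\<close>

locale slow_fast_limits = slow_fast_trap +
  assumes gam1: "1 / (lam * c) > 1"
    and gain1: "Cs * gX < a * S * exp (- Z - 1) / lam * g0"
    and gain0: "gX * ((1 + al) * Cs) < 2 * (g0 - 2 * n)"

locale orbit = slow_fast_limits +
  fixes \<psi> q \<xi> \<zeta> :: "real \<Rightarrow> real" and C :: real
  assumes der_psi: "(\<psi> has_real_derivative - ((1 + gam) * (lam * vel t (\<psi> t) (\<xi> t) (\<zeta> t) + q t))) (at t)"
    and der_q: "(q has_real_derivative q t * (1 - (lam * vel t (\<psi> t) (\<xi> t) (\<zeta> t) + q t)) + b * vel t (\<psi> t) (\<xi> t) (\<zeta> t)) (at t)"
    and der_xi: "(\<xi> has_real_derivative - ((1 + al) * sig (\<xi> t) (\<zeta> t))) (at t)"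
    and der_zeta: "(\<zeta> has_real_derivative (c * a * (exp (\<zeta> t) - 1) + (lam * vel t (\<psi> t) (\<xi> t) (\<zeta> t) + q t) + al * sig (\<xi> t) (\<zeta> t)) / n) (at t)"
    and bound: "\<bar>\<psi> t\<bar> \<le> C * wgt J t" "\<bar>q t\<bar> \<le> C * wgt J t" "\<bar>\<xi> t\<bar> \<le> C * wgt J t" "\<bar>\<zeta> t\<bar> \<le> C * wgt J t"
    and ranges: "0 \<le> q t" "q t \<le> Q" "\<bar>\<xi> t\<bar> \<le> e" "\<bar>\<zeta> t\<bar> \<le> Z"
begin

definition "vl t = vel t (\<psi> t) (\<xi> t) (\<zeta> t)"

lemma vl_pos: "0 < vl t" using pos by (simp add: vl_def vel_def)

lemma gam_gt1: "gam > 1" using gam1 by (simp add: gam_def)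

text \<open>At a zero of \<open>q\<close> the slope would be \<open>b * vl t > 0\<close>, so
  \<open>q\<close> would have been negative just before. Positivity admits \<open>ln q\<close> in
  the decay argument.\<close>

lemma q_pos: "0 < q t"
proof (rule ccontr)
  assume "\<not> 0 < q t"
  then have q0: "q t = 0" using ranges(1)[of t] by simp
  have "(q has_real_derivative b * vl t) (at t)" using der_q[of t] q0 by (simp add: vl_def)
  moreover have "0 < b * vl t" using vl_pos[of t] pos by simp
  ultimately obtain \<delta> where "\<delta> > 0" "\<And>h. h > 0 \<Longrightarrow> h < \<delta> \<Longrightarrow> q (t - h) < q t"
    using DERIV_pos_inc_left by blast
  then have "q (t - \<delta>/2) < 0" using q0 by (metis half_gt_zero field_sum_of_halves less_add_same_cancel1)
  then show False using ranges(1)[of "t - \<delta>/2"] by simp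
qed

lemma exponent_bound: "kap * \<xi> t + gam * n * \<zeta> t \<le> 1"
proof -
  have "kap * \<xi> t \<le> kap * e" "gam * n * \<zeta> t \<le> gam * n * Z"
    using ranges(3,4)[of t] kap_pos gam_pos pos by (auto intro!: mult_left_mono)
  then show ?thesis using small' by linarith
qed

text \<open>
  With \<open>G = ln (p / q powr (1 + gam))\<close>, corrected by powers of \<open>r\<close> and \<open>s\<close>, all coupling terms cancel up
  to a negative one and \<open>G' \<le> 1 - gam < 0\<close>.
\<close>

lemma vl_at_top: "(vl \<longlongrightarrow> 0) at_top"
proof -
  define G where "G = (\<lambda>t. \<psi> t + 2 * t - (1 + gam) * ln (q t))"
  have G': "(G has_real_derivative (1 - gam) - (1 + gam) * (b * vl t / q t)) (at t)" for t
    unfolding G_def using q_pos[of t]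
    by (auto intro!: derivative_eq_intros der_psi der_q simp: vl_def[symmetric] field_simps)
  have H: "G t + (gam - 1) * t \<le> G 0" if "0 \<le> t" for t
  proof -
    have "G t + (gam - 1) * t \<le> G 0 + (gam - 1) * 0"
    proof (rule deriv_nonpos_imp_antimono[where g = "\<lambda>t. G t + (gam - 1) * t" and g' = "\<lambda>t. - ((1 + gam) * (b * vl t / q t))"])
      show "((\<lambda>t. G t + (gam - 1) * t) has_real_derivative - ((1 + gam) * (b * vl t / q t))) (at t)" for t
        by (auto intro!: derivative_eq_intros G')
      show "- ((1 + gam) * (b * vl t / q t)) \<le> 0" for t
        using q_pos[of t] vl_pos[of t] gam_pos pos by simp
    qed (use that in auto)
    then show ?thesis by simp
  qed
  define K where "K = G 0 + (1 + gam) * ln Q + 1 + Z"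
  have up: "vl t \<le> a * exp K * exp (- ((gam - 1) * t))" if "0 \<le> t" for t
  proof -
    have "ln (q t) \<le> ln Q" using q_pos[of t] ranges(2)[of t] by (subst ln_le_cancel_iff) auto
    then have "(1 + gam) * ln (q t) \<le> (1 + gam) * ln Q" using gam_pos by (intro mult_left_mono) auto
    then have "\<psi> t + 2 * t \<le> G 0 - (gam - 1) * t + (1 + gam) * ln Q" using H[OF that] by (simp add: G_def)
    then have "2 * t + \<psi> t + kap * \<xi> t + (1 + gam * n) * \<zeta> t \<le> K + - ((gam - 1) * t)"
      using exponent_bound[of t] ranges(4)[of t] by (simp add: K_def algebra_simps)
    then have "exp (2 * t + \<psi> t + kap * \<xi> t + (1 + gam * n) * \<zeta> t) \<le> exp K * exp (- ((gam - 1) * t))"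
      by (simp flip: exp_add)
    then show ?thesis using pos by (simp add: vl_def vel_def mult.assoc)
  qed
  define k where "k = gam - 1"
  have "k > 0" using gam_gt1 by (simp add: k_def)
  then have "((\<lambda>t. exp (- (k * t))) \<longlongrightarrow> 0) at_top" by real_asymp
  then have lim: "((\<lambda>t. a * exp K * exp (- ((gam - 1) * t))) \<longlongrightarrow> 0) at_top"
    unfolding k_def by (rule tendsto_mult_right_zero)
  show ?thesis
  proof (rule Lim_null_comparison[OF _ lim])
    show "\<forall>\<^sub>F t in at_top. norm (vl t) \<le> a * exp K * exp (- ((gam - 1) * t))"
      using eventually_ge_at_top[of 0] by eventually_elim (use up vl_pos in \<open>simp add: less_imp_le\<close>)
  qed
qed

text \<open>The equation reads \<open>q' = - q * (q - 1) + (b - lam * q) * vl t\<close>: stable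
  around 1 once \<open>q\<close> stays away from 0, with vanishing forcing.
  \<open>small_gain\<close> is used with a zero second component.\<close>

lemma q_at_top: "(q \<longlongrightarrow> 1) at_top"
proof -
  have "\<forall>\<^sub>F t in at_top. vl t < 1 / (4 * lam)" using vl_at_top pos by (intro order_tendstoD) auto
  then obtain T where T: "\<And>t. t \<ge> T \<Longrightarrow> vl t < 1 / (4 * lam)" by (auto simp: eventually_at_top_linorder)
  \<comment> \<open>Below \<open>1 / 2\<close>, and with \<open>lam * vl t < 1 / 4\<close>, the
    function \<open>q\<close> increases, so it cannot fall under \<open>qm\<close>.\<close>
  define qm where "qm = min (q T) (1/2)"
  have qm0: "qm > 0" using q_pos by (simp add: qm_def)
  have low: "qm \<le> q t" if "T \<le> t" for t
  proof -
    have "- q t \<le> - qm"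
    proof (rule barrier_right[where h = "\<lambda>t. - q t" and t = t and T = T and hi = "1 - qm"
          and h' = "\<lambda>t. - (q t * (1 - (lam * vl t + q t)) + b * vl t)"])
      fix x assume x: "T \<le> x"
      show "((\<lambda>t. - q t) has_real_derivative - (q x * (1 - (lam * vl x + q x)) + b * vl x)) (at x)"
        using DERIV_minus[OF der_q[of x]] by (simp add: vl_def)
      assume "- qm < - q x"
      then have "q x < 1/2" by (simp add: qm_def)
      moreover have "lam * vl x < 1/4" using T[OF x] pos by (simp add: field_simps)
      ultimately have "0 \<le> q x * (1 - (lam * vl x + q x))" using q_pos[of x] by (intro mult_nonneg_nonneg) auto
      moreover have "0 \<le> b * vl x" using vl_pos[of x] pos by simp
      ultimately show "- (q x * (1 - (lam * vl x + q x)) + b * vl x) \<le> 0" by linarith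
    qed (use that in \<open>auto simp: qm_def\<close>)
    then show ?thesis by simp
  qed
  define f where "f = (\<lambda>t. \<bar>(b - lam * q t) * vl t\<bar>)"
  have f: "(f \<longlongrightarrow> 0) at_top" unfolding f_def
  proof (rule tendsto_rabs_zero, rule bounded_times_null[OF _ vl_at_top])
    have "\<bar>b - lam * q t\<bar> \<le> b + lam * Q" for t
    proof -
      have "0 \<le> lam * q t" "lam * q t \<le> lam * Q" "0 < b" using ranges(1,2)[of t] pos by (auto intro: mult_left_mono)
      then show ?thesis unfolding abs_le_iff by linarith
    qed
    then show "\<forall>\<^sub>F t in at_top. \<bar>b - lam * q t\<bar> \<le> b + lam * Q" by simp
  qed
  have "((\<lambda>t. q t - 1) \<longlongrightarrow> 0) at_top \<and> ((\<lambda>t::real. 0::real) \<longlongrightarrow> 0) at_top"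
  proof (rule small_gain[where ?\<mu>1.0 = qm and ?\<mu>2.0 = 1 and ?d1.0 = 0 and ?d2.0 = 0 and B = "Q + 1" and f = f
        and ?D1.0 = "\<lambda>t. q t * (1 - (lam * vl t + q t)) + b * vl t" and ?D2.0 = "\<lambda>_. 0"])
    show "\<forall>\<^sub>F t in at_top. ((\<lambda>t. q t - 1) has_real_derivative q t * (1 - (lam * vl t + q t)) + b * vl t) (at t)"
      using der_q by (intro always_eventually allI) (auto intro!: derivative_eq_intros simp: vl_def)
    show "\<forall>\<^sub>F t in at_top. \<bar>q t - 1\<bar> \<le> Q + 1 \<and> \<bar>0::real\<bar> \<le> Q + 1"
      using ranges(1,2) pos by (auto intro!: always_eventually simp: abs_le_iff) (smt (verit))+
    show "\<forall>\<^sub>F t in at_top. (q t - 1) * (q t * (1 - (lam * vl t + q t)) + b * vl t)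
        \<le> - qm * (q t - 1)\<^sup>2 + \<bar>q t - 1\<bar> * (0 * \<bar>0::real\<bar> + f t)"
      using eventually_ge_at_top[of T]
    proof eventually_elim
      case (elim t)
      have "(q t - 1) * (q t * (1 - (lam * vl t + q t)) + b * vl t) = - q t * (q t - 1)\<^sup>2 + (q t - 1) * ((b - lam * q t) * vl t)"
        by (simp add: algebra_simps power2_eq_square)
      moreover have "qm * (q t - 1)\<^sup>2 \<le> q t * (q t - 1)\<^sup>2" using low[OF elim] by (intro mult_right_mono) auto
      moreover have "(q t - 1) * ((b - lam * q t) * vl t) \<le> \<bar>q t - 1\<bar> * f t"
        unfolding f_def abs_mult[symmetric] by (rule abs_ge_self)
      ultimately show ?case by simp
    qed
  qed (use f qm0 in auto)
  then show ?thesis by (simp add: LIM_zero_cancel)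
qed

text \<open>This is \<open>ln (r1 / r0)\<close>: with \<open>u = 1\<close> and
  \<open>sig = 0\<close> the fast equation reduces to \<open>c * (r - a) + 1 = 0\<close>.\<close>

definition "z_end = ln (1 - 1 / (c * a))"

lemma z_end: "\<bar>z_end\<bar> \<le> Z" "c * a * (exp z_end - 1) = - 1"
proof -
  have ca: "c * a > 1" using U margin by linarith
  then have p: "1 - 1 / (c * a) > 0" by simp
  have Pp: "P > 0" using P by (smt (verit) exp_gt_zero)
  have "a * exp (1 - Z) * c \<le> a * exp (1 - Z) * (c + lam * P)" using pos Pp by (intro mult_left_mono) auto
  also have "\<dots> \<le> c * a - Q" by (rule Zrho)
  also have "\<dots> \<le> c * a - 1" using U margin by linarith
  finally have "exp (1 - Z) * (c * a) \<le> c * a - 1" by (simp add: mult_ac)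
  then have "exp (1 - Z) \<le> (c * a - 1) / (c * a)" using ca by (subst pos_le_divide_eq) auto
  also have "\<dots> = 1 - 1 / (c * a)" using pos by (simp add: diff_divide_distrib)
  finally have "exp (1 - Z) \<le> exp z_end" using p by (simp add: z_end_def)
  moreover have "exp z_end \<le> exp 0" using p ca by (simp add: z_end_def)
  ultimately show "\<bar>z_end\<bar> \<le> Z" by simp
  show "c * a * (exp z_end - 1) = - 1" using p pos by (simp add: z_end_def right_diff_distrib)
qed

lemma x_end_exists: "\<exists>x. \<bar>x\<bar> \<le> e \<and> sig x z_end = 0"
proof -
  have l: "sig (- e) z_end \<le> 0" "0 \<le> sig e z_end"
    using sig_sign[OF z_end(1)] by auto
  have "continuous_on {- e..e} (\<lambda>x. sig x z_end)" unfolding sig_def using pos by (intro continuous_intros) auto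
  then obtain x where "- e \<le> x" "x \<le> e" "sig x z_end = 0" using IVT'[of "\<lambda>x. sig x z_end" "- e" 0 e] l pos by auto
  then show ?thesis by (intro exI[of _ x]) auto
qed

text \<open>The \<open>\<xi>\<close> coordinate of \<open>M1\<close>, that is
  \<open>ln (s1 / s0) - n * z_end\<close>. Describing it as a zero of \<open>sig\<close> places it
  in the box by the sign change of \<open>sig_sign\<close>.\<close>

definition "x_end = (SOME x. \<bar>x\<bar> \<le> e \<and> sig x z_end = 0)"

lemma x_end: "\<bar>x_end\<bar> \<le> e" "sig x_end z_end = 0"
  using someI_ex[OF x_end_exists] unfolding x_end_def by auto

lemma sig_xi_dissipative:
  assumes "\<bar>x\<bar> \<le> e" "\<bar>x'\<bar> \<le> e" "\<bar>z\<bar> \<le> Z"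
  shows "a * S * exp (- Z - 1) / lam * (x - x')\<^sup>2 \<le> (x - x') * (sig x z - sig x' z)"
proof (cases "x' \<le> x")
  case True
  have "(x - x') * (a * S * exp (- Z - 1) / lam * (x - x')) \<le> (x - x') * (sig x z - sig x' z)"
    using sig_xi(1)[of x' x z] assms True by (intro mult_left_mono) auto
  then show ?thesis by (simp add: power2_eq_square mult_ac)
next
  case False
  have "(x' - x) * (a * S * exp (- Z - 1) / lam * (x' - x)) \<le> (x' - x) * (sig x' z - sig x z)"
    using sig_xi(1)[of x x' z] assms False by (intro mult_left_mono) auto
  moreover have "(x' - x) * (sig x' z - sig x z) = (x - x') * (sig x z - sig x' z)" by (simp add: algebra_simps)
  moreover have "(x' - x) * (a * S * exp (- Z - 1) / lam * (x' - x)) = a * S * exp (- Z - 1) / lam * (x - x')\<^sup>2"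
    unfolding power2_commute[of x x'] by (simp add: power2_eq_square mult_ac)
  ultimately show ?thesis by (simp only:)
qed

lemma fast_expansive:
  assumes "\<bar>x\<bar> \<le> e" "\<bar>z\<bar> \<le> Z" "\<bar>z'\<bar> \<le> Z"
  shows "g0 * (z - z')\<^sup>2 \<le> (z - z') * (c * a * (exp z - exp z') + al * (sig x z - sig x z'))"
proof -
  have 1: "2 * g0 * (z - z')\<^sup>2 \<le> (z - z') * (c * a * (exp z - exp z'))"
  proof -
    have mon: "exp (- Z) * (v - u) * (v - u) \<le> (exp v - exp u) * (v - u)" if "u \<le> v" "\<bar>u\<bar> \<le> Z" "\<bar>v\<bar> \<le> Z" for u v
      using exp_increment(1)[of "- Z" u v Z] that by (intro mult_right_mono) auto
    have m: "exp (- Z) * (z - z')\<^sup>2 \<le> (exp z - exp z') * (z - z')"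
      using mon[of z z'] mon[of z' z] assms by (cases "z \<le> z'") (auto simp: power2_eq_square algebra_simps)
    have "2 * g0 * (z - z')\<^sup>2 \<le> c * a * exp (- Z) * (z - z')\<^sup>2" using g0 by (intro mult_right_mono) auto
    also have "\<dots> = c * a * (exp (- Z) * (z - z')\<^sup>2)" by simp
    also have "\<dots> \<le> c * a * ((exp z - exp z') * (z - z'))" using m pos by (intro mult_left_mono) auto
    finally show ?thesis by (simp add: mult_ac)
  qed
  have 2: "- (g0 * (z - z')\<^sup>2) \<le> (z - z') * (al * (sig x z - sig x z'))"
  proof -
    have "\<bar>(z - z') * (al * (sig x z - sig x z'))\<bar> = al * (\<bar>sig x z - sig x z'\<bar> * \<bar>z - z'\<bar>)"
      using pos by (simp add: abs_mult)
    also have "\<dots> \<le> al * (Cs * \<bar>z - z'\<bar> * \<bar>z - z'\<bar>)"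
      using sig_zeta_lipschitz[of x z' z] assms pos by (intro mult_left_mono mult_right_mono) auto
    also have "\<dots> = al * Cs * (z - z')\<^sup>2" by (simp add: power2_eq_square)
    also have "\<dots> \<le> g0 * (z - z')\<^sup>2" using g0 by (intro mult_right_mono) auto
    finally show ?thesis by linarith
  qed
  have "(z - z') * (c * a * (exp z - exp z') + al * (sig x z - sig x z')) =
      (z - z') * (c * a * (exp z - exp z')) + (z - z') * (al * (sig x z - sig x z'))"
    by (simp add: distrib_left)
  then show ?thesis using 1 2 by linarith
qed

text \<open>\<open>\<xi> - x_end\<close> is contracted by \<open>sig_xi_dissipative\<close> and
  \<open>\<zeta> - z_end\<close> expanded by \<open>fast_expansive\<close>, with forcing
  \<open>u - 1\<close> tending to 0. Each difference of \<open>sig\<close> is telescoped so that one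
  argument changes at a time; the cross terms are then bounded by \<open>Cs\<close> and
  \<open>gX\<close>.\<close>

lemma xi_zeta_at_top: "(\<xi> \<longlongrightarrow> x_end) at_top" "(\<zeta> \<longlongrightarrow> z_end) at_top"
proof -
  define gm where "gm = a * S * exp (- Z - 1) / lam"
  have gm0: "gm > 0" using pos by (simp add: gm_def)
  define u where "u = (\<lambda>t. lam * vl t + q t)"
  have "(u \<longlongrightarrow> lam * 0 + 1) at_top" unfolding u_def by (intro tendsto_intros vl_at_top q_at_top)
  then have "((\<lambda>t. \<bar>u t - 1\<bar> / n) \<longlongrightarrow> \<bar>lam * 0 + 1 - 1\<bar> / n) at_top" by (intro tendsto_intros) (use pos in auto)
  then have f: "((\<lambda>t. \<bar>u t - 1\<bar> / n) \<longlongrightarrow> 0) at_top" by simp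
  have "((\<lambda>t. \<xi> t - x_end) \<longlongrightarrow> 0) at_top \<and> ((\<lambda>t. \<zeta> t - z_end) \<longlongrightarrow> 0) at_top"
  proof (rule small_gain[where ?\<mu>1.0 = "(1 + al) * gm" and ?\<mu>2.0 = "g0 / n" and ?d1.0 = "(1 + al) * Cs" and ?d2.0 = "gX / n"
        and B = "2 * e + 2 * Z" and f = "\<lambda>t. \<bar>u t - 1\<bar> / n"
        and ?D1.0 = "\<lambda>t. - ((1 + al) * sig (\<xi> t) (\<zeta> t))"
        and ?D2.0 = "\<lambda>t. (c * a * (exp (\<zeta> t) - 1) + u t + al * sig (\<xi> t) (\<zeta> t)) / n", OF _ _ _ _ _ f])
    show "\<forall>\<^sub>F t in at_top. ((\<lambda>t. \<xi> t - x_end) has_real_derivative - ((1 + al) * sig (\<xi> t) (\<zeta> t))) (at t)"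
      by (intro always_eventually allI) (auto intro!: derivative_eq_intros der_xi)
    show "\<forall>\<^sub>F t in at_top. ((\<lambda>t. \<zeta> t - z_end) has_real_derivative (c * a * (exp (\<zeta> t) - 1) + u t + al * sig (\<xi> t) (\<zeta> t)) / n) (at t)"
      using der_zeta by (intro always_eventually allI) (auto intro!: derivative_eq_intros simp: u_def vl_def)
    show "\<forall>\<^sub>F t in at_top. \<bar>\<xi> t - x_end\<bar> \<le> 2 * e + 2 * Z \<and> \<bar>\<zeta> t - z_end\<bar> \<le> 2 * e + 2 * Z"
    proof (intro always_eventually allI conjI)
      fix t show "\<bar>\<xi> t - x_end\<bar> \<le> 2 * e + 2 * Z" using ranges(3)[of t] x_end(1) pos by linarith
      show "\<bar>\<zeta> t - z_end\<bar> \<le> 2 * e + 2 * Z" using ranges(4)[of t] z_end(1) pos by linarith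
    qed
    show "\<forall>\<^sub>F t in at_top. (\<xi> t - x_end) * - ((1 + al) * sig (\<xi> t) (\<zeta> t)) \<le>
        - ((1 + al) * gm) * (\<xi> t - x_end)\<^sup>2 + \<bar>\<xi> t - x_end\<bar> * ((1 + al) * Cs * \<bar>\<zeta> t - z_end\<bar> + \<bar>u t - 1\<bar> / n)"
    proof (intro always_eventually allI)
      fix t
      have "gm * (\<xi> t - x_end)\<^sup>2 \<le> (\<xi> t - x_end) * (sig (\<xi> t) (\<zeta> t) - sig x_end (\<zeta> t))"
        unfolding gm_def by (rule sig_xi_dissipative) (use ranges x_end in auto)
      moreover have "- ((\<xi> t - x_end) * sig x_end (\<zeta> t)) \<le> \<bar>\<xi> t - x_end\<bar> * (Cs * \<bar>\<zeta> t - z_end\<bar>)"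
      proof -
        have "\<bar>sig x_end (\<zeta> t)\<bar> \<le> Cs * \<bar>\<zeta> t - z_end\<bar>"
          using sig_zeta_lipschitz[of x_end z_end "\<zeta> t"] x_end z_end(1) ranges(4)[of t] by simp
        then have "\<bar>(\<xi> t - x_end) * sig x_end (\<zeta> t)\<bar> \<le> \<bar>\<xi> t - x_end\<bar> * (Cs * \<bar>\<zeta> t - z_end\<bar>)"
          unfolding abs_mult by (intro mult_left_mono) auto
        then show ?thesis by linarith
      qed
      moreover have "(\<xi> t - x_end) * (sig (\<xi> t) (\<zeta> t) - sig x_end (\<zeta> t)) = (\<xi> t - x_end) * sig (\<xi> t) (\<zeta> t) - (\<xi> t - x_end) * sig x_end (\<zeta> t)"
        by (simp add: algebra_simps)
      ultimately have "- ((\<xi> t - x_end) * sig (\<xi> t) (\<zeta> t)) \<le> - (gm * (\<xi> t - x_end)\<^sup>2) + \<bar>\<xi> t - x_end\<bar> * (Cs * \<bar>\<zeta> t - z_end\<bar>)"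
        by linarith
      then have "(1 + al) * - ((\<xi> t - x_end) * sig (\<xi> t) (\<zeta> t)) \<le> (1 + al) * (- (gm * (\<xi> t - x_end)\<^sup>2) + \<bar>\<xi> t - x_end\<bar> * (Cs * \<bar>\<zeta> t - z_end\<bar>))"
        using pos by (intro mult_left_mono) auto
      also have "(1 + al) * - ((\<xi> t - x_end) * sig (\<xi> t) (\<zeta> t)) = (\<xi> t - x_end) * - ((1 + al) * sig (\<xi> t) (\<zeta> t))" by simp
      also have "(1 + al) * (- (gm * (\<xi> t - x_end)\<^sup>2) + \<bar>\<xi> t - x_end\<bar> * (Cs * \<bar>\<zeta> t - z_end\<bar>))
         = - ((1 + al) * gm) * (\<xi> t - x_end)\<^sup>2 + \<bar>\<xi> t - x_end\<bar> * ((1 + al) * Cs * \<bar>\<zeta> t - z_end\<bar>)"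
        by (simp add: algebra_simps)
      also have "\<dots> \<le> - ((1 + al) * gm) * (\<xi> t - x_end)\<^sup>2 + \<bar>\<xi> t - x_end\<bar> * ((1 + al) * Cs * \<bar>\<zeta> t - z_end\<bar> + \<bar>u t - 1\<bar> / n)"
        using pos by (intro add_left_mono mult_left_mono) auto
      finally show "(\<xi> t - x_end) * - ((1 + al) * sig (\<xi> t) (\<zeta> t)) \<le>
        - ((1 + al) * gm) * (\<xi> t - x_end)\<^sup>2 + \<bar>\<xi> t - x_end\<bar> * ((1 + al) * Cs * \<bar>\<zeta> t - z_end\<bar> + \<bar>u t - 1\<bar> / n)" .
    qed
    show "\<forall>\<^sub>F t in at_top. g0 / n * (\<zeta> t - z_end)\<^sup>2 - \<bar>\<zeta> t - z_end\<bar> * (gX / n * \<bar>\<xi> t - x_end\<bar> + \<bar>u t - 1\<bar> / n) \<le>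
        (\<zeta> t - z_end) * ((c * a * (exp (\<zeta> t) - 1) + u t + al * sig (\<xi> t) (\<zeta> t)) / n)"
    proof (intro always_eventually allI)
      fix t
      define y where "y = \<zeta> t - z_end"
      have 1: "g0 * y\<^sup>2 \<le> y * (c * a * (exp (\<zeta> t) - exp z_end) + al * (sig (\<xi> t) (\<zeta> t) - sig (\<xi> t) z_end))"
        unfolding y_def by (rule fast_expansive) (use ranges z_end in auto)
      have s: "al * \<bar>sig (\<xi> t) z_end\<bar> \<le> gX * \<bar>\<xi> t - x_end\<bar>"
        using sig_xi_lipschitz(2)[of x_end "\<xi> t" z_end] x_end z_end ranges(3)[of t] by simp
      have 2: "- (\<bar>y\<bar> * (gX * \<bar>\<xi> t - x_end\<bar> + \<bar>u t - 1\<bar>)) \<le> y * ((u t - 1) + al * sig (\<xi> t) z_end)"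
      proof -
        have "\<bar>(u t - 1) + al * sig (\<xi> t) z_end\<bar> \<le> \<bar>u t - 1\<bar> + al * \<bar>sig (\<xi> t) z_end\<bar>"
          using abs_triangle_ineq[of "u t - 1" "al * sig (\<xi> t) z_end"] pos by (simp add: abs_mult)
        then have "\<bar>(u t - 1) + al * sig (\<xi> t) z_end\<bar> \<le> gX * \<bar>\<xi> t - x_end\<bar> + \<bar>u t - 1\<bar>" using s by linarith
        then have "\<bar>y * ((u t - 1) + al * sig (\<xi> t) z_end)\<bar> \<le> \<bar>y\<bar> * (gX * \<bar>\<xi> t - x_end\<bar> + \<bar>u t - 1\<bar>)"
          unfolding abs_mult[of y] by (intro mult_left_mono) auto
        then show ?thesis by linarith
      qed
      have ce: "c * a * exp z_end = c * a - 1" using z_end(2) by (simp add: algebra_simps)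
      have "y * (c * a * (exp (\<zeta> t) - 1) + u t + al * sig (\<xi> t) (\<zeta> t)) =
          y * (c * a * (exp (\<zeta> t) - exp z_end) + al * (sig (\<xi> t) (\<zeta> t) - sig (\<xi> t) z_end)) + y * ((u t - 1) + al * sig (\<xi> t) z_end)"
        unfolding right_diff_distrib[of "c * a"] ce by (simp add: algebra_simps)
      then have "g0 * y\<^sup>2 - \<bar>y\<bar> * (gX * \<bar>\<xi> t - x_end\<bar> + \<bar>u t - 1\<bar>) \<le> y * (c * a * (exp (\<zeta> t) - 1) + u t + al * sig (\<xi> t) (\<zeta> t))"
        using 1 2 by linarith
      then have "(g0 * y\<^sup>2 - \<bar>y\<bar> * (gX * \<bar>\<xi> t - x_end\<bar> + \<bar>u t - 1\<bar>)) / n \<le> y * (c * a * (exp (\<zeta> t) - 1) + u t + al * sig (\<xi> t) (\<zeta> t)) / n"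
        using pos by (intro divide_right_mono) auto
      then show "g0 / n * (\<zeta> t - z_end)\<^sup>2 - \<bar>\<zeta> t - z_end\<bar> * (gX / n * \<bar>\<xi> t - x_end\<bar> + \<bar>u t - 1\<bar> / n) \<le>
        (\<zeta> t - z_end) * ((c * a * (exp (\<zeta> t) - 1) + u t + al * sig (\<xi> t) (\<zeta> t)) / n)"
        unfolding y_def by (simp add: diff_divide_distrib add_divide_distrib distrib_left)
    qed
    show "(1 + al) * Cs * (gX / n) < (1 + al) * gm * (g0 / n)"
    proof -
      have "(1 + al) / n * (Cs * gX) < (1 + al) / n * (gm * g0)"
        using gain1 pos unfolding gm_def by (intro mult_strict_left_mono) auto
      then show ?thesis by (simp add: mult_ac)
    qed
  qed (use pos gm0 Cs_pos in auto)
  then show "(\<xi> \<longlongrightarrow> x_end) at_top" "(\<zeta> \<longlongrightarrow> z_end) at_top" by (auto simp: LIM_zero_cancel)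
qed

section \<open>Exponential asymptotics at minus infinity\<close>

lemma null_at_bot: "(\<psi> \<longlongrightarrow> 0) at_bot" "(q \<longlongrightarrow> 0) at_bot" "(\<xi> \<longlongrightarrow> 0) at_bot" "(\<zeta> \<longlongrightarrow> 0) at_bot"
proof -
  have "((\<lambda>t. C * wgt J t) \<longlongrightarrow> 0) at_bot" using wgt_at_bot[of 0 C J] by simp
  note null = Lim_null_comparison[OF always_eventually this, rule_format]
  show "(\<psi> \<longlongrightarrow> 0) at_bot" "(q \<longlongrightarrow> 0) at_bot" "(\<xi> \<longlongrightarrow> 0) at_bot" "(\<zeta> \<longlongrightarrow> 0) at_bot"
    by (rule null; use bound in simp)+
qed

text \<open>For \<open>t \<le> 0\<close> the second factor of the weight is at most
  \<open>2 ^ J\<close>. Boundedness of the scaled unknowns is what the estimates in reversed time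
  upgrade to convergence.\<close>

lemma scaled_bound:
  assumes "\<And>t. \<bar>f t\<bar> \<le> C * wgt J t"
  shows "\<forall>\<^sub>F t in at_bot. \<bar>exp (- 2 * t) * f t\<bar> \<le> \<bar>C\<bar> * 2 ^ J"
  using eventually_le_at_bot[of 0]
proof eventually_elim
  case (elim t)
  have "(1 + exp (2 * t)) ^ J \<le> 2 ^ J" using elim by (intro power_mono) (auto simp: add_nonneg_nonneg)
  moreover have "exp (- 2 * t) * wgt J t = (1 + exp (2 * t)) ^ J"
    by (simp add: wgt_def mult.assoc[symmetric] flip: exp_add)
  ultimately have w: "exp (- 2 * t) * wgt J t \<le> 2 ^ J" by simp
  have "\<bar>exp (- 2 * t) * f t\<bar> = exp (- 2 * t) * \<bar>f t\<bar>" by (simp add: abs_mult)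
  also have "\<dots> \<le> exp (- 2 * t) * (\<bar>C\<bar> * wgt J t)"
    using assms[of t] wgt_pos[of J t] by (intro mult_left_mono order_trans[OF assms mult_right_mono]) auto
  also have "\<dots> = \<bar>C\<bar> * (exp (- 2 * t) * wgt J t)" by simp
  also have "\<dots> \<le> \<bar>C\<bar> * 2 ^ J" using w by (intro mult_left_mono) auto
  finally show ?case .
qed

lemma scaled_vl: "((\<lambda>t. exp (- 2 * t) * vl t) \<longlongrightarrow> a) at_bot"
proof -
  have e: "exp (- 2 * t) * vl t = a * exp (\<psi> t + kap * \<xi> t + (1 + gam * n) * \<zeta> t)" for t
    by (simp add: vl_def vel_def mult.left_commute flip: exp_add)
  have "((\<lambda>t. a * exp (\<psi> t + kap * \<xi> t + (1 + gam * n) * \<zeta> t)) \<longlongrightarrow> a * exp (0 + kap * 0 + (1 + gam * n) * 0)) at_bot"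
    by (intro tendsto_intros null_at_bot)
  then show ?thesis unfolding e by simp
qed

lemma vl_at_bot: "(vl \<longlongrightarrow> 0) at_bot"
proof -
  have "((\<lambda>t::real. exp (2 * t)) \<longlongrightarrow> 0) at_bot" by real_asymp
  from tendsto_mult[OF this scaled_vl] show ?thesis by (simp add: mult.assoc[symmetric] flip: exp_add)
qed

text \<open>The scaled deviation satisfies \<open>g' = - g + f\<close> with \<open>f\<close> tending
  to 0; the rate is the eigenvalue 1 of \<open>q\<close> minus the scaling rate 2. In reversed time
  this is unstable, so a bounded \<open>g\<close> tends to 0.\<close>

lemma scaled_q: "((\<lambda>t. exp (- 2 * t) * q t) \<longlongrightarrow> b * a) at_bot"
proof -
  define g where "g = (\<lambda>t. exp (- 2 * t) * q t - b * a)"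
  define f where "f = (\<lambda>t. b * (exp (- 2 * t) * vl t - a) - exp (- 2 * t) * q t * (lam * vl t + q t))"
  have g': "(g has_real_derivative - g t + f t) (at t)" for t
    unfolding g_def f_def
    by (auto intro!: derivative_eq_intros der_q simp: vl_def[symmetric] algebra_simps)
  have "((\<lambda>t. b * (exp (- 2 * t) * vl t - a)) \<longlongrightarrow> b * (a - a)) at_bot" by (intro tendsto_intros scaled_vl)
  moreover have "((\<lambda>t. exp (- 2 * t) * q t * (lam * vl t + q t)) \<longlongrightarrow> 0) at_bot"
  proof (rule bounded_times_null[OF scaled_bound[OF bound(2)]])
    have "((\<lambda>t. lam * vl t + q t) \<longlongrightarrow> lam * 0 + 0) at_bot" by (intro tendsto_intros vl_at_bot null_at_bot)
    then show "((\<lambda>t. lam * vl t + q t) \<longlongrightarrow> 0) at_bot" by simp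
  qed
  ultimately have "(f \<longlongrightarrow> b * (a - a) - 0) at_bot" unfolding f_def by (rule tendsto_diff)
  then have "((\<lambda>t. \<bar>f t\<bar>) \<longlongrightarrow> 0) at_bot" by (intro tendsto_rabs_zero) simp
  then have f0: "((\<lambda>s. \<bar>f (- s)\<bar>) \<longlongrightarrow> 0) at_top" by (simp add: filterlim_at_bot_mirror)
  have "((\<lambda>s::real. 0::real) \<longlongrightarrow> 0) at_top \<and> ((\<lambda>s. g (- s)) \<longlongrightarrow> 0) at_top"
  proof (rule small_gain[where ?\<mu>1.0 = 1 and ?\<mu>2.0 = 1 and ?d1.0 = 0 and ?d2.0 = 0 and f = "\<lambda>s. \<bar>f (- s)\<bar>"
        and B = "\<bar>C\<bar> * 2 ^ J + b * a" and ?D1.0 = "\<lambda>_. 0" and ?D2.0 = "\<lambda>s. - (- g (- s) + f (- s))", OF _ _ _ _ _ f0])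
    show "\<forall>\<^sub>F s in at_top. ((\<lambda>s. g (- s)) has_real_derivative - (- g (- s) + f (- s))) (at s)"
      by (intro always_eventually allI has_real_derivative_reflect g')
    have "\<forall>\<^sub>F t in at_bot. \<bar>g t\<bar> \<le> \<bar>C\<bar> * 2 ^ J + b * a"
      using scaled_bound[OF bound(2)]
    proof eventually_elim
      case (elim t)
      have "0 < b * a" using pos by simp
      then show ?case using elim unfolding g_def abs_le_iff by linarith
    qed
    then have "\<forall>\<^sub>F s in at_top. \<bar>g (- s)\<bar> \<le> \<bar>C\<bar> * 2 ^ J + b * a" by (simp add: at_bot_mirror eventually_filtermap)
    then show "\<forall>\<^sub>F s in at_top. \<bar>0::real\<bar> \<le> \<bar>C\<bar> * 2 ^ J + b * a \<and> \<bar>g (- s)\<bar> \<le> \<bar>C\<bar> * 2 ^ J + b * a"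
      using pos by (auto elim!: eventually_mono)
    show "\<forall>\<^sub>F s in at_top. 1 * (g (- s))\<^sup>2 - \<bar>g (- s)\<bar> * (0 * \<bar>0::real\<bar> + \<bar>f (- s)\<bar>) \<le> g (- s) * - (- g (- s) + f (- s))"
    proof (intro always_eventually allI)
      fix s
      have "g (- s) * f (- s) \<le> \<bar>g (- s)\<bar> * \<bar>f (- s)\<bar>" by (metis abs_ge_self abs_mult)
      then show "1 * (g (- s))\<^sup>2 - \<bar>g (- s)\<bar> * (0 * \<bar>0::real\<bar> + \<bar>f (- s)\<bar>) \<le> g (- s) * - (- g (- s) + f (- s))"
        by (simp add: power2_eq_square algebra_simps)
    qed
  qed auto
  then have "(g \<longlongrightarrow> 0) at_bot" by (simp add: filterlim_at_bot_mirror)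
  then show ?thesis unfolding g_def by (simp add: LIM_zero_cancel)
qed

text \<open>The derivative of \<open>sig\<close> at the origin.\<close>

definition "lin x z = (a * S * (x + n * z) - n / (1 + al) * z) / lam"

lemma lin_coeff: "lin x z = a * S / lam * x + (n * a * S - n / (1 + al)) / lam * z"
  "\<bar>(n * a * S - n / (1 + al)) / lam\<bar> \<le> Cs" "al * (a * S / lam) \<le> gX"
proof -
  show "lin x z = a * S / lam * x + (n * a * S - n / (1 + al)) / lam * z"
    by (simp add: lin_def algebra_simps add_divide_distrib diff_divide_distrib)
  have nu: "0 \<le> n / (1 + al)" "n / (1 + al) \<le> n" using pos by (auto simp: divide_le_eq)
  have nS: "0 \<le> n * a * S" using pos by simp
  have eZ: "1 \<le> exp Z" using pos by simp
  have p: "0 \<le> 3 * a * S * (e + n * Z)" "0 \<le> 3 * n * a * S + n" using pos by (auto intro!: add_nonneg_nonneg mult_nonneg_nonneg)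
  have "\<bar>n * a * S - n / (1 + al)\<bar> \<le> 3 * n * a * S + n" using nu nS unfolding abs_le_iff by linarith
  also have "\<dots> \<le> 3 * a * S * (e + n * Z) + 3 * n * a * S + n" using p by linarith
  also have "\<dots> = 1 * (3 * a * S * (e + n * Z) + 3 * n * a * S + n)" by simp
  also have "\<dots> \<le> exp Z * (3 * a * S * (e + n * Z) + 3 * n * a * S + n)" using eZ p by (intro mult_right_mono) linarith+
  also have "\<dots> \<le> Cs * lam" by (rule Cs)
  finally show "\<bar>(n * a * S - n / (1 + al)) / lam\<bar> \<le> Cs" using pos by (simp add: abs_divide divide_le_eq)
  have "a * S * 1 \<le> a * S * exp (Z + 1)" using pos by (intro mult_left_mono) auto
  then have "a * S / lam \<le> a * S * exp (Z + 1) / lam" using pos by (simp add: divide_right_mono)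
  then have "al * (a * S / lam) \<le> (1 + al) * (a * S * exp (Z + 1) / lam)"
    using pos by (intro mult_mono) auto
  also have "\<dots> \<le> gX" using gX by simp
  finally show "al * (a * S / lam) \<le> gX" .
qed

text \<open>\<open>xs\<close> and \<open>zs\<close> solve the linearised equations for the
  eigenvalue 2, with forcing \<open>lam * a + b * a\<close> coming from \<open>p\<close> and
  \<open>q\<close>. Time reversal exchanges the roles: the deviation of \<open>\<zeta>\<close>
  becomes stable and that of \<open>\<xi>\<close> unstable, so \<open>small_gain\<close> is applied
  with \<open>Y\<close> first.\<close>

lemma scaled_xi_zeta:
  assumes xs: "2 * xs = - ((1 + al) * lin xs zs)"
    and zs: "2 * n * zs = c * a * zs + (lam * a + b * a) + al * lin xs zs"
  shows "((\<lambda>t. exp (- 2 * t) * \<xi> t) \<longlongrightarrow> xs) at_bot" "((\<lambda>t. exp (- 2 * t) * \<zeta> t) \<longlongrightarrow> zs) at_bot"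
proof -
  define K where "K = \<bar>C\<bar> * 2 ^ J"
  have K0: "K \<ge> 0" by (simp add: K_def)
  have bx: "\<forall>\<^sub>F t in at_bot. \<bar>exp (- 2 * t) * \<xi> t\<bar> \<le> K" and bz: "\<forall>\<^sub>F t in at_bot. \<bar>exp (- 2 * t) * \<zeta> t\<bar> \<le> K"
    unfolding K_def by (rule scaled_bound[OF bound(3)], rule scaled_bound[OF bound(4)])
  have bw: "\<forall>\<^sub>F t in at_bot. \<bar>exp (- 2 * t) * (\<xi> t + n * \<zeta> t)\<bar> \<le> K + n * K"
    using bx bz
  proof eventually_elim
    case (elim t)
    have "\<bar>exp (- 2 * t) * (\<xi> t + n * \<zeta> t)\<bar> \<le> \<bar>exp (- 2 * t) * \<xi> t\<bar> + n * \<bar>exp (- 2 * t) * \<zeta> t\<bar>"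
      using abs_triangle_ineq[of "exp (- 2 * t) * \<xi> t" "n * (exp (- 2 * t) * \<zeta> t)"] pos
      by (simp add: abs_mult algebra_simps)
    also have "\<dots> \<le> K + n * K" using elim pos by (intro add_mono mult_left_mono) auto
    finally show ?case .
  qed
  have w0: "((\<lambda>t. \<xi> t + n * \<zeta> t) \<longlongrightarrow> 0) at_bot"
    using tendsto_add[OF null_at_bot(3) tendsto_mult_right_zero[OF null_at_bot(4), of n]] by simp
  note rz = scaled_exp_expansion[OF null_at_bot(4) bz]
  note rw = scaled_exp_expansion[OF w0 bw]
  \<comment> \<open>The remainders are the nonlinear part of \<open>sig\<close>, that of
    \<open>exp\<close>, and the deviation of the scaled \<open>u\<close> from its limit.\<close>
  define rem1 where "rem1 = (\<lambda>t. exp (- 2 * t) * sig (\<xi> t) (\<zeta> t) - lin (exp (- 2 * t) * \<xi> t) (exp (- 2 * t) * \<zeta> t))"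
  define rem2 where "rem2 = (\<lambda>t. c * a * (exp (- 2 * t) * (exp (\<zeta> t) - 1) - exp (- 2 * t) * \<zeta> t))"
  define rem3 where "rem3 = (\<lambda>t. exp (- 2 * t) * (lam * vl t + q t) - (lam * a + b * a))"
  have rem1_0: "(rem1 \<longlongrightarrow> 0) at_bot"
  proof -
    have "((\<lambda>t. exp (\<zeta> t) * (exp (- 2 * t) * (exp (\<xi> t + n * \<zeta> t) - 1) - exp (- 2 * t) * (\<xi> t + n * \<zeta> t))) \<longlongrightarrow> exp 0 * 0) at_bot"
      by (intro tendsto_intros rw null_at_bot)
    note p1 = this
    have p2: "((\<lambda>t. exp (- 2 * t) * (\<xi> t + n * \<zeta> t) * (exp (\<zeta> t) - 1)) \<longlongrightarrow> 0) at_bot"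
    proof (rule bounded_times_null[OF bw])
      have "((\<lambda>t. exp (\<zeta> t) - 1) \<longlongrightarrow> exp 0 - 1) at_bot" by (intro tendsto_intros null_at_bot)
      then show "((\<lambda>t. exp (\<zeta> t) - 1) \<longlongrightarrow> 0) at_bot" by simp
    qed
    have "((\<lambda>t. a * S / lam * (exp (\<zeta> t) * (exp (- 2 * t) * (exp (\<xi> t + n * \<zeta> t) - 1) - exp (- 2 * t) * (\<xi> t + n * \<zeta> t))
        + exp (- 2 * t) * (\<xi> t + n * \<zeta> t) * (exp (\<zeta> t) - 1)) - n / (1 + al) / lam * (exp (- 2 * t) * (exp (\<zeta> t) - 1) - exp (- 2 * t) * \<zeta> t))
        \<longlongrightarrow> a * S / lam * (exp 0 * 0 + 0) - n / (1 + al) / lam * 0) at_bot"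
      by (intro tendsto_add tendsto_diff tendsto_mult tendsto_const p1 p2 rz)
    note L = this
    have e: "rem1 t = a * S / lam * (exp (\<zeta> t) * (exp (- 2 * t) * (exp (\<xi> t + n * \<zeta> t) - 1) - exp (- 2 * t) * (\<xi> t + n * \<zeta> t))
        + exp (- 2 * t) * (\<xi> t + n * \<zeta> t) * (exp (\<zeta> t) - 1)) - n / (1 + al) / lam * (exp (- 2 * t) * (exp (\<zeta> t) - 1) - exp (- 2 * t) * \<zeta> t)" for t
    proof -
      have alg: "E * ((A * X * (W - 1) - B * (X - 1)) / lam) - (A * (E * x + n * (E * z)) - B * (E * z)) / lam =
        A / lam * (X * (E * (W - 1) - E * (x + n * z)) + E * (x + n * z) * (X - 1)) - B / lam * (E * (X - 1) - E * z)" for E A X W B x z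
        by (simp add: algebra_simps add_divide_distrib diff_divide_distrib)
      show ?thesis unfolding rem1_def sig_def lin_def by (rule alg)
    qed
    have "((\<lambda>t. rem1 t) \<longlongrightarrow> 0) at_bot" unfolding e using L by simp
    then show ?thesis by simp
  qed
  have rem2_0: "(rem2 \<longlongrightarrow> 0) at_bot" unfolding rem2_def by (rule tendsto_mult_right_zero[OF rz])
  have rem3_0: "(rem3 \<longlongrightarrow> 0) at_bot"
  proof -
    have "((\<lambda>t. lam * (exp (- 2 * t) * vl t) + exp (- 2 * t) * q t - (lam * a + b * a)) \<longlongrightarrow> lam * a + b * a - (lam * a + b * a)) at_bot"
      by (intro tendsto_intros scaled_vl scaled_q)
    then show ?thesis unfolding rem3_def by (simp add: algebra_simps)
  qed
  define X where "X = (\<lambda>t. exp (- 2 * t) * \<xi> t - xs)"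
  define Y where "Y = (\<lambda>t. exp (- 2 * t) * \<zeta> t - zs)"
  have lin_add: "lin (exp (- 2 * t) * \<xi> t) (exp (- 2 * t) * \<zeta> t) = lin (X t) (Y t) + lin xs zs" for t
  proof -
    have "lin (x + x') (z + z') = lin x z + lin x' z'" for x x' z z'
      unfolding lin_coeff(1) by (simp only: distrib_left add.assoc add.commute add.left_commute)
    from this[of "X t" xs "Y t" zs] show ?thesis by (simp add: X_def Y_def)
  qed
  define DX where "DX = (\<lambda>t. - 2 * X t - (1 + al) * (lin (X t) (Y t) + rem1 t))"
  define DY where "DY = (\<lambda>t. ((c * a - 2 * n) * Y t + al * lin (X t) (Y t) + (rem2 t + rem3 t + al * rem1 t)) / n)"
  have X': "(X has_real_derivative DX t) (at t)" for t
  proof -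
    have "(X has_real_derivative - 2 * (exp (- 2 * t) * \<xi> t) - (1 + al) * (exp (- 2 * t) * sig (\<xi> t) (\<zeta> t))) (at t)"
      unfolding X_def by (auto intro!: derivative_eq_intros der_xi simp: algebra_simps)
    moreover have "exp (- 2 * t) * sig (\<xi> t) (\<zeta> t) = lin (X t) (Y t) + lin xs zs + rem1 t"
      unfolding rem1_def lin_add by simp
    moreover have "exp (- 2 * t) * \<xi> t = X t + xs" by (simp add: X_def)
    moreover have "- 2 * (X t + xs) - (1 + al) * (lin (X t) (Y t) + lin xs zs + rem1 t) = DX t"
      using xs by (simp add: DX_def algebra_simps)
    ultimately show ?thesis by (simp only:)
  qed
  have Y': "(Y has_real_derivative DY t) (at t)" for t
  proof -
    define N where "N = c * a * (exp (\<zeta> t) - 1) + (lam * vl t + q t) + al * sig (\<xi> t) (\<zeta> t)"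
    have zd: "(\<zeta> has_real_derivative N / n) (at t)" using der_zeta[of t] by (simp add: N_def vl_def)
    have "(Y has_real_derivative - 2 * (exp (- 2 * t) * \<zeta> t) + exp (- 2 * t) * N / n) (at t)"
      unfolding Y_def by (auto intro!: derivative_eq_intros zd simp: algebra_simps)
    moreover have "exp (- 2 * t) * N = (c * a * (exp (- 2 * t) * \<zeta> t) + rem2 t) + (lam * a + b * a + rem3 t) + al * (lin (X t) (Y t) + lin xs zs + rem1 t)"
    proof -
      have "exp (- 2 * t) * sig (\<xi> t) (\<zeta> t) = lin (X t) (Y t) + lin xs zs + rem1 t"
        unfolding rem1_def lin_add by simp
      then have s: "al * (lin (X t) (Y t) + lin xs zs + rem1 t) = al * (exp (- 2 * t) * sig (\<xi> t) (\<zeta> t))" by (simp only:)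
      show ?thesis unfolding s N_def rem2_def rem3_def by (simp add: algebra_simps)
    qed
    moreover have "exp (- 2 * t) * \<zeta> t = Y t + zs" by (simp add: Y_def)
    moreover have "- 2 * (Y t + zs) + ((c * a * (Y t + zs) + rem2 t) + (lam * a + b * a + rem3 t) + al * (lin (X t) (Y t) + lin xs zs + rem1 t)) / n = DY t"
    proof -
      have "(c * a * (Y t + zs) + rem2 t) + (lam * a + b * a + rem3 t) + al * (lin (X t) (Y t) + lin xs zs + rem1 t)
        = ((c * a - 2 * n) * Y t + al * lin (X t) (Y t) + (rem2 t + rem3 t + al * rem1 t)) + n * (2 * (Y t + zs))"
        using zs by (simp add: algebra_simps)
      then show ?thesis using pos unfolding DY_def by (simp only: add_divide_distrib) simp
    qed
    ultimately show ?thesis by (simp only:)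
  qed
  define f where "f = (\<lambda>t. (\<bar>rem2 t\<bar> + \<bar>rem3 t\<bar> + al * \<bar>rem1 t\<bar>) / n + (1 + al) * \<bar>rem1 t\<bar>)"
  have "(f \<longlongrightarrow> (\<bar>0\<bar> + \<bar>0\<bar> + al * \<bar>0\<bar>) / n + (1 + al) * \<bar>0\<bar>) at_bot"
    unfolding f_def by (intro tendsto_intros rem1_0 rem2_0 rem3_0) (use pos in auto)
  then have f0: "((\<lambda>s. f (- s)) \<longlongrightarrow> 0) at_top" by (simp add: filterlim_at_bot_mirror)
  define A where "A = a * S / lam"
  define B where "B = (n * a * S - n / (1 + al)) / lam"
  have A0: "0 \<le> A" "al * A \<le> gX" using pos lin_coeff(3) by (auto simp: A_def)
  have B0: "\<bar>B\<bar> \<le> Cs" using lin_coeff(2) by (simp add: B_def)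
  have linAB: "lin x z = A * x + B * z" for x z by (simp add: lin_coeff(1) A_def B_def)
  have g2n: "g0 - 2 * n > 0"
  proof -
    have "0 \<le> gX * ((1 + al) * Cs)" using pos Cs_pos by simp
    from le_less_trans[OF this gain0] show ?thesis by simp
  qed
  have coef: "g0 - 2 * n \<le> c * a - 2 * n + al * B"
  proof -
    have "c * a * exp (- Z) \<le> c * a * 1" using pos by (intro mult_left_mono) auto
    moreover have "al * \<bar>B\<bar> \<le> al * Cs" using B0 pos by (intro mult_left_mono) auto
    moreover have "- (al * \<bar>B\<bar>) \<le> al * B" using mult_left_mono[of "- \<bar>B\<bar>" B al] pos by simp
    ultimately show ?thesis using g0 by linarith
  qed
  have "((\<lambda>s. Y (- s)) \<longlongrightarrow> 0) at_top \<and> ((\<lambda>s. X (- s)) \<longlongrightarrow> 0) at_top"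
  proof (rule small_gain[where ?\<mu>1.0 = "(g0 - 2 * n) / n" and ?\<mu>2.0 = 2 and ?d1.0 = "gX / n" and ?d2.0 = "(1 + al) * Cs"
        and f = "\<lambda>s. f (- s)" and B = "K + \<bar>xs\<bar> + \<bar>zs\<bar>" and ?D1.0 = "\<lambda>s. - DY (- s)" and ?D2.0 = "\<lambda>s. - DX (- s)", OF _ _ _ _ _ f0])
    show "\<forall>\<^sub>F s in at_top. ((\<lambda>s. Y (- s)) has_real_derivative - DY (- s)) (at s)"
      by (intro always_eventually allI has_real_derivative_reflect Y')
    show "\<forall>\<^sub>F s in at_top. ((\<lambda>s. X (- s)) has_real_derivative - DX (- s)) (at s)"
      by (intro always_eventually allI has_real_derivative_reflect X')
    have "\<forall>\<^sub>F t in at_bot. \<bar>Y t\<bar> \<le> K + \<bar>xs\<bar> + \<bar>zs\<bar> \<and> \<bar>X t\<bar> \<le> K + \<bar>xs\<bar> + \<bar>zs\<bar>"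
      using bx bz by eventually_elim (unfold X_def Y_def, linarith)
    then show "\<forall>\<^sub>F s in at_top. \<bar>Y (- s)\<bar> \<le> K + \<bar>xs\<bar> + \<bar>zs\<bar> \<and> \<bar>X (- s)\<bar> \<le> K + \<bar>xs\<bar> + \<bar>zs\<bar>"
      by (simp add: at_bot_mirror eventually_filtermap)
    show "\<forall>\<^sub>F s in at_top. Y (- s) * - DY (- s) \<le> - ((g0 - 2 * n) / n) * (Y (- s))\<^sup>2 + \<bar>Y (- s)\<bar> * (gX / n * \<bar>X (- s)\<bar> + f (- s))"
    proof (intro always_eventually allI)
      fix s
      define x y r where "x = X (- s)" and "y = Y (- s)" and "r = rem2 (- s) + rem3 (- s) + al * rem1 (- s)"
      have "\<bar>r\<bar> \<le> \<bar>rem2 (- s)\<bar> + \<bar>rem3 (- s)\<bar> + \<bar>al * rem1 (- s)\<bar>" unfolding r_def by linarith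
      then have rb: "\<bar>r\<bar> / n \<le> f (- s)"
        using pos by (simp add: f_def abs_mult divide_right_mono add_increasing2)
      have "(g0 - 2 * n) * y\<^sup>2 \<le> (c * a - 2 * n + al * B) * y\<^sup>2" using coef by (intro mult_right_mono) auto
      moreover have "\<bar>y * (al * A * x)\<bar> \<le> \<bar>y\<bar> * (gX * \<bar>x\<bar>)"
      proof -
        have "\<bar>y * (al * A * x)\<bar> = \<bar>y\<bar> * (al * A * \<bar>x\<bar>)" using A0 pos by (simp add: abs_mult)
        also have "\<dots> \<le> \<bar>y\<bar> * (gX * \<bar>x\<bar>)" using A0 by (intro mult_left_mono mult_right_mono) auto
        finally show ?thesis .
      qed
      moreover have "\<bar>y * r\<bar> = \<bar>y\<bar> * \<bar>r\<bar>" by (rule abs_mult)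
      moreover have "y * ((c * a - 2 * n) * y + al * lin x y + r) = (c * a - 2 * n + al * B) * y\<^sup>2 + y * (al * A * x) + y * r"
        by (simp add: linAB power2_eq_square algebra_simps)
      ultimately have "- (y * ((c * a - 2 * n) * y + al * lin x y + r)) \<le> - ((g0 - 2 * n) * y\<^sup>2) + \<bar>y\<bar> * (gX * \<bar>x\<bar>) + \<bar>y\<bar> * \<bar>r\<bar>"
        by linarith
      then have "- (y * ((c * a - 2 * n) * y + al * lin x y + r)) / n \<le> (- ((g0 - 2 * n) * y\<^sup>2) + \<bar>y\<bar> * (gX * \<bar>x\<bar>) + \<bar>y\<bar> * \<bar>r\<bar>) / n"
        using pos by (intro divide_right_mono) auto
      also have "\<dots> = - ((g0 - 2 * n) / n) * y\<^sup>2 + \<bar>y\<bar> * (gX / n * \<bar>x\<bar> + \<bar>r\<bar> / n)"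
      proof -
        have "(- (G * w) + v * (k * h) + v * r) / n = - (G / n) * w + v * (k / n * h + r / n)" for G w v k h r
          by (simp add: add_divide_distrib diff_divide_distrib distrib_left)
        then show ?thesis .
      qed
      also have "\<dots> \<le> - ((g0 - 2 * n) / n) * y\<^sup>2 + \<bar>y\<bar> * (gX / n * \<bar>x\<bar> + f (- s))"
        using rb by (intro add_left_mono mult_left_mono) auto
      finally show "Y (- s) * - DY (- s) \<le> - ((g0 - 2 * n) / n) * (Y (- s))\<^sup>2 + \<bar>Y (- s)\<bar> * (gX / n * \<bar>X (- s)\<bar> + f (- s))"
        unfolding DY_def x_def y_def r_def by simp
    qed
    show "\<forall>\<^sub>F s in at_top. 2 * (X (- s))\<^sup>2 - \<bar>X (- s)\<bar> * ((1 + al) * Cs * \<bar>Y (- s)\<bar> + f (- s)) \<le> X (- s) * - DX (- s)"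
    proof (intro always_eventually allI)
      fix s
      define x y r where "x = X (- s)" and "y = Y (- s)" and "r = rem1 (- s)"
      have rb: "(1 + al) * \<bar>r\<bar> \<le> f (- s)" using pos by (simp add: f_def r_def)
      have "0 \<le> A * x\<^sup>2" using A0 by simp
      moreover have "\<bar>x * (B * y)\<bar> \<le> \<bar>x\<bar> * (Cs * \<bar>y\<bar>)"
        unfolding abs_mult using B0 by (intro mult_left_mono mult_right_mono) auto
      moreover have "\<bar>x * r\<bar> = \<bar>x\<bar> * \<bar>r\<bar>" by (rule abs_mult)
      moreover have "x * (lin x y + r) = A * x\<^sup>2 + x * (B * y) + x * r" by (simp add: linAB power2_eq_square algebra_simps)
      ultimately have "- (\<bar>x\<bar> * (Cs * \<bar>y\<bar>) + \<bar>x\<bar> * \<bar>r\<bar>) \<le> x * (lin x y + r)" by linarith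
      then have "(1 + al) * - (\<bar>x\<bar> * (Cs * \<bar>y\<bar>) + \<bar>x\<bar> * \<bar>r\<bar>) \<le> (1 + al) * (x * (lin x y + r))"
        using pos by (intro mult_left_mono) auto
      moreover have "(1 + al) * - (\<bar>x\<bar> * (Cs * \<bar>y\<bar>) + \<bar>x\<bar> * \<bar>r\<bar>) = - (\<bar>x\<bar> * ((1 + al) * Cs * \<bar>y\<bar> + (1 + al) * \<bar>r\<bar>))"
        by (simp add: algebra_simps)
      moreover have "\<bar>x\<bar> * ((1 + al) * Cs * \<bar>y\<bar> + (1 + al) * \<bar>r\<bar>) \<le> \<bar>x\<bar> * ((1 + al) * Cs * \<bar>y\<bar> + f (- s))"
        using rb by (intro mult_left_mono) auto
      moreover have "x * - DX (- s) = 2 * x\<^sup>2 + (1 + al) * (x * (lin x y + r))"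
        by (simp add: DX_def x_def y_def r_def power2_eq_square algebra_simps)
      ultimately have "2 * x\<^sup>2 - \<bar>x\<bar> * ((1 + al) * Cs * \<bar>y\<bar> + f (- s)) \<le> x * - DX (- s)" by linarith
      then show "2 * (X (- s))\<^sup>2 - \<bar>X (- s)\<bar> * ((1 + al) * Cs * \<bar>Y (- s)\<bar> + f (- s)) \<le> X (- s) * - DX (- s)"
        unfolding x_def y_def .
    qed
    show "gX / n * ((1 + al) * Cs) < (g0 - 2 * n) / n * 2"
    proof -
      have "gX * ((1 + al) * Cs) / n < 2 * (g0 - 2 * n) / n" using gain0 pos by (intro divide_strict_right_mono) auto
      then show ?thesis by (simp add: mult_ac)
    qed
  qed (use pos g2n Cs_pos in auto)
  then have "(X \<longlongrightarrow> 0) at_bot" "(Y \<longlongrightarrow> 0) at_bot" by (simp_all add: filterlim_at_bot_mirror)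
  then show "((\<lambda>t. exp (- 2 * t) * \<xi> t) \<longlongrightarrow> xs) at_bot" "((\<lambda>t. exp (- 2 * t) * \<zeta> t) \<longlongrightarrow> zs) at_bot"
    unfolding X_def Y_def by (simp_all add: LIM_zero_cancel)
qed

end

section \<open>Constants in the limit n = 0\<close>

lemma eventually_less_from_limits:
  fixes f g :: "'a \<Rightarrow> real"
  assumes "(f \<longlongrightarrow> l) F" "(g \<longlongrightarrow> k) F" "l < k"
  shows "\<forall>\<^sub>F x in F. f x < g x"
proof -
  have "((\<lambda>x. g x - f x) \<longlongrightarrow> k - l) F" by (intro tendsto_intros assms)
  then have "\<forall>\<^sub>F x in F. 0 < g x - f x" by (rule order_tendstoD) (use assms in simp)
  then show ?thesis by eventually_elim simp
qed

text \<open>Each condition in \<open>strict\<close> is a locale assumption evaluated at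
  \<open>n = 0\<close>; being strict, it persists for small \<open>n > 0\<close>. The visible zeros
  make it literally the limit that \<open>tendsto_intros\<close> produces. The conditions in
  \<open>closed_ineqs\<close> involve constants only and may hold with equality.\<close>

lemma slow_fast_limits_eventually:
  fixes c a b S :: "real \<Rightarrow> real" and J :: nat
  assumes T: "(c \<longlongrightarrow> c0) (at_right 0)" "(a \<longlongrightarrow> a0) (at_right 0)" "(b \<longlongrightarrow> b0) (at_right 0)" "(S \<longlongrightarrow> S0) (at_right 0)"
    and pos0: "lam > 0" "al > 0" "c0 > 0" "a0 > 0" "b0 > 0" "S0 > 0"
    and posc: "d > 0" "Q > 0" "Z > 0" "e > 0" "gX > 0" "g0 > 0" "M \<ge> 1"
    and P: "P \<ge> exp 1" and th: "0 \<le> th" "th < 1"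
    and closed_ineqs: "al * Cs \<le> g0" "2 * Q + 1 \<le> th * (2 * Q + 2)" "gX + (1 + al) * Cs * M \<le> th * (gX + 2)"
      "Z \<ge> 1" "1 + d \<le> U" "U < Q" "Cs * Z + gX * e \<le> Sig" "eta \<le> 1"
    and strict: "e + 0 * Z < 1"
      "1/(lam*c0) * 0 < 1"
      "1/(lam*c0) * al/(1+al) * e + 1/(lam*c0) * 0 * Z < 1"
      "1/(lam*c0) * al/(1+al) + 3 < k3"
      "2 * a0 * exp Z * P < V0"
      "(1+al) * (a0 * S0 * exp (Z + 1)) / lam < gX"
      "2 * g0 < c0 * a0 * exp (- Z)"
      "c0 * a0 * exp Z + 2 * lam * V0 + g0 < g1"
      "exp Z * (3 * a0 * S0 * (e + 0 * Z) + 3 * 0 * a0 * S0 + 0) < Cs * lam"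
      "(1 + 1/(lam*c0)) * (lam * V0 * k3 * M) < 2 * real J * th"
      "1 + 1/(lam*c0) < 2 * th * M"
      "lam * V0 + (lam * Q + b0) * V0 * k3 * M^2 < 2 * real J * th"
      "g1 - g0 + (1 + lam * V0 * (1 + 1/(lam*c0) * al/(1+al)) + gX) / M < th * (g1 - 0 * (2 + 2 * real J))"
      "0 * (2 + 2 * real J) < g0"
      "2 + b0 / lam + d < (1 + 1/(lam*c0)) * U"
      "Q < c0 * a0"
      "U < lam * P * (a0 - U / c0)"
      "a0 * exp (1 - Z) * (c0 + lam * P) < c0 * a0 - Q"
      "0 * exp Z * (3 * a0 * S0 * Z + 1) < a0 * S0 * exp (- Z - 1) * e"
      "al * Sig + 0 * LR < eta * g0"
      "P * (a0 + lam^2 * P * a0 + lam * Q + b0) * (a0 * exp Z * eta) < d * U"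
      "(Q * (1 + lam * V0 + Q) + b0 * V0) / (c0 * a0 - Q) + 2 + (1 + 1/(lam*c0)) * (lam * V0 + Q) + 1/(lam*c0) * al/(1+al) * ((1 + al) * Sig) + 1/(lam*c0) * (c0 * a0 * exp Z + lam * V0 + Q + al * Sig) < LR"
      "1 < 1/(lam*c0)"
      "Cs * gX < a0 * S0 * exp (- Z - 1) / lam * g0"
      "gX * ((1 + al) * Cs) < 2 * (g0 - 2 * 0)"
  shows "\<forall>\<^sub>F n in at_right 0. slow_fast_limits lam al n (c n) (a n) (b n) (S n) Q P Z e V0 gX g0 g1 k3 th M Cs J U d Sig eta LR"
proof -
  have N: "((\<lambda>n::real. n) \<longlongrightarrow> 0) (at_right 0)" by (rule tendsto_ident_at)
  have nz: "c0 \<noteq> 0" "lam \<noteq> 0" "1 + al \<noteq> 0" "lam * c0 \<noteq> 0" "M \<noteq> 0" "c0 * a0 - Q \<noteq> 0" using pos0 posc strict(16) by auto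
  have ev: "\<forall>\<^sub>F n in at_right 0. e + n * Z < 1"
    "\<forall>\<^sub>F n in at_right 0. 1/(lam*c n) * n < 1"
    "\<forall>\<^sub>F n in at_right 0. 1/(lam*c n) * al/(1+al) * e + 1/(lam*c n) * n * Z < 1"
    "\<forall>\<^sub>F n in at_right 0. 1/(lam*c n) * al/(1+al) + 3 < k3"
    "\<forall>\<^sub>F n in at_right 0. 2 * a n * exp Z * P < V0"
    "\<forall>\<^sub>F n in at_right 0. (1+al) * (a n * S n * exp (Z + 1)) / lam < gX"
    "\<forall>\<^sub>F n in at_right 0. 2 * g0 < c n * a n * exp (- Z)"
    "\<forall>\<^sub>F n in at_right 0. c n * a n * exp Z + 2 * lam * V0 + g0 < g1"
    "\<forall>\<^sub>F n in at_right 0. exp Z * (3 * a n * S n * (e + n * Z) + 3 * n * a n * S n + n) < Cs * lam"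
    "\<forall>\<^sub>F n in at_right 0. (1 + 1/(lam*c n)) * (lam * V0 * k3 * M) < 2 * real J * th"
    "\<forall>\<^sub>F n in at_right 0. 1 + 1/(lam*c n) < 2 * th * M"
    "\<forall>\<^sub>F n in at_right 0. lam * V0 + (lam * Q + b n) * V0 * k3 * M^2 < 2 * real J * th"
    "\<forall>\<^sub>F n in at_right 0. g1 - g0 + (1 + lam * V0 * (1 + 1/(lam*c n) * al/(1+al)) + gX) / M < th * (g1 - n * (2 + 2 * real J))"
    "\<forall>\<^sub>F n in at_right 0. n * (2 + 2 * real J) < g0"
    "\<forall>\<^sub>F n in at_right 0. 2 + b n / lam + d < (1 + 1/(lam*c n)) * U"
    "\<forall>\<^sub>F n in at_right 0. Q < c n * a n"
    "\<forall>\<^sub>F n in at_right 0. U < lam * P * (a n - U / c n)"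
    "\<forall>\<^sub>F n in at_right 0. a n * exp (1 - Z) * (c n + lam * P) < c n * a n - Q"
    "\<forall>\<^sub>F n in at_right 0. n * exp Z * (3 * a n * S n * Z + 1) < a n * S n * exp (- Z - 1) * e"
    "\<forall>\<^sub>F n in at_right 0. al * Sig + n * LR < eta * g0"
    "\<forall>\<^sub>F n in at_right 0. P * (a n + lam^2 * P * a n + lam * Q + b n) * (a n * exp Z * eta) < d * U"
    "\<forall>\<^sub>F n in at_right 0. (Q * (1 + lam * V0 + Q) + b n * V0) / (c n * a n - Q) + 2 + (1 + 1/(lam*c n)) * (lam * V0 + Q) + 1/(lam*c n) * al/(1+al) * ((1 + al) * Sig) + 1/(lam*c n) * (c n * a n * exp Z + lam * V0 + Q + al * Sig) < LR"
    "\<forall>\<^sub>F n in at_right 0. 1 < 1/(lam*c n)"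
    "\<forall>\<^sub>F n in at_right 0. Cs * gX < a n * S n * exp (- Z - 1) / lam * g0"
    "\<forall>\<^sub>F n in at_right 0. gX * ((1 + al) * Cs) < 2 * (g0 - 2 * n)"
    subgoal by (rule eventually_less_from_limits[OF _ _ strict(1)]) (intro tendsto_intros T N nz)+
    subgoal by (rule eventually_less_from_limits[OF _ _ strict(2)]) (intro tendsto_intros T N nz)+
    subgoal by (rule eventually_less_from_limits[OF _ _ strict(3)]) (intro tendsto_intros T N nz)+
    subgoal by (rule eventually_less_from_limits[OF _ _ strict(4)]) (intro tendsto_intros T N nz)+
    subgoal by (rule eventually_less_from_limits[OF _ _ strict(5)]) (intro tendsto_intros T N nz)+
    subgoal by (rule eventually_less_from_limits[OF _ _ strict(6)]) (intro tendsto_intros T N nz)+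
    subgoal by (rule eventually_less_from_limits[OF _ _ strict(7)]) (intro tendsto_intros T N nz)+
    subgoal by (rule eventually_less_from_limits[OF _ _ strict(8)]) (intro tendsto_intros T N nz)+
    subgoal by (rule eventually_less_from_limits[OF _ _ strict(9)]) (intro tendsto_intros T N nz)+
    subgoal by (rule eventually_less_from_limits[OF _ _ strict(10)]) (intro tendsto_intros T N nz)+
    subgoal by (rule eventually_less_from_limits[OF _ _ strict(11)]) (intro tendsto_intros T N nz)+
    subgoal by (rule eventually_less_from_limits[OF _ _ strict(12)]) (intro tendsto_intros T N nz)+
    subgoal by (rule eventually_less_from_limits[OF _ _ strict(13)]) (intro tendsto_intros T N nz)+
    subgoal by (rule eventually_less_from_limits[OF _ _ strict(14)]) (intro tendsto_intros T N nz)+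
    subgoal by (rule eventually_less_from_limits[OF _ _ strict(15)]) (intro tendsto_intros T N nz)+
    subgoal by (rule eventually_less_from_limits[OF _ _ strict(16)]) (intro tendsto_intros T N nz)+
    subgoal by (rule eventually_less_from_limits[OF _ _ strict(17)]) (intro tendsto_intros T N nz)+
    subgoal by (rule eventually_less_from_limits[OF _ _ strict(18)]) (intro tendsto_intros T N nz)+
    subgoal by (rule eventually_less_from_limits[OF _ _ strict(19)]) (intro tendsto_intros T N nz)+
    subgoal by (rule eventually_less_from_limits[OF _ _ strict(20)]) (intro tendsto_intros T N nz)+
    subgoal by (rule eventually_less_from_limits[OF _ _ strict(21)]) (intro tendsto_intros T N nz)+
    subgoal by (rule eventually_less_from_limits[OF _ _ strict(22)]) (intro tendsto_intros T N nz)+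
    subgoal by (rule eventually_less_from_limits[OF _ _ strict(23)]) (intro tendsto_intros T N nz)+
    subgoal by (rule eventually_less_from_limits[OF _ _ strict(24)]) (intro tendsto_intros T N nz)+
    subgoal by (rule eventually_less_from_limits[OF _ _ strict(25)]) (intro tendsto_intros T N nz)+
    done
  have np: "\<forall>\<^sub>F n::real in at_right 0. n > 0" by (simp add: eventually_at_right_less)
  have pp: "\<forall>\<^sub>F n in at_right 0. c n > 0" "\<forall>\<^sub>F n in at_right 0. a n > 0" "\<forall>\<^sub>F n in at_right 0. b n > 0" "\<forall>\<^sub>F n in at_right 0. S n > 0"
    using order_tendstoD(1)[OF T(1) pos0(3)] order_tendstoD(1)[OF T(2) pos0(4)] order_tendstoD(1)[OF T(3) pos0(5)] order_tendstoD(1)[OF T(4) pos0(6)] by auto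
  from np pp ev show ?thesis
  proof eventually_elim
    case (elim n)
    interpret slow_fast lam al n "c n" "a n" "b n" "S n" Q P Z e V0 gX g0 g1 k3 th M Cs J
      by (rule slow_fast.intro; (fact | (rule less_imp_le, fact)))
    have "slow_fast_trap lam al n (c n) (a n) (b n) (S n) Q P Z e V0 gX g0 g1 k3 th M Cs J U d Sig eta LR"
      by (unfold_locales; (fact | (rule less_imp_le, fact) | (unfold gam_def kap_def, rule less_imp_le, fact)))
    then interpret slow_fast_trap lam al n "c n" "a n" "b n" "S n" Q P Z e V0 gX g0 g1 k3 th M Cs J U d Sig eta LR .
    show ?case by (unfold_locales; (fact | (rule less_imp_le, fact)))
  qed
qed

section \<open>Return to the original variables\<close>

context slow_fast_limits
begin

text \<open>Undoes the logarithmic change of variables. Since \<open>exp (- 2 * t) * p t\<close>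
  tends to 1, the factor \<kappa> is 1, and what remains is to identify the scaled limits of
  \<open>\<xi>\<close> and \<open>\<zeta>\<close> with the components \<open>y1\<close> and
  \<open>z1\<close> of the eigenvector.\<close>

theorem heteroclinic_orbit_exists:
  fixes m :: real
  assumes cdef: "c = (al - m - n) / (lam * (1 + al))" and adef: "a = aa al m n lam"
    and bdef: "b = bb al m n lam" and Sdef: "S = s0 al m n lam" and Delta: "Delta1 al m n lam \<noteq> 0"
  shows "\<exists>p q r s :: real \<Rightarrow> real.
        (\<forall>t. (p has_real_derivative Fp al m n lam (p t) (q t) (r t) (s t)) (at t) \<and>
             (q has_real_derivative Fq al m n lam (p t) (q t) (r t) (s t)) (at t) \<and>
             (r has_real_derivative Fr al m n lam (p t) (q t) (r t) (s t)) (at t) \<and>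
             (s has_real_derivative Fs al m n lam (p t) (q t) (r t) (s t)) (at t)) \<and>
        (p \<longlongrightarrow> 0) at_bot \<and> (q \<longlongrightarrow> 0) at_bot \<and>
        (r \<longlongrightarrow> r0 al m n lam) at_bot \<and> (s \<longlongrightarrow> s0 al m n lam) at_bot \<and>
        (p \<longlongrightarrow> 0) at_top \<and> (q \<longlongrightarrow> 1) at_top \<and>
        (r \<longlongrightarrow> r1 al m n lam) at_top \<and> (s \<longlongrightarrow> s1 al m n lam) at_top \<and>
        (\<exists>\<kappa>. \<kappa> \<noteq> 0 \<and>
           ((\<lambda>t. exp (-2*t) * (p t - 0)) \<longlongrightarrow> \<kappa> * 1) at_bot \<and>
           ((\<lambda>t. exp (-2*t) * (q t - 0)) \<longlongrightarrow> \<kappa> * (bb al m n lam * r0 al m n lam)) at_bot \<and>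
           ((\<lambda>t. exp (-2*t) * (r t - r0 al m n lam)) \<longlongrightarrow> \<kappa> * y1 al m n lam) at_bot \<and>
           ((\<lambda>t. exp (-2*t) * (s t - s0 al m n lam)) \<longlongrightarrow> \<kappa> * z1 al m n lam) at_bot)"
proof (rule slow_fast_orbit_exists, goal_cases)
  case (1 \<psi> q \<xi> \<zeta> C)
  note orb = 1
  interpret orb: orbit lam al n c a b S Q P Z e V0 gX g0 g1 k3 th M Cs J U d Sig eta LR \<psi> q \<xi> \<zeta> C
    by unfold_locales (rule orb)+
  define A where "A = (1 + m + n) / (1 + al)"
  have al1: "1 + al > 0" using pos by simp
  have r0a: "r0 al m n lam = a" by (simp add: r0_def adef)
  have SA: "S = A - n / ((1 + al) * a)" by (simp add: Sdef s0_def r0a A_def)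
  have cA: "c * lam = 1 - A"
  proof -
    have "c * lam = (al - m - n) / (1 + al)" using pos unfolding cdef by simp
    also have "\<dots> = 1 - A" using al1 by (simp add: A_def field_simps)
    finally show ?thesis .
  qed
  define p where "p = (\<lambda>t. exp (2 * t + \<psi> t + kap * \<xi> t + gam * n * \<zeta> t))"
  define r where "r = (\<lambda>t. a * exp (\<zeta> t))"
  define s where "s = (\<lambda>t. S * exp (\<xi> t + n * \<zeta> t))"
  define u where "u = (\<lambda>t. lam * (p t * r t) + q t)"
  define \<sigma> where "\<sigma> = (\<lambda>t. sig (\<xi> t) (\<zeta> t))"
  have vl: "orb.vl t = p t * r t" for t
    by (simp add: orb.vl_def vel_def p_def r_def algebra_simps flip: exp_add)
  have rpos: "r t > 0" for t using pos by (simp add: r_def)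
  have sg: "\<sigma> t = r t * (s t - A) / lam + n / (lam * (1 + al))" for t
  proof -
    have "r t * (s t - A) = a * S * exp (\<zeta> t) * (exp (\<xi> t + n * \<zeta> t) - 1) - n / (1 + al) * exp (\<zeta> t)"
    proof -
      have "A = S + n / (1 + al) / a" using SA by simp
      then have "r t * (s t - A) = a * S * exp (\<zeta> t) * (exp (\<xi> t + n * \<zeta> t) - 1) - exp (\<zeta> t) * (a * (n / (1 + al) / a))"
        unfolding r_def s_def by (simp only:) (simp add: algebra_simps)
      also have "a * (n / (1 + al) / a) = n / (1 + al)" using pos by simp
      finally show ?thesis by simp
    qed
    moreover have "lam * \<sigma> t = a * S * exp (\<zeta> t) * (exp (\<xi> t + n * \<zeta> t) - 1) - n / (1 + al) * (exp (\<zeta> t) - 1)"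
      using pos by (simp add: \<sigma>_def sig_def)
    moreover have "n / (1 + al) * (exp (\<zeta> t) - 1) = n / (1 + al) * exp (\<zeta> t) - n / (1 + al)"
      by (simp only: right_diff_distrib mult_1_right)
    ultimately have "lam * \<sigma> t = r t * (s t - A) + n / (1 + al)" by linarith
    then have "\<sigma> t = (r t * (s t - A) + n / (1 + al)) / lam" using pos by (simp add: nonzero_eq_divide_eq mult.commute)
    then show ?thesis by (simp add: add_divide_distrib mult.commute)
  qed
  have pd: "(\<psi> has_real_derivative - ((1 + gam) * u t)) (at t)" for t
    using orb(1)[of t] vl[of t] by (simp add: orb.vl_def u_def)
  have xd: "(\<xi> has_real_derivative - ((1 + al) * \<sigma> t)) (at t)" for t
    using orb(3)[of t] by (simp add: \<sigma>_def)
  have zd: "(\<zeta> has_real_derivative (c * (r t - a) + u t + al * \<sigma> t) / n) (at t)" for t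
  proof -
    have *: "c * a * (exp (\<zeta> t) - 1) = c * (r t - a)" by (simp add: r_def algebra_simps)
    show ?thesis using orb(4)[of t, unfolded *] vl[of t] by (simp add: orb.vl_def u_def \<sigma>_def)
  qed
  have gl: "gam * c = 1 / lam" using pos by (simp add: gam_def)
  have k: "kap * (1 + al) = gam * al" using pos by (simp add: kap_def)
  have Dp: "(p has_real_derivative Fp al m n lam (p t) (q t) (r t) (s t)) (at t)" for t
  proof -
    have "(p has_real_derivative p t * (2 + - ((1 + gam) * u t) + kap * (- ((1 + al) * \<sigma> t)) + gam * n * ((c * (r t - a) + u t + al * \<sigma> t) / n))) (at t)"
      unfolding p_def by (rule derivative_eq_intros zd xd pd refl)+ simp
    moreover have "2 + - ((1 + gam) * u t) + kap * (- ((1 + al) * \<sigma> t)) + gam * n * ((c * (r t - a) + u t + al * \<sigma> t) / n)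
        = (1 / lam) * (r t - a) + 2 - lam * p t * r t - q t"
    proof -
      have "2 + - ((1 + gam) * u t) + kap * (- ((1 + al) * \<sigma> t)) + gam * n * ((c * (r t - a) + u t + al * \<sigma> t) / n)
         = 2 + - ((1 + gam) * u t) + kap * (- ((1 + al) * \<sigma> t)) + gam * (c * (r t - a) + u t + al * \<sigma> t)"
        using pos by simp
      also have "\<dots> = 2 - u t - (kap * (1 + al)) * \<sigma> t + gam * al * \<sigma> t + (gam * c) * (r t - a)"
        by (simp add: algebra_simps)
      also have "\<dots> = (1 / lam) * (r t - a) + 2 - lam * p t * r t - q t" unfolding k gl by (simp add: u_def)
      finally show ?thesis .
    qed
    ultimately show ?thesis unfolding Fp_def adef[symmetric] by (simp only:)
  qed
  have Dq: "(q has_real_derivative Fq al m n lam (p t) (q t) (r t) (s t)) (at t)" for t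
    using orb(2)[of t] vl[of t] by (simp add: orb.vl_def Fq_def bdef[symmetric] algebra_simps)
  have Dr: "(r has_real_derivative Fr al m n lam (p t) (q t) (r t) (s t)) (at t)" for t
  proof -
    have "(r has_real_derivative r t * ((c * (r t - a) + u t + al * \<sigma> t) / n)) (at t)"
      unfolding r_def by (rule derivative_eq_intros zd[unfolded r_def] refl)+ simp
    moreover have "r t * ((c * (r t - a) + u t + al * \<sigma> t) / n) = Fr al m n lam (p t) (q t) (r t) (s t)"
    proof -
      have "al * \<sigma> t = al / lam * r t * (s t - A) + n * al / (lam * (1 + al))"
        unfolding sg by (simp only: distrib_left times_divide_eq_right times_divide_eq_left mult.assoc mult.commute[of n al])
      then show ?thesis
        unfolding Fr_def adef[symmetric] A_def[symmetric] cdef[symmetric] by (simp only: u_def) (simp add: add.assoc)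
    qed
    ultimately show ?thesis by (simp only:)
  qed
  have Ds: "(s has_real_derivative Fs al m n lam (p t) (q t) (r t) (s t)) (at t)" for t
  proof -
    have "(s has_real_derivative s t * (- ((1 + al) * \<sigma> t) + n * ((c * (r t - a) + u t + al * \<sigma> t) / n))) (at t)"
      unfolding s_def by (rule derivative_eq_intros zd xd refl)+ simp
    moreover have "- ((1 + al) * \<sigma> t) + n * ((c * (r t - a) + u t + al * \<sigma> t) / n) = c * (r t - a) + u t - \<sigma> t"
    proof -
      have nx: "n * (x / n) = x" for x using pos by simp
      show ?thesis unfolding nx by (simp add: algebra_simps)
    qed
    moreover have "s t * (c * (r t - a) + u t - \<sigma> t) = Fs al m n lam (p t) (q t) (r t) (s t)"
      unfolding Fs_def adef[symmetric] A_def[symmetric] cdef[symmetric]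
      by (simp add: sg u_def algebra_simps add_divide_distrib diff_divide_distrib)
    ultimately show ?thesis by (simp only:)
  qed
  have pvr: "p = (\<lambda>t. orb.vl t / r t)" using rpos by (auto simp: vl less_imp_neq[symmetric] fun_eq_iff)
  have r_bot: "(r \<longlongrightarrow> r0 al m n lam) at_bot"
  proof -
    have "((\<lambda>t. a * exp (\<zeta> t)) \<longlongrightarrow> a * exp 0) at_bot" by (intro tendsto_intros orb.null_at_bot)
    then show ?thesis by (simp add: r_def r0a)
  qed
  have s_bot: "(s \<longlongrightarrow> s0 al m n lam) at_bot"
  proof -
    have "((\<lambda>t. S * exp (\<xi> t + n * \<zeta> t)) \<longlongrightarrow> S * exp (0 + n * 0)) at_bot" by (intro tendsto_intros orb.null_at_bot)
    then show ?thesis by (simp add: s_def Sdef)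
  qed
  have p_bot: "(p \<longlongrightarrow> 0) at_bot"
  proof -
    have "((\<lambda>t. orb.vl t / r t) \<longlongrightarrow> 0 / a) at_bot"
      by (intro tendsto_intros orb.vl_at_bot r_bot[unfolded r0a]) (use pos in auto)
    then show ?thesis unfolding pvr by simp
  qed
  have r_end: "a * exp orb.z_end = a - 1 / c"
  proof -
    have "c * (a * exp orb.z_end) = c * a - 1" using orb.z_end(2) by (simp add: algebra_simps)
    then have "a * exp orb.z_end = (c * a - 1) / c" using pos by (simp add: nonzero_eq_divide_eq mult.commute)
    then show ?thesis using pos by (simp add: diff_divide_distrib)
  qed
  have r1_eq: "r1 al m n lam = a * exp orb.z_end"
    unfolding r_end r1_def adef[symmetric] by (simp add: cdef mult.commute)
  have r_top: "(r \<longlongrightarrow> r1 al m n lam) at_top"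
    unfolding r1_eq r_def by (intro tendsto_intros orb.xi_zeta_at_top)
  have p_top: "(p \<longlongrightarrow> 0) at_top"
  proof -
    have "((\<lambda>t. orb.vl t / r t) \<longlongrightarrow> 0 / (a * exp orb.z_end)) at_top"
      by (intro tendsto_intros orb.vl_at_top r_top[unfolded r1_eq]) (use pos in auto)
    then show ?thesis unfolding pvr by simp
  qed
  \<comment> \<open>The equation \<open>sig x_end z_end = 0\<close> is affine in
    \<open>exp (x_end + n * z_end)\<close>; solving it gives the formula for \<open>s1\<close> with
    \<open>r1\<close> as denominator.\<close>
  have s1_eq: "s1 al m n lam = S * exp (orb.x_end + n * orb.z_end)"
  proof -
    define E where "E = exp (orb.x_end + n * orb.z_end)"
    define R where "R = a * exp orb.z_end"
    have R0: "R > 0" using pos by (simp add: R_def)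
    have "a * S * exp orb.z_end * (E - 1) - n / (1 + al) * (exp orb.z_end - 1) = 0"
      using orb.x_end(2) pos by (simp add: sig_def E_def)
    then have "R * (S * E) = R * S + n / (1 + al) * (R / a) - n / (1 + al)"
      using pos by (simp add: R_def algebra_simps)
    then have "S * E = (R * S + n / (1 + al) * (R / a) - n / (1 + al)) / R"
      using R0 by (simp add: nonzero_eq_divide_eq mult.commute)
    also have "\<dots> = S + n / (1 + al) / a - n / (1 + al) / R"
      using R0 by (simp add: add_divide_distrib diff_divide_distrib)
    also have "\<dots> = A - n / ((1 + al) * R)" using SA by simp
    finally show ?thesis unfolding s1_def r1_eq A_def[symmetric] by (simp add: E_def R_def)
  qed
  have s_top: "(s \<longlongrightarrow> s1 al m n lam) at_top"
    unfolding s1_eq s_def by (intro tendsto_intros orb.xi_zeta_at_top)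
  \<comment> \<open>\<open>y1\<close> and \<open>z1\<close> are Cramer's solution of the two linear
    equations \<open>ratio\<close> and \<open>level\<close> below, whose determinant is
    \<open>\<Delta>\<close> up to sign.\<close>
  define X where "X = (1 + al) / lam * a + 2 / S"
  define Y where "Y = n / a * (1 / lam + 2)"
  define B where "B = (lam + b) * a"
  define \<Delta> where "\<Delta> = Delta1 al m n lam"
  have \<Delta>: "\<Delta> = (1 - S) / lam * X - Y * (a / lam + 2 / S)"
    by (simp add: \<Delta>_def Delta1_def Let_def r0a X_def Y_def Sdef)
  have y1: "y1 al m n lam = - B * X / \<Delta>" and z1: "z1 al m n lam = - B * Y / \<Delta>"
  proof -
    have "y1 al m n lam = - (lam + b) * a * (X / \<Delta>)" "z1 al m n lam = - (lam + b) * a * (Y / \<Delta>)"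
      unfolding y1_def z1_def Let_def r0a Sdef[symmetric] bdef[symmetric] X_def Y_def \<Delta>_def by (rule refl)+
    then show "y1 al m n lam = - B * X / \<Delta>" "z1 al m n lam = - B * Y / \<Delta>"
      by (simp_all only: B_def mult_minus_left times_divide_eq_right)
  qed
  define y where "y = y1 al m n lam"
  define z where "z = z1 al m n lam"
  \<comment> \<open>The eigenvector in logarithmic variables: linearising
    \<open>r = a * exp \<zeta>\<close> gives \<open>y / a\<close>, and linearising
    \<open>s = S * exp (\<xi> + n * \<zeta>)\<close> gives
    \<open>z / S = xs + n * zs\<close>.\<close>
  define zs where "zs = y / a"
  define xs where "xs = z / S - n * zs"
  define \<tau> where "\<tau> = orb.lin xs zs"
  have \<tau>: "\<tau> = (a * z - n / (1 + al) * (y / a)) / lam"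
    using pos by (simp add: \<tau>_def orb.lin_def xs_def zs_def)
  have ratio: "y * Y = z * X" by (simp add: y_def z_def y1 z1)
  have level: "z * (a / lam + 2 / S) - y * ((1 - S) / lam) = B"
  proof -
    have "z * (a / lam + 2 / S) - y * ((1 - S) / lam) = B * ((1 - S) / lam * X - Y * (a / lam + 2 / S)) / \<Delta>"
    proof -
      have "- B * Y / \<Delta> * w - - B * X / \<Delta> * v = B * (v * X - Y * w) / \<Delta>" for v w
        by (simp add: diff_divide_distrib algebra_simps)
      then show ?thesis unfolding y_def z_def y1 z1 .
    qed
    also have "\<dots> = B" using Delta unfolding \<Delta>[symmetric] by (simp add: \<Delta>_def)
    finally show ?thesis .
  qed
  have \<tau>2: "(1 + al) * \<tau> = (1 + al) * a * z / lam - n * (y / a) / lam"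
    unfolding \<tau> using al1 by (simp add: right_diff_distrib diff_divide_distrib)
  \<comment> \<open>\<open>ratio\<close> is the \<open>\<xi>\<close> row of the eigenvalue equation,
    \<open>level\<close> the \<open>s\<close> row stated as \<open>ii\<close>; the sum of
    \<open>i\<close> and \<open>ii\<close> is the \<open>\<zeta>\<close> row.\<close>
  have i: "2 * n * zs - 2 * (z / S) = (1 + al) * \<tau>"
  proof -
    have "n * (y / a) / lam + 2 * n * (y / a) = y * Y" by (simp add: Y_def algebra_simps)
    also have "\<dots> = (1 + al) * a * z / lam + 2 * (z / S)" unfolding ratio by (simp add: X_def algebra_simps)
    finally show ?thesis unfolding \<tau>2 zs_def by linarith
  qed
  have ii: "2 * (z / S) = c * y + B - \<tau>"
  proof -
    have "(1 - S) / lam = c + n / (1 + al) / a / lam"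
    proof -
      have "1 - S = c * lam + n / (1 + al) / a" using SA cA by simp
      then show ?thesis using pos by (simp add: add_divide_distrib)
    qed
    then have "z * (a / lam + 2 / S) - y * (c + n / (1 + al) / a / lam) = B" using level by simp
    moreover have "\<tau> = z * (a / lam) - y * (n / (1 + al) / a / lam)" unfolding \<tau> by (simp add: diff_divide_distrib mult.commute)
    ultimately show ?thesis by (simp add: algebra_simps)
  qed
  have xs_eq: "2 * xs = - ((1 + al) * orb.lin xs zs)"
    using i unfolding \<tau>_def[symmetric] by (simp add: xs_def)
  have zs_eq: "2 * n * zs = c * a * zs + (lam * a + b * a) + al * orb.lin xs zs"
  proof -
    have "c * a * zs = c * y" using pos by (simp add: zs_def)
    moreover have "lam * a + b * a = B" by (simp add: B_def algebra_simps)
    moreover have "(1 + al) * \<tau> = \<tau> + al * \<tau>" by (simp add: algebra_simps)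
    ultimately show ?thesis using i ii unfolding \<tau>_def[symmetric] by linarith
  qed
  note sc = orb.scaled_xi_zeta[OF xs_eq zs_eq]
  define E where "E = (\<lambda>t::real. exp (- 2 * t))"
  have scE: "((\<lambda>t. E t * \<xi> t) \<longlongrightarrow> xs) at_bot" "((\<lambda>t. E t * \<zeta> t) \<longlongrightarrow> zs) at_bot" using sc unfolding E_def .
  have expand: "((\<lambda>t. E t * (exp (h t) - 1)) \<longlongrightarrow> l) at_bot"
    if h0: "(h \<longlongrightarrow> 0) at_bot" and hl: "((\<lambda>t. E t * h t) \<longlongrightarrow> l) at_bot" for h l
  proof -
    have "\<forall>\<^sub>F t in at_bot. dist (E t * h t) l < 1" using hl by (rule tendstoD) simp
    then have "\<forall>\<^sub>F t in at_bot. \<bar>E t * h t\<bar> \<le> \<bar>l\<bar> + 1" by eventually_elim (simp add: dist_real_def)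
    from tendsto_add[OF scaled_exp_expansion[OF h0 this] hl] show ?thesis by simp
  qed
  have p_sc: "((\<lambda>t. exp (-2*t) * (p t - 0)) \<longlongrightarrow> 1 * 1) at_bot"
  proof -
    have e: "exp (-2*t) * (p t - 0) = exp (\<psi> t + kap * \<xi> t + gam * n * \<zeta> t)" for t
      by (simp add: p_def flip: exp_add)
    have "((\<lambda>t. exp (\<psi> t + kap * \<xi> t + gam * n * \<zeta> t)) \<longlongrightarrow> exp (0 + kap * 0 + gam * n * 0)) at_bot"
      by (intro tendsto_intros orb.null_at_bot)
    then show ?thesis unfolding e by simp
  qed
  have q_sc: "((\<lambda>t. exp (-2*t) * (q t - 0)) \<longlongrightarrow> 1 * (bb al m n lam * r0 al m n lam)) at_bot"
    using orb.scaled_q by (simp add: r0a bdef)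
  have r_sc: "((\<lambda>t. exp (-2*t) * (r t - r0 al m n lam)) \<longlongrightarrow> 1 * y1 al m n lam) at_bot"
  proof -
    have "((\<lambda>t. a * (E t * (exp (\<zeta> t) - 1))) \<longlongrightarrow> a * zs) at_bot"
      by (intro tendsto_intros expand orb.null_at_bot scE)
    moreover have "a * (E t * (exp (\<zeta> t) - 1)) = exp (-2*t) * (r t - r0 al m n lam)" for t
      by (simp add: E_def r_def r0a algebra_simps)
    moreover have "a * zs = 1 * y1 al m n lam" using pos by (simp add: zs_def y_def)
    ultimately show ?thesis by (simp only:)
  qed
  have s_sc: "((\<lambda>t. exp (-2*t) * (s t - s0 al m n lam)) \<longlongrightarrow> 1 * z1 al m n lam) at_bot"
  proof -
    have h0: "((\<lambda>t. \<xi> t + n * \<zeta> t) \<longlongrightarrow> 0) at_bot"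
      using tendsto_add[OF orb.null_at_bot(3) tendsto_mult_right_zero[OF orb.null_at_bot(4), of n]] by simp
    have "((\<lambda>t. E t * \<xi> t + n * (E t * \<zeta> t)) \<longlongrightarrow> xs + n * zs) at_bot" by (intro tendsto_intros scE)
    then have hl: "((\<lambda>t. E t * (\<xi> t + n * \<zeta> t)) \<longlongrightarrow> xs + n * zs) at_bot" by (simp add: algebra_simps)
    have "((\<lambda>t. S * (E t * (exp (\<xi> t + n * \<zeta> t) - 1))) \<longlongrightarrow> S * (xs + n * zs)) at_bot"
      by (intro tendsto_mult tendsto_const expand[OF h0 hl])
    moreover have "S * (E t * (exp (\<xi> t + n * \<zeta> t) - 1)) = exp (-2*t) * (s t - s0 al m n lam)" for t
      unfolding Sdef[symmetric] by (simp add: E_def s_def algebra_simps)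
    moreover have "S * (xs + n * zs) = 1 * z1 al m n lam" using pos by (simp add: xs_def z_def)
    ultimately show ?thesis by (simp only:)
  qed
  have "\<exists>\<kappa>. \<kappa> \<noteq> 0 \<and>
           ((\<lambda>t. exp (-2*t) * (p t - 0)) \<longlongrightarrow> \<kappa> * 1) at_bot \<and>
           ((\<lambda>t. exp (-2*t) * (q t - 0)) \<longlongrightarrow> \<kappa> * (bb al m n lam * r0 al m n lam)) at_bot \<and>
           ((\<lambda>t. exp (-2*t) * (r t - r0 al m n lam)) \<longlongrightarrow> \<kappa> * y1 al m n lam) at_bot \<and>
           ((\<lambda>t. exp (-2*t) * (s t - s0 al m n lam)) \<longlongrightarrow> \<kappa> * z1 al m n lam) at_bot"
    using p_sc q_sc r_sc s_sc by (intro exI[of _ 1] conjI) simp_all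
  then show ?thesis
    using Dp Dq Dr Ds p_bot orb.null_at_bot(2) r_bot s_bot p_top orb.q_at_top r_top s_top by blast
qed

end

text \<open>The order of choice matters: the box \<open>U\<close>, \<open>Q\<close>,
  \<open>P\<close>, \<open>Z\<close>, then the slopes, the factor \<open>th\<close>, the scale
  \<open>M\<close>, the exponent \<open>J\<close>, the tolerances \<open>eta\<close> and
  \<open>Sig\<close>, and at last \<open>Cs\<close> and \<open>e\<close>. The bounds for the slopes
  use \<open>e + n * Z \<le> 1\<close> only, so nothing chosen earlier depends on
  \<open>e\<close>.\<close>

lemma slow_fast_constants_exist:
  fixes c a b S :: "real \<Rightarrow> real"
  assumes T: "(c \<longlongrightarrow> c0) (at_right 0)" "(a \<longlongrightarrow> a0) (at_right 0)" "(b \<longlongrightarrow> b0) (at_right 0)" "(S \<longlongrightarrow> S0) (at_right 0)"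
    and pos0: "lam > 0" "al > 0" "c0 > 0" "a0 > 0" "b0 > 0" "S0 > 0"
    and ca: "1 < c0 * a0" and tr: "2 + b0 / lam < (1 + 1/(lam*c0)) * (c0 * a0)" and gam: "1 < 1/(lam*c0)"
  obtains U d Q P Z e V0 gX g0 g1 k3 th M Cs Sig eta LR :: real and J where
    "\<forall>\<^sub>F n in at_right 0. slow_fast_limits lam al n (c n) (a n) (b n) (S n) Q P Z e V0 gX g0 g1 k3 th M Cs J U d Sig eta LR"
proof -
  define G where "G = 1 + 1/(lam*c0)"
  have G0: "G > 0" using gam by (simp add: G_def)
  have "(2 + b0 / lam) / G < c0 * a0" using tr G0 by (simp add: G_def pos_divide_less_eq mult.commute)
  then have "max 1 ((2 + b0 / lam) / G) < c0 * a0" using ca by simp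
  \<comment> \<open>Above the maximum both brackets of the trapping estimate are negative; below
    \<open>c0 * a0\<close> the slow manifold has positive \<open>r\<close>.\<close>
  then obtain U where U: "max 1 ((2 + b0 / lam) / G) < U" "U < c0 * a0" using dense by blast
  then have U1: "1 < U" and "(2 + b0 / lam) / G < U" by auto
  then have U2: "2 + b0 / lam < G * U" using G0 by (simp add: pos_divide_less_eq mult.commute)
  define d where "d = min (U - 1) (G * U - (2 + b0 / lam)) / 2"
  have d_le: "d > 0" "d \<le> (U - 1) / 2" "d \<le> (G * U - (2 + b0 / lam)) / 2" using U1 U2 by (simp_all add: d_def)
  have "1 + d \<le> U" using d_le U1 by argo
  moreover have "2 + b0 / lam + d < G * U" using d_le U2 by argo
  ultimately have d: "d > 0" "1 + d \<le> U" "2 + b0 / lam + d < G * U" using d_le by auto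
  obtain Q where Q: "U < Q" "Q < c0 * a0" using U dense by blast
  \<comment> \<open>\<open>w\<close> bounds \<open>rho\<close> from below as long as
    \<open>u \<le> U\<close>; the second summand of \<open>P\<close> makes
    \<open>lam * P * w\<close> exceed \<open>U\<close>.\<close>
  define w where "w = a0 - U / c0"
  have w0: "w > 0" using U pos0 by (simp add: w_def pos_divide_less_eq mult.commute)
  define P where "P = exp 1 + U / (lam * w)"
  have P1: "exp 1 \<le> P" using U1 w0 pos0 by (simp add: P_def)
  have P0: "P > 0" using P1 by (smt (verit) exp_gt_zero)
  have P2: "U < lam * P * w"
  proof -
    have "lam * P * w = lam * w * exp 1 + U" using w0 pos0 by (simp add: P_def field_simps)
    then show ?thesis using w0 pos0 by simp
  qed
  define \<delta> where "\<delta> = c0 * a0 - Q"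
  have \<delta>0: "\<delta> > 0" using Q by (simp add: \<delta>_def)
  define L where "L = a0 * (c0 + lam * P)"
  have L0: "L > 0" using pos0 P0 by (simp add: L_def add_pos_pos)
  \<comment> \<open>The inequality \<open>x < exp x\<close> at \<open>x = L / \<delta>\<close> then
    gives \<open>L * exp (1 - Z) < \<delta>\<close>.\<close>
  define Z where "Z = 1 + L / \<delta>"
  have Z1: "Z \<ge> 1" using L0 \<delta>0 by (simp add: Z_def)
  have Z2: "a0 * exp (1 - Z) * (c0 + lam * P) < c0 * a0 - Q"
  proof -
    have "L / \<delta> < exp (L / \<delta>)" using exp_ge_add_one_self[of "L / \<delta>"] by linarith
    then have "L < exp (L / \<delta>) * \<delta>" using \<delta>0 by (simp add: pos_divide_less_eq)
    then have "L * exp (- (L / \<delta>)) < exp (L / \<delta>) * \<delta> * exp (- (L / \<delta>))" by (intro mult_strict_right_mono) auto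
    also have "\<dots> = \<delta>" by (simp add: exp_minus)
    finally show ?thesis by (simp add: L_def Z_def \<delta>_def mult_ac)
  qed
  define V0 where "V0 = 2 * a0 * exp Z * P + 1"
  have V0: "V0 > 0" using pos0 P0 by (simp add: V0_def add_pos_pos)
  define gX where "gX = (1+al) * (a0 * S0 * exp (Z + 1)) / lam + 1"
  have gX: "gX > 0" using pos0 by (simp add: gX_def add_nonneg_pos)
  define g0 where "g0 = c0 * a0 * exp (- Z) / 4"
  have g0: "g0 > 0" using pos0 by (simp add: g0_def)
  define g1 where "g1 = c0 * a0 * exp Z + 2 * lam * V0 + g0 + 1"
  have g1: "g1 > 0" using pos0 V0 g0 by (auto simp: g1_def intro!: add_pos_pos)
  define k3 where "k3 = 1/(lam*c0) * al/(1+al) + 4"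
  have k3: "k3 > 0" using pos0 by (simp add: k3_def add_nonneg_pos)
  \<comment> \<open>The three ratios serve the rows of \<open>Que\<close>, \<open>Xi\<close> and
    \<open>Zeta\<close>. In the second the added 1 pays for the coupling through
    \<open>Cs * M\<close>; in the third half of the gain \<open>g0\<close> is kept for the couplings
    divided by \<open>M\<close>.\<close>
  define th where "th = max ((2 * Q + 1) / (2 * Q + 2)) (max ((gX + 1) / (gX + 2)) (1 - g0 / (2 * g1)))"
  have Q0: "Q > 0" using Q U1 by simp
  have th0: "0 < th" using Q0 by (simp add: th_def less_max_iff_disj)
  have th1: "th < 1" using Q0 gX g0 g1 by (simp add: th_def)
  have thQ: "2 * Q + 1 \<le> th * (2 * Q + 2)"
    using Q0 by (subst pos_divide_le_eq[symmetric]) (auto simp: th_def)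
  have thX: "gX + 1 \<le> th * (gX + 2)"
    using gX by (subst pos_divide_le_eq[symmetric]) (auto simp: th_def)
  have thg: "g1 - g0 / 2 \<le> th * g1"
  proof -
    have "(1 - g0 / (2 * g1)) * g1 \<le> th * g1" using g1 by (intro mult_right_mono) (auto simp: th_def)
    moreover have "(1 - g0 / (2 * g1)) * g1 = g1 - g0 / 2" using g1 by (simp add: field_simps)
    ultimately show ?thesis by simp
  qed
  define K where "K = 1 + lam * V0 * (1 + 1/(lam*c0) * al/(1+al)) + gX"
  have K0: "K > 0" using pos0 V0 gX unfolding K_def by (intro add_pos_pos mult_pos_pos add_pos_nonneg) auto
  \<comment> \<open>\<open>G / th\<close> serves the \<open>Psi\<close> row, and
    \<open>4 * K / g0\<close> makes the couplings of the \<open>Zeta\<close> row smaller than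
    \<open>g0 / 4\<close>.\<close>
  define M where "M = 1 + G / th + 4 * K / g0"
  have Mp: "G / th > 0" "4 * K / g0 > 0" using G0 th0 K0 g0 by auto
  have M1: "M \<ge> 1" using Mp by (simp add: M_def)
  have MG: "G < 2 * th * M"
  proof -
    have "G = th * (G / th)" using th0 by simp
    also have "\<dots> < th * M" using Mp th0 by (intro mult_strict_left_mono) (auto simp: M_def)
    also have "\<dots> \<le> 2 * th * M" using th0 M1 by simp
    finally show ?thesis .
  qed
  have MK: "K / M < g0 / 4"
  proof -
    have "4 * K / g0 < M" using Mp by (simp add: M_def)
    then have "4 * K < M * g0" using g0 by (simp add: pos_divide_less_eq)
    then show ?thesis using M1 by (simp add: pos_divide_less_eq mult.commute)
  qed
  have row: "g1 - g0 + K / M < th * (g1 - 0 * (2 + 2 * real J))" for J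
    unfolding mult_zero_left diff_0_right using MK thg g0 by linarith
  define X1 where "X1 = G * (lam * V0 * k3 * M)"
  define X2 where "X2 = lam * V0 + (lam * Q + b0) * V0 * k3 * M^2"
  have X0: "X1 > 0" "X2 > 0"
    unfolding X1_def X2_def using G0 pos0 V0 k3 M1 Q0 by (auto intro!: add_pos_pos mult_pos_pos)
  obtain J :: nat where "(X1 + X2) / (2 * th) < real J" using reals_Archimedean2 by blast
  then have "X1 + X2 < 2 * real J * th" using th0 by (simp add: pos_divide_less_eq mult_ac)
  then have J: "X1 < 2 * real J * th" "X2 < 2 * real J * th" using X0 by linarith+
  define E where "E = P * (a0 + lam^2 * P * a0 + lam * Q + b0) * (a0 * exp Z)"
  have E0: "E > 0" unfolding E_def using pos0 P0 Q0 by (auto intro!: mult_pos_pos add_pos_pos)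
  define eta where "eta = min 1 (d * U / (2 * E))"
  have dU: "d * U > 0" using d U1 by simp
  have eta0: "eta > 0" "eta \<le> 1" using dU E0 by (auto simp: eta_def)
  have etaE: "E * eta < d * U"
  proof -
    have "E * eta \<le> E * (d * U / (2 * E))" using E0 by (intro mult_left_mono) (auto simp: eta_def)
    also have "\<dots> = d * U / 2" using E0 by simp
    finally show ?thesis using dU by linarith
  qed
  define Sig where "Sig = eta * g0 / (2 * al)"
  have Sig0: "Sig > 0" using eta0 g0 pos0 by (simp add: Sig_def)
  have Sig1: "al * Sig < eta * g0" using eta0 g0 pos0 by (simp add: Sig_def)
  define gm where "gm = a0 * S0 * exp (- Z - 1) / lam"
  have gm0: "gm > 0" using pos0 by (simp add: gm_def)
  \<comment> \<open>In this order: the slope of the fast equation, the \<open>Xi\<close> row, the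
    gain at \<open>M1\<close>, the gain at \<open>M0\<close>, and one half of
    \<open>Sig\<close>.\<close>
  define Cs where "Cs = Min {g0 / al, 1 / ((1 + al) * M), gm * g0 / (2 * gX), g0 / (gX * (1 + al)), Sig / (2 * Z)}"
  have Cs_le: "Cs \<le> g0 / al" "Cs \<le> 1 / ((1 + al) * M)" "Cs \<le> gm * g0 / (2 * gX)" "Cs \<le> g0 / (gX * (1 + al))" "Cs \<le> Sig / (2 * Z)"
    unfolding Cs_def by (intro Min_le; simp)+
  have Cs0: "Cs > 0" unfolding Cs_def using g0 pos0 M1 gm0 gX Sig0 Z1 by auto
  have Cs1: "al * Cs \<le> g0" using Cs_le(1) pos0 by (simp add: pos_le_divide_eq mult.commute)
  have Cs2: "(1 + al) * Cs * M \<le> 1"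
  proof -
    have "0 < (1 + al) * M" using pos0 M1 by simp
    then show ?thesis using Cs_le(2) by (simp add: pos_le_divide_eq mult_ac)
  qed
  have Cs3: "Cs * gX < gm * g0"
  proof -
    have "Cs * (2 * gX) \<le> gm * g0" using Cs_le(3) gX by (simp add: pos_le_divide_eq)
    moreover have "0 < Cs * gX" using Cs0 gX by simp
    ultimately show ?thesis by linarith
  qed
  have Cs4: "gX * ((1 + al) * Cs) < 2 * g0"
  proof -
    have "0 < gX * (1 + al)" using gX pos0 by simp
    then have "Cs * (gX * (1 + al)) \<le> g0" using Cs_le(4) by (simp add: pos_le_divide_eq)
    then show ?thesis using g0 by (simp add: mult_ac)
  qed
  have Cs5: "Cs * Z \<le> Sig / 2"
  proof -
    have "Cs * (2 * Z) \<le> Sig" using Cs_le(5) Z1 by (simp add: pos_le_divide_eq)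
    then show ?thesis by simp
  qed
  define kp where "kp = 1/(lam*c0) * al/(1+al)"
  have kp0: "kp > 0" using pos0 by (simp add: kp_def)
  \<comment> \<open>The entries bound the exponent \<open>x + n * z\<close>, the exponent of
    \<open>p\<close>, the leading part of the condition on \<open>Cs\<close>, and the second half of
    \<open>Sig\<close>.\<close>
  define e where "e = Min {1/2, 1 / (2 * kp), Cs * lam / (2 * (exp Z * (3 * a0 * S0))), Sig / (2 * gX)}"
  have e_le: "e \<le> 1/2" "e \<le> 1 / (2 * kp)" "e \<le> Cs * lam / (2 * (exp Z * (3 * a0 * S0)))" "e \<le> Sig / (2 * gX)"
    unfolding e_def by (intro Min_le; simp)+
  have e0: "e > 0" unfolding e_def using kp0 Cs0 pos0 Sig0 gX by auto
  have e2: "kp * e < 1" using e_le(2) kp0 by (simp add: pos_le_divide_eq mult_ac)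
  have e3: "exp Z * (3 * a0 * S0 * e) < Cs * lam"
  proof -
    have p: "0 < exp Z * (3 * a0 * S0)" using pos0 by simp
    then have "e * (2 * (exp Z * (3 * a0 * S0))) \<le> Cs * lam" using e_le(3) by (simp add: pos_le_divide_eq)
    moreover have "0 < e * (exp Z * (3 * a0 * S0))" using e0 p by (rule mult_pos_pos)
    ultimately have "e * (exp Z * (3 * a0 * S0)) < Cs * lam" by linarith
    then show ?thesis by (simp add: mult_ac)
  qed
  have e4: "gX * e \<le> Sig / 2" using e_le(4) gX by (simp add: pos_le_divide_eq mult_ac)
  define LR where "LR = (Q * (1 + lam * V0 + Q) + b0 * V0) / (c0 * a0 - Q) + 2 + (1 + 1/(lam*c0)) * (lam * V0 + Q) + 1/(lam*c0) * al/(1+al) * ((1 + al) * Sig) + 1/(lam*c0) * (c0 * a0 * exp Z + lam * V0 + Q + al * Sig) + 1"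
  show ?thesis
  proof (rule that, rule slow_fast_limits_eventually[OF T pos0])
    show "d > 0" "Q > 0" "Z > 0" "e > 0" "gX > 0" "g0 > 0" "M \<ge> 1" "P \<ge> exp 1" "0 \<le> th" "th < 1"
      using d Q0 Z1 e0 gX g0 M1 P1 th0 th1 by auto
    show "al * Cs \<le> g0" "2 * Q + 1 \<le> th * (2 * Q + 2)" "Z \<ge> 1" "1 + d \<le> U" "U < Q" "eta \<le> 1"
      by (fact Cs1 thQ Z1 d(2) Q(1) eta0(2))+
    show "gX + (1 + al) * Cs * M \<le> th * (gX + 2)" using Cs2 thX by linarith
    show "Cs * Z + gX * e \<le> Sig" using Cs5 e4 by linarith
    show "e + 0 * Z < 1" using e_le(1) by simp
    show "1/(lam*c0) * 0 < 1" by simp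
    show "1/(lam*c0) * al/(1+al) * e + 1/(lam*c0) * 0 * Z < 1" using e2 by (simp add: kp_def)
    show "1/(lam*c0) * al/(1+al) + 3 < k3" by (simp add: k3_def)
    show "2 * a0 * exp Z * P < V0" by (simp add: V0_def)
    show "(1+al) * (a0 * S0 * exp (Z + 1)) / lam < gX" by (simp add: gX_def)
    have "0 < c0 * a0 * exp (- Z)" using pos0 by simp
    then show "2 * g0 < c0 * a0 * exp (- Z)" unfolding g0_def by linarith
    show "c0 * a0 * exp Z + 2 * lam * V0 + g0 < g1" by (simp add: g1_def)
    show "exp Z * (3 * a0 * S0 * (e + 0 * Z) + 3 * 0 * a0 * S0 + 0) < Cs * lam" using e3 by simp
    show "(1 + 1/(lam*c0)) * (lam * V0 * k3 * M) < 2 * real J * th" using J(1) unfolding X1_def G_def .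
    show "1 + 1/(lam*c0) < 2 * th * M" using MG unfolding G_def .
    show "lam * V0 + (lam * Q + b0) * V0 * k3 * M^2 < 2 * real J * th" using J(2) unfolding X2_def .
    show "g1 - g0 + (1 + lam * V0 * (1 + 1/(lam*c0) * al/(1+al)) + gX) / M < th * (g1 - 0 * (2 + 2 * real J))"
      using row unfolding K_def .
    show "0 * (2 + 2 * real J) < g0" using g0 by simp
    show "2 + b0 / lam + d < (1 + 1/(lam*c0)) * U" using d(3) unfolding G_def .
    show "Q < c0 * a0" by (rule Q)
    show "U < lam * P * (a0 - U / c0)" using P2 unfolding w_def .
    show "a0 * exp (1 - Z) * (c0 + lam * P) < c0 * a0 - Q" by (rule Z2)
    show "0 * exp Z * (3 * a0 * S0 * Z + 1) < a0 * S0 * exp (- Z - 1) * e" using pos0 e0 by simp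
    show "al * Sig + 0 * LR < eta * g0" using Sig1 by simp
    show "P * (a0 + lam^2 * P * a0 + lam * Q + b0) * (a0 * exp Z * eta) < d * U"
      using etaE unfolding E_def by (simp only: mult.assoc)
    show "(Q * (1 + lam * V0 + Q) + b0 * V0) / (c0 * a0 - Q) + 2 + (1 + 1/(lam*c0)) * (lam * V0 + Q) + 1/(lam*c0) * al/(1+al) * ((1 + al) * Sig) + 1/(lam*c0) * (c0 * a0 * exp Z + lam * V0 + Q + al * Sig) < LR"
      unfolding LR_def by simp
    show "1 < 1/(lam*c0)" by (rule gam)
    show "Cs * gX < a0 * S0 * exp (- Z - 1) / lam * g0" using Cs3 unfolding gm_def .
    show "gX * ((1 + al) * Cs) < 2 * (g0 - 2 * 0)" using Cs4 by simp
  qed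
qed

lemma eventually_at_right_0_D:
  "eventually P (at_right (0::real)) \<Longrightarrow> \<exists>n0>0. \<forall>n. 0 < n \<and> n < n0 \<longrightarrow> P n"
  by (auto simp: eventually_at_right_field)

theorem theorem1:
  fixes al m lam :: real
  assumes "al > 0" and "m > -1" and "al > m"
    and "0 < lam" and "lam < 2*(al - m)/(1 + m)"
  shows "\<exists>n0 > 0. \<forall>n. 0 < n \<and> n < n0 \<longrightarrow>
     - al + m + n < 0 \<and>
     0 < lam \<and> lam < 2*(al - m - n)*(1 + m) / (1 + m + n)^2 \<and>
     (\<exists>p q r s :: real \<Rightarrow> real.
        (\<forall>t. (p has_real_derivative Fp al m n lam (p t) (q t) (r t) (s t)) (at t) \<and>
             (q has_real_derivative Fq al m n lam (p t) (q t) (r t) (s t)) (at t) \<and>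
             (r has_real_derivative Fr al m n lam (p t) (q t) (r t) (s t)) (at t) \<and>
             (s has_real_derivative Fs al m n lam (p t) (q t) (r t) (s t)) (at t)) \<and>
        (p \<longlongrightarrow> 0) at_bot \<and> (q \<longlongrightarrow> 0) at_bot \<and>
        (r \<longlongrightarrow> r0 al m n lam) at_bot \<and> (s \<longlongrightarrow> s0 al m n lam) at_bot \<and>
        (p \<longlongrightarrow> 0) at_top \<and> (q \<longlongrightarrow> 1) at_top \<and>
        (r \<longlongrightarrow> r1 al m n lam) at_top \<and> (s \<longlongrightarrow> s1 al m n lam) at_top \<and>
        (\<exists>\<kappa>. \<kappa> \<noteq> 0 \<and>
           ((\<lambda>t. exp (-2*t) * (p t - 0)) \<longlongrightarrow> \<kappa> * 1) at_bot \<and>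
           ((\<lambda>t. exp (-2*t) * (q t - 0)) \<longlongrightarrow> \<kappa> * (bb al m n lam * r0 al m n lam)) at_bot \<and>
           ((\<lambda>t. exp (-2*t) * (r t - r0 al m n lam)) \<longlongrightarrow> \<kappa> * y1 al m n lam) at_bot \<and>
           ((\<lambda>t. exp (-2*t) * (s t - s0 al m n lam)) \<longlongrightarrow> \<kappa> * z1 al m n lam) at_bot))"
proof -
  define c where "c = (\<lambda>n. (al - m - n) / (lam * (1 + al)))"
  define a where "a = (\<lambda>n. aa al m n lam)"
  define b where "b = (\<lambda>n. bb al m n lam)"
  define S where "S = (\<lambda>n. s0 al m n lam)"
  define D where "D = 1 + 2 * al - m"
  have D0: "D > 0" using assms by (simp add: D_def)
  have al1: "1 + al > 0" using assms by simp
  have m1: "1 + m > 0" using assms by simp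
  have gap: "lam * (1 + m) < 2 * (al - m)" using assms m1 by (simp add: pos_less_divide_eq)
  have a_0: "a 0 = 2 * (1 + al) * (1 + lam) / D"
    by (simp add: a_def aa_def DD_def D_def add_divide_distrib algebra_simps)
  have b_0: "b 0 = (1 + m) * (1 + lam) / D"
    by (simp add: b_def bb_def DD_def D_def add_divide_distrib algebra_simps)
  have S_0: "S 0 = (1 + m) / (1 + al)" by (simp add: S_def s0_def)
  have c_0: "c 0 = (al - m) / (lam * (1 + al))" by (simp add: c_def)
  have pos0: "c 0 > 0" "a 0 > 0" "b 0 > 0" "S 0 > 0"
    using assms D0 al1 m1 by (simp_all add: a_0 b_0 S_0 c_0)
  have N: "((\<lambda>n::real. n) \<longlongrightarrow> 0) (at_right 0)" by (rule tendsto_ident_at)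
  have nz: "1 + 2 * al - m - 0 \<noteq> 0" "(1 + al) * a 0 \<noteq> 0" "lam * (1 + al) \<noteq> 0" "1 + al \<noteq> 0" "lam \<noteq> 0" "a 0 \<noteq> 0" "S 0 \<noteq> 0"
    using D0 al1 pos0 assms by (auto simp: D_def)
  have cT: "(c \<longlongrightarrow> c 0) (at_right 0)" unfolding c_def by (intro tendsto_intros N nz)
  have aT: "(a \<longlongrightarrow> a 0) (at_right 0)" unfolding a_def aa_def DD_def by (intro tendsto_intros N nz)
  have bT: "(b \<longlongrightarrow> b 0) (at_right 0)" unfolding b_def bb_def DD_def by (intro tendsto_intros N nz)
  have ST: "(S \<longlongrightarrow> S 0) (at_right 0)"
  proof -
    have e: "S = (\<lambda>n. (1 + m + n) / (1 + al) - n / ((1 + al) * a n))" by (simp add: S_def s0_def r0_def a_def)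
    show ?thesis unfolding e by (intro tendsto_intros N nz aT)
  qed
  \<comment> \<open>At \<open>n = 0\<close> this is equivalent to the upper bound on
    \<open>lam\<close>. Since \<open>r1 = a - 1 / c\<close>, it says that the limiting
    \<open>r1\<close> is positive.\<close>
  have ca: "1 < c 0 * a 0"
  proof -
    have "lam * D < 2 * (al - m) * (1 + lam)" using gap by (simp add: D_def algebra_simps)
    moreover have "c 0 * a 0 = 2 * (al - m) * (1 + lam) / (lam * D)"
    proof -
      have "x / (lam * w) * (2 * w * v / D) = 2 * x * v / (lam * D)" if "w > 0" for x v w :: real using that by simp
      from this[OF al1] show ?thesis unfolding c_0 a_0 .
    qed
    ultimately show ?thesis using assms D0 by (simp add: pos_less_divide_eq)
  qed
  \<comment> \<open>The right-hand side equals \<open>2 + 2 / lam\<close>, so \<open>b 0 < 2\<close>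
    is what has to hold; the bound on \<open>lam\<close> even gives \<open>b 0 < 1\<close>.\<close>
  have tr: "2 + b 0 / lam < (1 + 1/(lam * c 0)) * (c 0 * a 0)"
  proof -
    have "(1 + m) * (1 + lam) < D" using gap by (simp add: D_def algebra_simps)
    then have b1: "b 0 < 1" using D0 by (simp add: b_0 pos_divide_less_eq)
    have "(1 + 1/(lam * c 0)) * (c 0 * a 0) = a 0 * (c 0 + 1 / lam)" using pos0 assms by (simp add: field_simps)
    also have "c 0 + 1 / lam = D / (lam * (1 + al))"
    proof -
      have "1 / lam = (1 + al) / (lam * (1 + al))" using al1 by simp
      then have "c 0 + 1 / lam = ((al - m) + (1 + al)) / (lam * (1 + al))" by (simp only: c_0 add_divide_distrib)
      also have "(al - m) + (1 + al) = D" by (simp add: D_def)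
      finally show ?thesis .
    qed
    also have "a 0 * (D / (lam * (1 + al))) = 2 * (1 + lam) / lam"
    proof -
      have "2 * w * v / D * (D / (lam * w)) = 2 * v / lam" if "w > 0" for v w :: real using that D0 by simp
      from this[OF al1] show ?thesis unfolding a_0 .
    qed
    also have "\<dots> = 2 + 2 / lam" using assms by (simp add: field_simps)
    finally have e: "(1 + 1/(lam * c 0)) * (c 0 * a 0) = 2 + 2 / lam" .
    have "b 0 / lam < 2 / lam" using b1 assms by (intro divide_strict_right_mono) auto
    then show ?thesis unfolding e by simp
  qed
  \<comment> \<open>The right-hand side is \<open>(1 + al) / (al - m)\<close>, which exceeds 1
    because \<open>m > -1\<close>.\<close>
  have gam: "1 < 1/(lam * c 0)" using assms al1 by (simp add: c_0 pos_less_divide_eq)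
  obtain U d Q P Z e V0 gX g0 g1 k3 th M Cs Sig eta LR :: real and J where
    ev: "\<forall>\<^sub>F n in at_right 0. slow_fast_limits lam al n (c n) (a n) (b n) (S n) Q P Z e V0 gX g0 g1 k3 th M Cs J U d Sig eta LR"
    by (rule slow_fast_constants_exist[OF cT aT bT ST assms(4,1) pos0 ca tr gam]) (rule that)
  have "((\<lambda>n. Delta1 al m n lam) \<longlongrightarrow>
      (1 - S 0) / lam * ((1 + al) / lam * a 0 + 2 / S 0) - 0 / a 0 * (1 / lam + 2) * (a 0 / lam + 2 / S 0)) (at_right 0)"
  proof -
    have e: "(\<lambda>n. Delta1 al m n lam) = (\<lambda>n. (1 - S n) / lam * ((1 + al) / lam * a n + 2 / S n) - n / a n * (1 / lam + 2) * (a n / lam + 2 / S n))"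
      by (simp add: Delta1_def Let_def r0_def a_def S_def)
    show ?thesis unfolding e by (intro tendsto_intros N nz aT ST)
  qed
  \<comment> \<open>At \<open>n = 0\<close> the subtracted term vanishes, and \<open>S 0 < 1\<close>
    because \<open>m < al\<close>. Hence the denominator of \<open>y1\<close> and \<open>z1\<close>
    is nonzero for small \<open>n\<close>.\<close>
  moreover have "0 < (1 - S 0) / lam * ((1 + al) / lam * a 0 + 2 / S 0) - 0 / a 0 * (1 / lam + 2) * (a 0 / lam + 2 / S 0)"
  proof -
    have "S 0 < 1" using assms al1 by (simp add: S_0)
    then show ?thesis using assms al1 pos0 by (auto intro!: divide_pos_pos mult_pos_pos add_pos_pos)
  qed
  ultimately have ev_Delta: "\<forall>\<^sub>F n in at_right 0. 0 < Delta1 al m n lam" by (rule order_tendstoD)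
  have ev_al: "\<forall>\<^sub>F n in at_right 0. 0 < al - m - n"
  proof (rule order_tendstoD)
    show "((\<lambda>n. al - m - n) \<longlongrightarrow> al - m - 0) (at_right 0)" by (intro tendsto_intros N)
  qed (use assms in simp)
  \<comment> \<open>At \<open>n = 0\<close> the bound becomes \<open>2 * (al - m) / (1 + m)\<close>,
    so the strict hypothesis persists for small \<open>n\<close>.\<close>
  have ev_lam: "\<forall>\<^sub>F n in at_right 0. lam < 2 * (al - m - n) * (1 + m) / (1 + m + n)^2"
  proof (rule order_tendstoD)
    show "((\<lambda>n. 2 * (al - m - n) * (1 + m) / (1 + m + n)^2) \<longlongrightarrow> 2 * (al - m - 0) * (1 + m) / (1 + m + 0)^2) (at_right 0)"
      by (intro tendsto_intros N) (use m1 in simp)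
    show "lam < 2 * (al - m - 0) * (1 + m) / (1 + m + 0)^2"
      using assms m1 by (simp add: power2_eq_square)
  qed
  from ev ev_Delta ev_al ev_lam show ?thesis
  proof (intro eventually_at_right_0_D, eventually_elim)
    case (elim n)
    then interpret slow_fast_limits lam al n "c n" "a n" "b n" "S n" Q P Z e V0 gX g0 g1 k3 th M Cs J U d Sig eta LR
      by simp
    have Delta: "Delta1 al m n lam \<noteq> 0" using elim by simp
    show ?case
    proof (intro conjI)
      show "- al + m + n < 0" "0 < lam" "lam < 2 * (al - m - n) * (1 + m) / (1 + m + n)^2"
        using elim assms(4) by simp_all
    qed (rule heteroclinic_orbit_exists[OF c_def[THEN fun_cong] a_def[THEN fun_cong] b_def[THEN fun_cong] S_def[THEN fun_cong] Delta])
  qed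
qed

end
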